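(* Let $\ell\ge 2$ be an integer, let $L\neq 2$ be a prime, and let $c\ge 1$ be an integer. Let $q=p^d$ range over the powers of primes $p\ne L$ such that $\delta_L(p)\mid d$ (equivalently $L\mid q-1$) and $v_L(q-1)=c$. Then $$\lim_{\substack{q\to\infty\\ v_L(q-1)=c}}\frac{|\operatorname{Per}(x^L,\mathrm{M}_\ell(q))|}{|\mathrm{M}_\ell(q)|}=\lim_{\substack{q\to\infty\\ v_L(q-1)=c}}\frac{|\operatorname{Per}(x^L,\mathrm{GL}_\ell(q))|}{|\mathrm{GL}_\ell(q)|}=\sum_{\lambda\vdash \ell}\ \prod_{i=1}^{r}\frac{1}{(\lambda_i)^{m_i}\,m_i!}\cdot\frac{1}{L^{m_i v_L(q^{\lambda_i}-1)}},$$ where the sum runs over all partitions $\lambda=(\lambda_1^{m_1},\lambda_2^{m_2},\ldots,\lambda_r^{m_r})$ of $\ell$ (with distinct parts $\lambda_1,\dots,\lambda_r$ of multiplicities $m_1,\dots,m_r\ge 1$).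
   Context: $\mathrm{M}_\ell(q)$ is the algebra of $\ell\times\ell$ matrices over the finite field $\mathbb{F}_q$, and $\mathrm{GL}_\ell(q)=\mathrm{M}_\ell(q)^\times$. For a set $S$ and a self-map $f:S\to S$, a point $\alpha\in S$ is periodic if $f^n(\alpha)=\alpha$ for some $n>1$, where $f^n$ is the $n$-fold composite; $\operatorname{Per}(f,S)$ is the set of periodic points. Here $x^L$ denotes the map $x\mapsto x^L$. $v_L$ is the $L$-adic valuation, and $\delta_L(p)$ is the multiplicative order of $p$ modulo $L$. On the right-hand side $q$ is any admissible prime power with $v_L(q-1)=c$; since $L$ is odd and $L\mid q-1$, $v_L(q^k-1)=c+v_L(k)$ depends only on $c$ and $k$. *)

theory Defs
  imports
    "HOL-Number_Theory.Number_Theory"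
    "HOL-Library.Multiset"
    "Jordan_Normal_Form.Matrix"
begin

(* The library's matrix multiplication works over a type class. Here the field of coefficients
   varies inside a limit, so it must be a ring record and the operations are spelled out. *)
definition mat_ring :: "('a, 'b) ring_scheme \<Rightarrow> nat \<Rightarrow> 'a mat ring" where
  "mat_ring R n =
    \<lparr> carrier = {A \<in> carrier_mat n n. elements_mat A \<subseteq> carrier R},
      monoid.mult = (\<lambda>A B. mat n n (\<lambda>(i, j). \<Oplus>\<^bsub>R\<^esub>k\<in>{..<n}. A $$ (i, k) \<otimes>\<^bsub>R\<^esub> B $$ (k, j))),
      one = mat n n (\<lambda>(i, j). if i = j then \<one>\<^bsub>R\<^esub> else \<zero>\<^bsub>R\<^esub>),
      ring.zero = mat n n (\<lambda>(i, j). \<zero>\<^bsub>R\<^esub>),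
      ring.add = (\<lambda>A B. mat n n (\<lambda>(i, j). A $$ (i, j) \<oplus>\<^bsub>R\<^esub> B $$ (i, j))) \<rparr>"

(* "n > 1" and "n > 0" give the same set: iterate a period once more. *)
definition Per :: "('a \<Rightarrow> 'a) \<Rightarrow> 'a set \<Rightarrow> 'a set" where
  "Per f S = {\<alpha> \<in> S. \<exists>n>1. (f ^^ n) \<alpha> = \<alpha>}"

definition Per_ratio :: "('a \<Rightarrow> 'a) \<Rightarrow> 'a set \<Rightarrow> real" where
  "Per_ratio f S = real (card (Per f S)) / real (card S)"

definition admissible :: "nat \<Rightarrow> nat \<Rightarrow> nat \<Rightarrow> bool" where
  "admissible L c q \<longleftrightarrow>
    (\<exists>p d. prime p \<and> p \<noteq> L \<and> d > 0 \<and> q = p ^ d \<and> ord L p dvd d) \<and> multiplicity L (q - 1) = c"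

definition admissible_at_top :: "nat \<Rightarrow> nat \<Rightarrow> nat filter" where
  "admissible_at_top L c = inf at_top (principal {q. admissible L c q})"

(* A partition of l is the multiset of its parts: the distinct parts form its set_mset, and
   the multiplicity of a part is its count. *)
definition partitions :: "nat \<Rightarrow> nat multiset set" where
  "partitions l = {P. (\<forall>k\<in>#P. k > 0) \<and> sum_mset P = l}"

end

theory Submission
  imports Defs "HOL-Algebra.Polynomial_Divisibility"
begin

hide_const (open) Divisibility.prime Divisibility.irreducible Ring_Divisibility.mult_of
hide_fact (open) Ring_Divisibility.nat_pow_mult_of

text \<open>
  Call a matrix or a monic polynomial \<open>f\<close> good if \<open>A^(L^m) = A\<close>, respectively
  \<open>f dvd X^(L^m) - X\<close>, for some \<open>m > 1\<close>. Conjugating the companion matrix of \<open>f\<close> by \<open>B\<close> and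
  recording \<open>B e\<^sub>0\<close> injects \<open>GL\<^sub>l \<times> {monic f of degree l}\<close> into \<open>M\<^sub>l \<times> F^l\<close> and preserves
  goodness. Since \<open>|GL\<^sub>l| / |M\<^sub>l|\<close> tends to 1, the density of good matrices has the same limit as
  the density of good polynomials; no conjugacy classes or centralizers are needed.

  Up to polynomials with a repeated factor, which are negligible, the good polynomials are the
  products of good irreducibles. Counting pairs (good \<open>f\<close>, irreducible divisor of \<open>f\<close>) weighted by the
  degree of the divisor gives a recurrence for the density in degree \<open>l\<close>, and the sum over
  partitions satisfies the same recurrence. Finally, with \<open>q^k - 1 = L^v N\<close> and \<open>L\<close> not dividing \<open>N\<close>,
  the good irreducibles of degree \<open>k\<close> other than \<open>X\<close> are the irreducible factors of degree \<open>k\<close> of the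
  squarefree polynomial \<open>X^N - 1\<close>, so there are about \<open>q^k / (k L^v)\<close> of them.
\<close>

section \<open>Sums over partitions\<close>

text \<open>An injection by itself bounds the good matrices only from below. Applied to the bad
  polynomials as well, it bounds the bad matrices from below too. Domain and codomain have sizes in
  the ratio |GL_l| : |M_l|, so the two bounds pinch the density as soon as this ratio tends to 1.
  Goodness does not imply squarefreeness: X^(L^m) - X has repeated factors when the characteristic
  divides L^m - 1. The good polynomials are therefore sandwiched between the squarefree products of
  good irreducibles and all products of good irreducibles, and neither bound is exact. The
  recurrence likewise splits into two inequalities, one for each of these families, which agree up
  to lower order. The limit is taken over varying fields but compared with fixed numbers. This works
  because L is odd: then v = c + v_L(k), so the density 1/(k L^v) of good irreducibles of degree k
  is the same for all admissible q.\<close>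

definition partition_weight :: "(nat \<Rightarrow> real) \<Rightarrow> nat multiset \<Rightarrow> real" where
  "partition_weight a P = (\<Prod>k\<in>set_mset P. a k ^ count P k / fact (count P k))"

text \<open>The coefficient of t^n in exp(sum over k >= 1 of a_k t^k).\<close>

definition partition_sum :: "(nat \<Rightarrow> real) \<Rightarrow> nat \<Rightarrow> real" where
  "partition_sum a n = (\<Sum>P\<in>partitions n. partition_weight a P)"

lemma partition_member_le:
  assumes "P \<in> partitions n" "k \<in># P"
  shows "0 < k" "k \<le> n"
  using assms sum_mset.remove[of k P] by (auto simp: partitions_def)

lemma sum_mset_count_sum: "sum_mset P = (\<Sum>k\<in>set_mset P. count P k * k)" for P :: "nat multiset"
proof (induction P)
  case (add x P)
  have "(\<Sum>k\<in>set_mset (add_mset x P). count (add_mset x P) k * k)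
      = (\<Sum>k\<in>insert x (set_mset P). count P k * k + (if k = x then k else 0))"
    by (intro sum.cong) auto
  also have "\<dots> = (\<Sum>k\<in>insert x (set_mset P). count P k * k) + x"
    by (simp add: sum.distrib sum.delta)
  also have "(\<Sum>k\<in>insert x (set_mset P). count P k * k) = (\<Sum>k\<in>set_mset P. count P k * k)"
    by (rule sum.mono_neutral_right) (auto simp: not_in_iff)
  finally show ?case using add by simp
qed simp

lemma finite_partitions: "finite (partitions n)"
proof (rule finite_subset)
  show "partitions n \<subseteq> mset ` {xs. set xs \<subseteq> {..n} \<and> length xs \<le> n}"
  proof
    fix P assume P: "P \<in> partitions n"
    have "size P = (\<Sum>k\<in>#P. 1)" by simp
    also have "\<dots> \<le> (\<Sum>k\<in>#P. k)"
      by (rule sum_mset_mono) (use P in \<open>auto simp: partitions_def Suc_le_eq\<close>)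
    also have "\<dots> = n" using P by (simp add: partitions_def)
    finally have sz: "size P \<le> n" .
    obtain xs where xs: "mset xs = P" using ex_mset by blast
    have "set xs \<subseteq> {..n}" using partition_member_le[OF P] xs by (metis atMost_iff set_mset_mset subsetI)
    moreover have "length xs \<le> n" using sz xs by (metis size_mset)
    ultimately show "P \<in> mset ` {xs. set xs \<subseteq> {..n} \<and> length xs \<le> n}" using xs by blast
  qed
qed (use finite_lists_length_le[of "{..n}" n] in simp)

lemma partition_weight_superset:
  assumes "finite A" "set_mset P \<subseteq> A"
  shows "partition_weight a P = (\<Prod>k\<in>A. a k ^ count P k / fact (count P k))"
  unfolding partition_weight_def
  by (rule prod.mono_neutral_left) (use assms in \<open>auto simp: not_in_iff\<close>)

text \<open>One more part k turns a_k^m / m! into a_k^(m+1) / (m+1)!; the factor m + 1 is cleared to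
  the left.\<close>

lemma partition_weight_add_mset:
  "real (Suc (count P k)) * partition_weight a (add_mset k P) = a k * partition_weight a P"
proof -
  let ?A = "insert k (set_mset P)"
  have "partition_weight a (add_mset k P)
      = (\<Prod>j\<in>?A. a j ^ count (add_mset k P) j / fact (count (add_mset k P) j))"
    by (rule partition_weight_superset) auto
  also have "\<dots> = a k ^ Suc (count P k) / fact (Suc (count P k))
      * (\<Prod>j\<in>?A - {k}. a j ^ count P j / fact (count P j))"
    by (subst prod.remove[of _ k]) (auto intro!: prod.cong)
  finally have 1: "partition_weight a (add_mset k P) = \<dots>" .
  have "partition_weight a P = (\<Prod>j\<in>?A. a j ^ count P j / fact (count P j))"
    by (rule partition_weight_superset) auto
  also have "\<dots> = a k ^ count P k / fact (count P k)
      * (\<Prod>j\<in>?A - {k}. a j ^ count P j / fact (count P j))"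
    by (subst prod.remove[of _ k]) auto
  finally have 2: "partition_weight a P = \<dots>" .
  define Q where "Q = (\<Prod>j\<in>?A - {k}. a j ^ count P j / fact (count P j))"
  show ?thesis unfolding 1 2 Q_def[symmetric] by (simp add: divide_simps del: of_nat_Suc)
qed

lemma partition_sum_0 [simp]: "partition_sum a 0 = 1"
proof -
  have "partitions 0 = {{#}}" by (auto simp: partitions_def) (metis multiset_nonemptyE not_gr0)
  thus ?thesis by (simp add: partition_sum_def partition_weight_def)
qed

text \<open>The logarithmic derivative of exp(sum of a_k t^k), compared coefficientwise. Writing n
  as the sum of the parts of P with multiplicity turns the left side into a sum over pairs of a
  partition and one of its parts.\<close>

lemma partition_sum_rec:
  "real n * partition_sum a n = (\<Sum>k=1..n. real k * a k * partition_sum a (n - k))"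
proof -
  have "real n * partition_weight a P
      = (\<Sum>k\<in>set_mset P. real k * real (count P k) * partition_weight a P)"
    if "P \<in> partitions n" for P
  proof -
    have "real n = real (\<Sum>k\<in>set_mset P. count P k * k)"
      using that by (simp add: partitions_def sum_mset_count_sum)
    thus ?thesis by (simp add: sum_distrib_left mult_ac)
  qed
  hence "real n * partition_sum a n = (\<Sum>P\<in>partitions n. \<Sum>k\<in>set_mset P.
      real k * real (count P k) * partition_weight a P)"
    by (simp add: partition_sum_def sum_distrib_left)
  also have "\<dots> = (\<Sum>(P,k)\<in>Sigma (partitions n) set_mset.
      real k * real (count P k) * partition_weight a P)"
    by (rule sum.Sigma) (auto simp: finite_partitions)
  \<comment> \<open>Removing the chosen part matches (P, k) with (k, P - {#k#}); the factor
    \<open>count P k\<close> is absorbed by the factorial.\<close>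
  also have "\<dots> = (\<Sum>(k,P)\<in>Sigma {1..n} (\<lambda>k. partitions (n - k)). real k * a k * partition_weight a P)"
  proof -
    have A: "k \<in> {1..n}" "P - {#k#} \<in> partitions (n - k)"
      "real k * a k * partition_weight a (P - {#k#}) = real k * real (count P k) * partition_weight a P"
      if P: "P \<in> partitions n" and k: "k \<in># P" for P k
    proof -
      show "k \<in> {1..n}" using partition_member_le[OF P k] by simp
      show "P - {#k#} \<in> partitions (n - k)"
        using P k sum_mset.remove[OF k] by (auto simp: partitions_def dest: in_diffD)
      have "Suc (count (P - {#k#}) k) = count P k" using k by simp
      hence "real (count P k) * partition_weight a P = a k * partition_weight a (P - {#k#})"
        using partition_weight_add_mset[of "P - {#k#}" k a] k by (metis insert_DiffM)
      thus "real k * a k * partition_weight a (P - {#k#}) = real k * real (count P k) * partition_weight a P"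
        by (simp add: mult_ac)
    qed
    have B: "add_mset k P \<in> partitions n" if "k \<in> {1..n}" "P \<in> partitions (n - k)" for P k
      using that by (auto simp: partitions_def)
    show ?thesis
      by (rule sum.reindex_bij_witness[of _ "\<lambda>(k,P). (add_mset k P, k)" "\<lambda>(P,k). (k, P - {#k#})"])
         (use A B in \<open>auto simp del: atLeastAtMost_iff\<close>)
  qed
  also have "\<dots> = (\<Sum>k=1..n. \<Sum>P\<in>partitions (n - k). real k * a k * partition_weight a P)"
    by (rule sum.Sigma[symmetric]) (auto simp: finite_partitions)
  finally show ?thesis by (simp add: partition_sum_def sum_distrib_left)
qed

text \<open>Meant for x q = q, with N counting the irreducibles of degree k in some set, G the monic
  polynomials of degree n built from them and H the squarefree ones among these. The sums in the
  hypotheses involve G in degrees below n only, so strong induction yields their limits.\<close>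

lemma tendsto_partition_sum:
  fixes x :: "'b \<Rightarrow> real" and N G H :: "'b \<Rightarrow> nat \<Rightarrow> real"
  assumes x: "filterlim x at_top F"
    and N: "\<And>k. k \<ge> 1 \<Longrightarrow> ((\<lambda>q. N q k / x q ^ k) \<longlongrightarrow> a k) F"
    and zero: "\<forall>\<^sub>F q in F. G q 0 = 1 \<and> H q 0 = 1"
    and HG: "\<And>n. \<forall>\<^sub>F q in F. H q n \<le> G q n"
    and upper: "\<And>n. \<forall>\<^sub>F q in F. real n * H q n \<le> (\<Sum>k=1..n. real k * N q k * G q (n - k))"
    and lower: "\<And>n. \<forall>\<^sub>F q in F. (\<Sum>k=1..n. real k * N q k * G q (n - k)) \<le> real n * G q n"
    and diff: "\<And>n. \<forall>\<^sub>F q in F. G q n \<le> H q n + (\<Sum>k=1..n div 2. N q k * G q (n - 2 * k))"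
  shows "((\<lambda>q. G q n / x q ^ n) \<longlongrightarrow> partition_sum a n) F
       \<and> ((\<lambda>q. H q n / x q ^ n) \<longlongrightarrow> partition_sum a n) F"
proof (induction n rule: less_induct)
  case (less n)
  have xpos: "\<forall>\<^sub>F q in F. x q > 0"
    using x by (auto simp: filterlim_at_top_dense)
  show ?case
  proof (cases "n = 0")
    case True
    have "\<forall>\<^sub>F q in F. 1 = G q 0 / x q ^ 0" "\<forall>\<^sub>F q in F. 1 = H q 0 / x q ^ 0"
      using zero by (auto elim: eventually_mono)
    thus ?thesis using True by (auto intro: Lim_transform_eventually[OF tendsto_const])
  next
    case False
    define T where "T q = (\<Sum>k=1..n. real k * N q k * G q (n - k))" for q
    define E where "E q = (\<Sum>k=1..n div 2. N q k * G q (n - 2 * k))" for q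
    have "((\<lambda>q. \<Sum>k=1..n. real k * (N q k / x q ^ k) * (G q (n - k) / x q ^ (n - k)))
        \<longlongrightarrow> (\<Sum>k=1..n. real k * a k * partition_sum a (n - k))) F"
      using less.IH False by (intro tendsto_sum tendsto_mult tendsto_const N) auto
    moreover have "\<forall>\<^sub>F q in F. (\<Sum>k=1..n. real k * (N q k / x q ^ k) * (G q (n - k) / x q ^ (n - k)))
        = T q / x q ^ n"
      using xpos
    proof eventually_elim
      case (elim q)
      show ?case unfolding T_def sum_divide_distrib
        by (intro sum.cong refl) (use elim in \<open>auto simp: field_simps simp flip: power_add\<close>)
    qed
    ultimately have "((\<lambda>q. T q / x q ^ n) \<longlongrightarrow> real n * partition_sum a n) F"
      unfolding partition_sum_rec by (rule Lim_transform_eventually)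
    hence "((\<lambda>q. T q / x q ^ n / real n) \<longlongrightarrow> real n * partition_sum a n / real n) F"
      using False by (intro tendsto_divide tendsto_const) auto
    hence T: "((\<lambda>q. T q / x q ^ n / real n) \<longlongrightarrow> partition_sum a n) F"
      using False by simp
    \<comment> \<open>A square p^2 uses up 2k degrees while p ranges over about x^k choices, so N_k
      G_(n-2k) has order x^(n-k). After division by x^n a factor x^k with k >= 1 remains in the
      denominator.\<close>
    have "((\<lambda>q. \<Sum>k=1..n div 2. N q k / x q ^ k * (G q (n - 2 * k) / x q ^ (n - 2 * k)) / x q ^ k)
        \<longlongrightarrow> (\<Sum>k=1..n div 2. 0)) F"
    proof (intro tendsto_sum)
      fix k assume k: "k \<in> {1..n div 2}"
      have 1: "((\<lambda>q. N q k / x q ^ k * (G q (n - 2 * k) / x q ^ (n - 2 * k)))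
          \<longlongrightarrow> a k * partition_sum a (n - 2 * k)) F"
        using less.IH k False by (intro tendsto_mult N) auto
      have 2: "filterlim (\<lambda>q. x q ^ k) at_top F"
        using k by (intro filterlim_pow_at_top x) auto
      show "((\<lambda>q. N q k / x q ^ k * (G q (n - 2 * k) / x q ^ (n - 2 * k)) / x q ^ k) \<longlongrightarrow> 0) F"
        by (rule real_tendsto_divide_at_top[OF 1 2])
    qed
    moreover have "\<forall>\<^sub>F q in F. (\<Sum>k=1..n div 2. N q k / x q ^ k * (G q (n - 2 * k) / x q ^ (n - 2 * k)) / x q ^ k)
        = E q / x q ^ n"
      using xpos
    proof eventually_elim
      case (elim q)
      show ?case unfolding E_def sum_divide_distrib
      proof (intro sum.cong refl)
        fix k assume "k \<in> {1..n div 2}"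
        hence "n = k + (n - 2 * k) + k" by auto
        hence "x q ^ n = x q ^ k * x q ^ (n - 2 * k) * x q ^ k" by (metis power_add)
        thus "N q k / x q ^ k * (G q (n - 2 * k) / x q ^ (n - 2 * k)) / x q ^ k
            = N q k * G q (n - 2 * k) / x q ^ n"
          by simp
      qed
    qed
    ultimately have E: "((\<lambda>q. E q / x q ^ n) \<longlongrightarrow> 0) F"
      using Lim_transform_eventually by fastforce
    have G: "((\<lambda>q. G q n / x q ^ n) \<longlongrightarrow> partition_sum a n) F"
    proof (rule tendsto_sandwich)
      show "\<forall>\<^sub>F q in F. T q / x q ^ n / real n \<le> G q n / x q ^ n"
        using lower[of n] xpos
      proof eventually_elim
        case (elim q)
        thus ?case using False unfolding T_def[symmetric] by (simp add: field_simps)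
      qed
      \<comment> \<open>The recurrence bounds H, not G, from above; G is reached as H plus the
        error.\<close>
      show "\<forall>\<^sub>F q in F. G q n / x q ^ n \<le> T q / x q ^ n / real n + E q / x q ^ n"
        using diff[of n] upper[of n] xpos
      proof eventually_elim
        case (elim q)
        have "H q n \<le> T q / real n" using elim False unfolding T_def[symmetric] by (simp add: field_simps)
        hence "G q n \<le> T q / real n + E q" using elim unfolding E_def[symmetric] by simp
        hence "G q n / x q ^ n \<le> (T q / real n + E q) / x q ^ n"
          using elim by (intro divide_right_mono) auto
        thus ?case by (simp add: add_divide_distrib mult.commute)
      qed
      show "((\<lambda>q. T q / x q ^ n / real n + E q / x q ^ n) \<longlongrightarrow> partition_sum a n) F"
        using tendsto_add[OF T E] by simp
    qed (rule T)
    moreover have "((\<lambda>q. H q n / x q ^ n) \<longlongrightarrow> partition_sum a n) F"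
    proof (rule tendsto_sandwich)
      show "\<forall>\<^sub>F q in F. G q n / x q ^ n - E q / x q ^ n \<le> H q n / x q ^ n"
        using diff[of n] xpos
        by eventually_elim (simp add: E_def divide_right_mono flip: diff_divide_distrib)
      show "\<forall>\<^sub>F q in F. H q n / x q ^ n \<le> G q n / x q ^ n"
        using HG[of n] xpos by eventually_elim (simp add: divide_right_mono)
      show "((\<lambda>q. G q n / x q ^ n - E q / x q ^ n) \<longlongrightarrow> partition_sum a n) F"
        using tendsto_diff[OF G E] by simp
    qed (rule G)
    ultimately show ?thesis ..
  qed
qed

section \<open>Lifting the exponent\<close>

lemma power_eq_geometric: "Suc a ^ m = 1 + a * (\<Sum>i<m. Suc a ^ i)"
  by (induction m) (auto simp: algebra_simps)

text \<open>Modulo L every power of q is 1, so the cofactor 1 + q + ... + q^(m-1) is congruent to m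
  and contributes no factor L.\<close>

lemma multiplicity_power_minus_1_coprime:
  fixes q :: nat
  assumes "prime L" "L dvd q - 1" "q > 1" "\<not> L dvd m"
  shows "multiplicity L (q ^ m - 1) = multiplicity L (q - 1)"
proof -
  define S where "S = (\<Sum>i<m. q ^ i)"
  have eq: "q ^ m - 1 = (q - 1) * S"
    using power_eq_geometric[of "q - 1" m] assms(3) by (simp add: S_def)
  have "[q = 1] (mod L)" 
    using assms(2,3) cong_altdef_nat[of 1 q L] by simp
  hence "[S = (\<Sum>i<m. 1 ^ i)] (mod L)"
    unfolding S_def by (intro cong_sum cong_pow)
  hence S: "\<not> L dvd S" using assms(4) by (simp add: cong_dvd_iff)
  hence "S \<noteq> 0" by (metis dvd_0_right)
  thus ?thesis unfolding eq
    using assms S by (simp add: prime_elem_multiplicity_mult_distrib not_dvd_imp_multiplicity_0)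
qed

text \<open>The cofactor 1 + q + ... + q^(L-1) must contain L exactly once, which requires its value
  modulo L^2. Oddness of L enters through 0 + 1 + ... + (L-1) = L h with the integer h =
  (L-1)/2.\<close>

lemma multiplicity_power_prime_minus_1:
  fixes q :: nat
  assumes "prime L" "L \<noteq> 2" "L dvd q - 1" "q > 1"
  shows "multiplicity L (q ^ L - 1) = Suc (multiplicity L (q - 1))"
proof -
  define S where "S = (\<Sum>i<L. q ^ i)"
  have eq: "q ^ L - 1 = (q - 1) * S"
    using power_eq_geometric[of "q - 1" L] assms(4) by (simp add: S_def)
  obtain u where u: "q = 1 + L * u" using assms(3,4) by (metis dvdE le_add_diff_inverse less_imp_le_nat)
  \<comment> \<open>The first two terms of the binomial expansion of (1 + L u)^i; all others are
    multiples of L^2.\<close>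
  have "\<exists>t. q ^ i = 1 + i * L * u + L * L * t" for i
  proof (induction i)
    case (Suc i)
    then obtain t where "q ^ i = 1 + i * L * u + L * L * t" by blast
    hence "q ^ Suc i = 1 + Suc i * L * u + L * L * (t + i * u * u + t * L * u)"
      by (simp add: u algebra_simps)
    thus ?case by blast
  qed (auto intro: exI[of _ 0])
  then obtain t where t: "\<And>i. q ^ i = 1 + i * L * u + L * L * t i" by metis
  have "odd L" using assms(1,2) prime_odd_nat prime_ge_2_nat le_neq_implies_less by metis
  then obtain h where h: "L = 2 * h + 1" by (elim oddE)
  have "2 * (\<Sum>i<L. i) = L * (L - 1)"
    using gauss_sum_nat[of "L - 1"] h by (simp add: lessThan_Suc_atMost atLeast0AtMost)
  hence "(\<Sum>i<L. i) = L * h" using h by simp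
  hence "S = L + L * h * L * u + L * L * (\<Sum>i<L. t i)"
    unfolding S_def t by (simp add: sum.distrib mult.assoc del: add_Suc One_nat_def flip: sum_distrib_left sum_distrib_right)
  also have "\<dots> = L * (1 + L * (h * u + (\<Sum>i<L. t i)))" by (simp add: algebra_simps)
  finally have S: "S = L * (1 + L * (h * u + (\<Sum>i<L. t i)))" .
  have "\<not> L dvd 1 + L * (h * u + (\<Sum>i<L. t i))"
    using assms(1) by (metis dvd_add_left_iff dvd_triv_left not_prime_unit)
  hence "multiplicity L S = 1"
    unfolding S using assms(1)
    by (subst prime_elem_multiplicity_mult_distrib) (auto simp: not_dvd_imp_multiplicity_0 multiplicity_self)
  moreover have "S \<noteq> 0" unfolding S using assms(1) by auto
  ultimately show ?thesis unfolding eq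
    using assms by (simp add: prime_elem_multiplicity_mult_distrib)
qed

text \<open>Each factor L of k is split off by viewing q^k as the L-th power of q^j with j = k / L,
  which raises the valuation by one. Exponents prime to L leave it unchanged.\<close>

lemma multiplicity_power_minus_1:
  fixes q :: nat
  assumes "prime L" "L \<noteq> 2" "L dvd q - 1" "q > 1" "k > 0"
  shows "multiplicity L (q ^ k - 1) = multiplicity L (q - 1) + multiplicity L k"
  using assms(5)
proof (induction k rule: less_induct)
  case (less k)
  show ?case
  proof (cases "L dvd k")
    case False
    thus ?thesis using multiplicity_power_minus_1_coprime[OF assms(1,3,4) False]
      by (simp add: not_dvd_imp_multiplicity_0)
  next
    case True
    then obtain j where j: "k = L * j" by blast
    have "j > 0" "j < k" using j less.prems prime_gt_1_nat[OF assms(1)] by auto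
    have "1 < q ^ j" using assms(4) \<open>j > 0\<close> by (intro one_less_power)
    have "q - 1 dvd q ^ j - 1"
      using power_eq_geometric[of "q - 1" j] assms(4) by simp
    hence "L dvd q ^ j - 1" using assms(3) dvd_trans by blast
    hence "multiplicity L ((q ^ j) ^ L - 1) = Suc (multiplicity L (q ^ j - 1))"
      using assms \<open>1 < q ^ j\<close> by (intro multiplicity_power_prime_minus_1)
    also have "(q ^ j) ^ L = q ^ k" by (simp add: j mult.commute flip: power_mult)
    also have "multiplicity L (q ^ j - 1) = multiplicity L (q - 1) + multiplicity L j"
      using less.IH \<open>j > 0\<close> \<open>j < k\<close> by blast
    finally show ?thesis
      using assms(1) \<open>j > 0\<close> by (simp add: j prime_elem_multiplicity_mult_distrib multiplicity_self)
  qed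
qed

section \<open>The Frobenius map\<close>

text \<open>Pascal's rule: multiplication by x shifts the index of the summands, multiplication by y
  does not, and the aligned sums are added termwise.\<close>

lemma (in cring) binomial_ring:
  assumes x: "x \<in> carrier R" and y: "y \<in> carrier R"
  shows "(x \<oplus> y) [^] n = (\<Oplus>i\<in>{..n}. [(n choose i)] \<cdot> (x [^] i \<otimes> y [^] (n - i)))"
proof (induction n)
  case 0
  show ?case using x y by simp
next
  case (Suc n)
  define t where "t i = x [^] i \<otimes> y [^] (Suc n - i)" for i
  have t [simp]: "t i \<in> carrier R" for i using x y by (simp add: t_def)
  have "(x \<oplus> y) [^] Suc n = (\<Oplus>i\<in>{..n}. [(n choose i)] \<cdot> (x [^] i \<otimes> y [^] (n - i))) \<otimes> x
      \<oplus> (\<Oplus>i\<in>{..n}. [(n choose i)] \<cdot> (x [^] i \<otimes> y [^] (n - i))) \<otimes> y"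
    using x y by (simp add: Suc r_distr finsum_closed Pi_def)
  also have "(\<Oplus>i\<in>{..n}. [(n choose i)] \<cdot> (x [^] i \<otimes> y [^] (n - i))) \<otimes> x
      = (\<Oplus>i\<in>{..n}. [(n choose i)] \<cdot> t (Suc i))"
  proof (subst finsum_ldistr)
    show "(\<Oplus>i\<in>{..n}. [(n choose i)] \<cdot> (x [^] i \<otimes> y [^] (n - i)) \<otimes> x)
        = (\<Oplus>i\<in>{..n}. [(n choose i)] \<cdot> t (Suc i))"
      using x y by (intro finsum_cong') (auto simp: add_pow_ldistr add_pow_rdistr t_def m_ac)
  qed (use x y in auto)
  also have "(\<Oplus>i\<in>{..n}. [(n choose i)] \<cdot> (x [^] i \<otimes> y [^] (n - i))) \<otimes> y
      = (\<Oplus>i\<in>{..n}. [(n choose i)] \<cdot> t i)"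
  proof (subst finsum_ldistr)
    show "(\<Oplus>i\<in>{..n}. [(n choose i)] \<cdot> (x [^] i \<otimes> y [^] (n - i)) \<otimes> y)
        = (\<Oplus>i\<in>{..n}. [(n choose i)] \<cdot> t i)"
      using x y by (intro finsum_cong') (auto simp: add_pow_ldistr add_pow_rdistr t_def m_ac Suc_diff_le)
  qed (use x y in auto)
  \<comment> \<open>The new top term vanishes because \<open>n choose Suc n\<close> is 0. Splitting
    off index 0 afterwards aligns this sum with the shifted one.\<close>
  also have "(\<Oplus>i\<in>{..n}. [(n choose i)] \<cdot> t i) = (\<Oplus>i\<in>{..Suc n}. [(n choose i)] \<cdot> t i)"
    by (subst finsum_Suc) (auto simp: Pi_def binomial_eq_0)
  also have "\<dots> = (\<Oplus>i\<in>{..n}. [(n choose Suc i)] \<cdot> t (Suc i)) \<oplus> t 0"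
    by (subst finsum_Suc2) (auto simp: Pi_def)
  also have "(\<Oplus>i\<in>{..n}. [(n choose i)] \<cdot> t (Suc i)) \<oplus> ((\<Oplus>i\<in>{..n}. [(n choose Suc i)] \<cdot> t (Suc i)) \<oplus> t 0)
     = (\<Oplus>i\<in>{..n}. [(n choose i)] \<cdot> t (Suc i) \<oplus> [(n choose Suc i)] \<cdot> t (Suc i)) \<oplus> t 0"
    by (subst finsum_addf) (auto simp: Pi_def a_assoc finsum_closed)
  also have "(\<Oplus>i\<in>{..n}. [(n choose i)] \<cdot> t (Suc i) \<oplus> [(n choose Suc i)] \<cdot> t (Suc i))
      = (\<Oplus>i\<in>{..n}. [(Suc n choose Suc i)] \<cdot> t (Suc i))"
    by (intro finsum_cong') (auto simp: add.nat_pow_mult)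
  also have "\<dots> \<oplus> t 0 = (\<Oplus>i\<in>{..Suc n}. [(Suc n choose i)] \<cdot> t i)"
    by (subst finsum_Suc2) (auto simp: Pi_def)
  finally show ?case by (simp add: t_def)
qed

lemma (in cring) frobenius_add:
  assumes p: "prime (p :: nat)" and char: "[p] \<cdot> \<one> = \<zero>"
    and x: "x \<in> carrier R" and y: "y \<in> carrier R"
  shows "(x \<oplus> y) [^] p = x [^] p \<oplus> y [^] p"
proof -
  \<comment> \<open>Two successors expose both end terms of the binomial sum; the inner coefficients
    \<open>p choose Suc i\<close> with \<open>i \<le> m\<close> are divisible by p.\<close>
  obtain m where m: "p = Suc (Suc m)"
    using prime_ge_2_nat[OF p] by (metis Suc_eq_plus1 add_2_eq_Suc' le_add_diff_inverse2)
  have zero: "[k] \<cdot> z = \<zero>" if "p dvd k" "z \<in> carrier R" for k z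
  proof -
    obtain j where "k = p * j" using \<open>p dvd k\<close> by blast
    hence "[k] \<cdot> z = [j] \<cdot> ([p] \<cdot> z)" using that by (simp add: add.nat_pow_pow)
    also have "[p] \<cdot> z = ([p] \<cdot> \<one>) \<otimes> z" using that by (simp add: add_pow_ldistr)
    finally show ?thesis using char that by simp
  qed
  let ?f = "\<lambda>i. [(p choose i)] \<cdot> (x [^] i \<otimes> y [^] (p - i))"
  have f: "?f i \<in> carrier R" for i using x y by simp
  have "(x \<oplus> y) [^] p = ?f p \<oplus> ((\<Oplus>i\<in>{..m}. ?f (Suc i)) \<oplus> ?f 0)"
  proof -
    have "finsum R ?f {..Suc (Suc m)} = ?f (Suc (Suc m)) \<oplus> finsum R ?f {..Suc m}"
      by (rule finsum_Suc) (use f in blast)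
    also have "finsum R ?f {..Suc m} = (\<Oplus>i\<in>{..m}. ?f (Suc i)) \<oplus> ?f 0"
      by (rule finsum_Suc2) (use f in blast)
    finally show ?thesis unfolding binomial_ring[OF x y] m .
  qed
  also have "(\<Oplus>i\<in>{..m}. ?f (Suc i)) = (\<Oplus>i\<in>{..m}. \<zero>)"
  proof (rule finsum_cong')
    fix i assume "i \<in> {..m}"
    hence "p dvd (p choose Suc i)" using m using p by (intro dvd_choose_prime) auto
    thus "?f (Suc i) = \<zero>" using zero x y by simp
  qed auto
  finally show ?thesis using x y by simp
qed

lemma (in cring) frobenius_power_add:
  assumes p: "prime (p :: nat)" and char: "[p] \<cdot> \<one> = \<zero>"
    and x: "x \<in> carrier R" and y: "y \<in> carrier R"
  shows "(x \<oplus> y) [^] (p ^ e) = x [^] (p ^ e) \<oplus> y [^] (p ^ e)"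
proof (induction e)
  case (Suc e)
  have "z [^] (p ^ Suc e) = (z [^] (p ^ e)) [^] p" if "z \<in> carrier R" for z
    using that by (simp add: nat_pow_pow mult.commute)
  thus ?case using Suc x y frobenius_add[OF p char] by simp
qed (use x y in simp)

text \<open>The order of the additive group of a finite field, a power of p, annihilates 1; without
  zero divisors one factor p must do so already.\<close>

lemma (in domain) char_prime_of_prime_power:
  assumes "[(p ^ d :: nat)] \<cdot> \<one> = \<zero>"
  shows "[p] \<cdot> \<one> = \<zero>"
  using assms
proof (induction d)
  case (Suc d)
  have "[(p ^ Suc d)] \<cdot> \<one> = ([p] \<cdot> \<one>) \<otimes> ([(p ^ d)] \<cdot> \<one>)"
    by (simp add: add_pow_ldistr add.nat_pow_pow mult.commute)
  thus ?case using Suc integral by (metis add.nat_pow_closed one_closed)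
qed simp

section \<open>Monic polynomials over a finite field\<close>

locale finite_field = field +
  assumes finite_carrier: "finite (carrier R)"
begin

sublocale UP: principal_domain "poly_ring R"
  by (rule univ_poly_is_principal[OF carrier_is_subfield])

text \<open>Lists start with the leading coefficient, so a monic polynomial of degree n is 1
  followed by n free entries. Such a list is automatically in normal form, which makes the count
  immediate.\<close>

definition monics :: "nat \<Rightarrow> 'a list set" where
  "monics n = {p. set p \<subseteq> carrier R \<and> length p = Suc n \<and> hd p = \<one>}"

lemma monics_carrier: "p \<in> monics n \<Longrightarrow> p \<in> carrier (poly_ring R)"
  by (auto simp: monics_def polynomial_def simp flip: univ_poly_carrier)

lemma monics_iff:
  "p \<in> monics n \<longleftrightarrow> p \<in> carrier (poly_ring R) \<and> p \<noteq> [] \<and> lead_coeff p = \<one> \<and> degree p = n"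
  by (cases p) (auto simp: monics_def polynomial_def simp flip: univ_poly_carrier)

lemma monics_0: "monics 0 = {\<one>\<^bsub>poly_ring R\<^esub>}"
  by (auto simp: monics_def univ_poly_one length_Suc_conv)

lemma monics_eq_image: "monics n = Cons \<one> ` {xs. set xs \<subseteq> carrier R \<and> length xs = n}"
  by (auto simp: monics_def length_Suc_conv)

lemma finite_monics: "finite (monics n)"
  unfolding monics_eq_image by (intro finite_imageI finite_lists_length_eq finite_carrier)

lemma card_monics: "card (monics n) = card (carrier R) ^ n"
  unfolding monics_eq_image
  by (subst card_image) (auto simp: card_lists_length_eq finite_carrier)

lemma degree_mult:
  assumes "p \<in> carrier (poly_ring R)" "r \<in> carrier (poly_ring R)" "p \<noteq> []" "r \<noteq> []"
  shows "degree (p \<otimes>\<^bsub>poly_ring R\<^esub> r) = degree p + degree r"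
    and "lead_coeff (p \<otimes>\<^bsub>poly_ring R\<^esub> r) = lead_coeff p \<otimes> lead_coeff r"
    and "p \<otimes>\<^bsub>poly_ring R\<^esub> r \<noteq> []"
  using assms poly_mult_degree_eq[OF carrier_is_subring, of p r]
    poly_mult_lead_coeff[OF carrier_is_subring, of p r] UP.integral_iff[of p r]
  by (auto simp: univ_poly_carrier univ_poly_mult univ_poly_zero)

lemma lead_coeff_closed: "p \<in> carrier (poly_ring R) \<Longrightarrow> p \<noteq> [] \<Longrightarrow> lead_coeff p \<in> carrier R - {\<zero>}"
  by (cases p) (auto simp: polynomial_def simp flip: univ_poly_carrier)

lemma monics_mult:
  assumes "p \<in> monics m" "r \<in> monics n"
  shows "p \<otimes>\<^bsub>poly_ring R\<^esub> r \<in> monics (m + n)"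
  using assms degree_mult[of p r] by (simp add: monics_iff)

lemma monics_factor:
  assumes "p \<in> monics m" "g \<in> carrier (poly_ring R)" "p \<otimes>\<^bsub>poly_ring R\<^esub> g \<in> monics n"
  shows "m \<le> n" "g \<in> monics (n - m)"
proof -
  have "p \<in> carrier (poly_ring R)" using assms(1) monics_carrier by blast
  hence "p \<otimes>\<^bsub>poly_ring R\<^esub> [] = []" using UP.r_null by (simp add: univ_poly_zero)
  moreover have "[] \<notin> monics n" by (simp add: monics_def)
  ultimately have "g \<noteq> []" using assms(3) by metis
  thus "m \<le> n" "g \<in> monics (n - m)"
    using assms degree_mult[of p g] lead_coeff_closed[of g] by (auto simp: monics_iff)
qed

lemma monic_multiple:
  assumes "p \<in> carrier (poly_ring R)" "p \<noteq> []"
  obtains u where "u \<in> Units (poly_ring R)" "u \<otimes>\<^bsub>poly_ring R\<^esub> p \<in> monics (degree p)"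
proof
  let ?u = "[inv (lead_coeff p)]"
  have k: "inv (lead_coeff p) \<in> carrier R - {\<zero>}"
    
    using lead_coeff_closed[OF assms] Units_inv_Units field_Units by blast
  thus "?u \<in> Units (poly_ring R)" unfolding univ_poly_carrier_units by blast
  hence "?u \<in> carrier (poly_ring R)" by blast
  thus "?u \<otimes>\<^bsub>poly_ring R\<^esub> p \<in> monics (degree p)"
    using assms degree_mult[of ?u p] lead_coeff_closed[OF assms] field_Units
    by (auto simp: monics_iff)
qed

section \<open>Monic irreducible polynomials\<close>

definition irreds :: "nat \<Rightarrow> 'a list set" where
  "irreds n = {p \<in> monics n. pirreducible (carrier R) p}"

definition irred :: "'a list \<Rightarrow> bool" where
  "irred p \<longleftrightarrow> p \<in> irreds (degree p)"

lemma irredsD: "p \<in> irreds n \<Longrightarrow> irred p \<and> degree p = n"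
  by (auto simp: irred_def irreds_def monics_iff)

lemma irred_carrier: "irred p \<Longrightarrow> p \<in> carrier (poly_ring R)"
  by (auto simp: irred_def irreds_def monics_iff)

lemma irred_degree_pos: "irred p \<Longrightarrow> 0 < degree p"
  using pirreducible_degree[OF carrier_is_subfield, of p]
  by (auto simp: irred_def irreds_def monics_iff)

lemma irred_prime:
  assumes "irred p" "a \<in> carrier (poly_ring R)" "b \<in> carrier (poly_ring R)"
    "p pdivides (a \<otimes>\<^bsub>poly_ring R\<^esub> b)"
  shows "p pdivides a \<or> p pdivides b"
  using assms pprimeE(3)[OF carrier_is_subfield irred_carrier[OF assms(1)], of a b]
    pprime_iff_pirreducible[OF carrier_is_subfield irred_carrier[OF assms(1)]]
  by (auto simp: irred_def irreds_def)

text \<open>Monic irreducibles represent their classes up to units uniquely: associates differ by a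
  constant, and comparison of leading coefficients makes it 1.\<close>

lemma irred_pdivides_irred:
  assumes "irred p" "irred r" "p pdivides r"
  shows "p = r"
proof -
  have c: "p \<in> carrier (poly_ring R)" "r \<in> carrier (poly_ring R)"
    using assms irred_carrier by auto
  have "p \<notin> Units (poly_ring R)"
    using irred_degree_pos[OF assms(1)] univ_poly_units'[OF carrier_is_subfield, of p] by auto
  hence "p \<sim>\<^bsub>poly_ring R\<^esub> r"
    using divides_pirreducible_condition[of "carrier R" r p] assms c
    by (auto simp: irred_def irreds_def pdivides_def)
  then obtain k where k: "k \<in> carrier R - {\<zero>}" "p = [k] \<otimes>\<^bsub>poly_ring R\<^esub> r"
    using associated_polynomials_iff[OF carrier_is_subfield c] by auto
  have kc: "[k] \<in> carrier (poly_ring R)"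
    using k(1) by (auto simp: polynomial_def simp flip: univ_poly_carrier)
  hence "lead_coeff p = k \<otimes> lead_coeff r"
    using degree_mult(2)[OF kc c(2)] k assms(2) by (auto simp: irred_def irreds_def monics_iff)
  hence "k = \<one>" using k assms by (auto simp: irred_def irreds_def monics_iff)
  thus ?thesis using k c UP.l_one[of r] by (simp add: univ_poly_one)
qed

text \<open>An irreducible divisor b is given only up to a unit, and p is its monic associate.
  Irreducibility passes from b to p because a factorisation of p becomes one of b after
  multiplication by the inverse unit.\<close>

lemma exists_irred_divisor:
  assumes "f \<in> monics n" "n > 0"
  obtains p g where "irred p" "degree p \<le> n" "g \<in> monics (n - degree p)" "f = p \<otimes>\<^bsub>poly_ring R\<^esub> g"
proof -
  have f: "f \<in> carrier (poly_ring R) - {\<zero>\<^bsub>poly_ring R\<^esub>}" "f \<notin> Units (poly_ring R)"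
    using assms univ_poly_units'[OF carrier_is_subfield, of f]
    by (auto simp: monics_iff univ_poly_zero)
  obtain b where b: "b \<in> carrier (poly_ring R)" "pirreducible (carrier R) b" "b divides\<^bsub>poly_ring R\<^esub> f"
    using UP.exists_irreducible_divisor[OF f] by auto
  have "b \<noteq> []" using UP.ring_irreducibleE(1)[OF b(1,2)] by (simp add: univ_poly_zero)
  then obtain u where u: "u \<in> Units (poly_ring R)" "u \<otimes>\<^bsub>poly_ring R\<^esub> b \<in> monics (degree b)"
    using monic_multiple[OF b(1)] by blast
  define p where "p = u \<otimes>\<^bsub>poly_ring R\<^esub> b"
  have p: "p \<in> monics (degree b)" "p \<in> carrier (poly_ring R)" using u p_def b by auto
  have inv: "inv\<^bsub>poly_ring R\<^esub> u \<in> Units (poly_ring R)" using u by simp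
  have uc: "u \<in> carrier (poly_ring R)" "inv\<^bsub>poly_ring R\<^esub> u \<in> carrier (poly_ring R)" using u inv by auto
  have bp: "b = inv\<^bsub>poly_ring R\<^esub> u \<otimes>\<^bsub>poly_ring R\<^esub> p"
    unfolding p_def using u b uc by (simp flip: UP.m_assoc)
  have "pirreducible (carrier R) p"
  proof (rule UP.ring_irreducibleI)
    show "p \<in> carrier (poly_ring R) - {\<zero>\<^bsub>poly_ring R\<^esub>}" using p by (auto simp: monics_iff univ_poly_zero)
    show "p \<notin> Units (poly_ring R)"
      using UP.ring_irreducibleE(4)[OF b(1,2)] inv UP.Units_m_closed bp by metis
    fix x y assume xy: "x \<in> carrier (poly_ring R)" "y \<in> carrier (poly_ring R)" "p = x \<otimes>\<^bsub>poly_ring R\<^esub> y"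
    have "b = (inv\<^bsub>poly_ring R\<^esub> u \<otimes>\<^bsub>poly_ring R\<^esub> x) \<otimes>\<^bsub>poly_ring R\<^esub> y"
      using bp xy uc by (simp add: UP.m_assoc)
    hence "inv\<^bsub>poly_ring R\<^esub> u \<otimes>\<^bsub>poly_ring R\<^esub> x \<in> Units (poly_ring R) \<or> y \<in> Units (poly_ring R)"
      using UP.ring_irreducibleE(5)[OF b(1,2)] xy uc by simp
    moreover have "x = u \<otimes>\<^bsub>poly_ring R\<^esub> (inv\<^bsub>poly_ring R\<^esub> u \<otimes>\<^bsub>poly_ring R\<^esub> x)"
      using u uc xy by (simp flip: UP.m_assoc)
    ultimately show "x \<in> Units (poly_ring R) \<or> y \<in> Units (poly_ring R)"
      using u UP.Units_m_closed by metis
  qed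
  hence irr: "irred p" using p by (auto simp: irred_def irreds_def monics_iff)
  obtain h where h: "h \<in> carrier (poly_ring R)" "f = b \<otimes>\<^bsub>poly_ring R\<^esub> h"
    using b(3) by (auto simp: factor_def)
  define g where "g = inv\<^bsub>poly_ring R\<^esub> u \<otimes>\<^bsub>poly_ring R\<^esub> h"
  have g: "g \<in> carrier (poly_ring R)" "f = p \<otimes>\<^bsub>poly_ring R\<^esub> g"
    using h uc p(2) by (auto simp: g_def bp UP.m_ac)
  have "p \<in> monics (degree p)" using irr by (auto simp: irred_def irreds_def)
  thus ?thesis using that[OF irr] g monics_factor[of p "degree p" g n] assms by auto
qed

lemma pdivides_monics:
  assumes "p \<in> monics m" "f \<in> monics n" "p pdivides f"
  obtains g where "m \<le> n" "g \<in> monics (n - m)" "f = p \<otimes>\<^bsub>poly_ring R\<^esub> g"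
proof -
  obtain g where g: "g \<in> carrier (poly_ring R)" "f = p \<otimes>\<^bsub>poly_ring R\<^esub> g"
    using assms(3) unfolding pdivides_def factor_def by blast
  have "p \<otimes>\<^bsub>poly_ring R\<^esub> g \<in> monics n" using assms(2) unfolding g(2) .
  from monics_factor[OF assms(1) g(1) this] show ?thesis using that g(2) by blast
qed

lemma irred_monics: "irred p \<Longrightarrow> p \<in> monics (degree p)"
  by (simp add: irred_def irreds_def)

lemma pdivides_mult:
  assumes "a \<in> carrier (poly_ring R)" "b \<in> carrier (poly_ring R)"
  shows "a pdivides (a \<otimes>\<^bsub>poly_ring R\<^esub> b)"
  using assms by (auto simp: pdivides_def factor_def)

lemma pdivides_trans:
  assumes "a \<in> carrier (poly_ring R)" "a pdivides b" "b pdivides c"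
  shows "a pdivides c"
  using assms UP.divides_trans unfolding pdivides_def by blast

section \<open>Irreducible divisors without multiplicity, and squarefree polynomials\<close>

definition irred_divisors :: "'a list \<Rightarrow> 'a list set" where
  "irred_divisors f = {p. irred p \<and> p pdivides f}"

definition squarefree_poly :: "'a list \<Rightarrow> bool" where
  "squarefree_poly f \<longleftrightarrow> (\<forall>p. irred p \<longrightarrow> \<not> (p \<otimes>\<^bsub>poly_ring R\<^esub> p) pdivides f)"

lemma irred_divisors_subset:
  assumes "f \<in> monics n"
  shows "irred_divisors f \<subseteq> (\<Union>d\<le>n. irreds d)"
proof
  fix p assume "p \<in> irred_divisors f"
  hence p: "irred p" "p pdivides f" by (auto simp: irred_divisors_def)
  have "degree p \<le> n" using pdivides_monics[OF irred_monics[OF p(1)] assms p(2)] by blast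
  thus "p \<in> (\<Union>d\<le>n. irreds d)" using p(1) by (auto simp: irred_def)
qed

lemma finite_irreds: "finite (irreds n)"
  using finite_monics by (simp add: irreds_def)

lemma finite_irred_divisors: "f \<in> monics n \<Longrightarrow> finite (irred_divisors f)"
  by (rule finite_subset[OF irred_divisors_subset]) (auto simp: finite_irreds)

lemma irred_divisors_mult:
  assumes "irred p" "g \<in> carrier (poly_ring R)"
  shows "irred_divisors (p \<otimes>\<^bsub>poly_ring R\<^esub> g) = insert p (irred_divisors g)"
proof -
  have "r pdivides (p \<otimes>\<^bsub>poly_ring R\<^esub> g)" if "irred r" "r pdivides g" for r
    using that pdivides_mult[of g p] pdivides_trans[of r g] irred_carrier[of r] irred_carrier[OF assms(1)] assms(2)
    by (simp add: UP.m_comm)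
  thus ?thesis
    using irred_prime[of _ p g] irred_pdivides_irred[of _ p] assms pdivides_mult[of p g] irred_carrier
    by (auto simp: irred_divisors_def)
qed

lemma irred_divisors_one: "irred_divisors \<one>\<^bsub>poly_ring R\<^esub> = {}"
  using irred_divisors_subset[of "\<one>\<^bsub>poly_ring R\<^esub>" 0] irred_degree_pos irredsD
  by (fastforce simp: monics_0)

lemma squarefree_poly_mult:
  assumes p: "irred p" and gc: "g \<in> carrier (poly_ring R)"
    and sf: "squarefree_poly (p \<otimes>\<^bsub>poly_ring R\<^esub> g)"
  shows "\<not> p pdivides g" "squarefree_poly g"
proof -
  have pc: "p \<in> carrier (poly_ring R)" using irred_carrier[OF p] .
  show "\<not> p pdivides g"
  proof
    assume "p pdivides g"
    then obtain h where h: "h \<in> carrier (poly_ring R)" "g = p \<otimes>\<^bsub>poly_ring R\<^esub> h"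
      by (auto simp: pdivides_def factor_def)
    hence "p \<otimes>\<^bsub>poly_ring R\<^esub> g = (p \<otimes>\<^bsub>poly_ring R\<^esub> p) \<otimes>\<^bsub>poly_ring R\<^esub> h"
      using pc by (simp add: UP.m_assoc)
    hence "(p \<otimes>\<^bsub>poly_ring R\<^esub> p) pdivides (p \<otimes>\<^bsub>poly_ring R\<^esub> g)"
      using pdivides_mult[of "p \<otimes>\<^bsub>poly_ring R\<^esub> p" h] pc h by simp
    thus False using sf p by (auto simp: squarefree_poly_def)
  qed
  show "squarefree_poly g"
    unfolding squarefree_poly_def
  proof (intro allI impI notI)
    fix r assume r: "irred r" "(r \<otimes>\<^bsub>poly_ring R\<^esub> r) pdivides g"
    have "(r \<otimes>\<^bsub>poly_ring R\<^esub> r) pdivides (p \<otimes>\<^bsub>poly_ring R\<^esub> g)"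
      using pdivides_trans[OF _ r(2)] pdivides_mult[of g p] irred_carrier[OF r(1)] pc gc
      by (simp add: UP.m_comm)
    thus False using sf r(1) by (auto simp: squarefree_poly_def)
  qed
qed

text \<open>Each irreducible divisor is counted once. Splitting f = p g therefore adds at most deg p
  to the sum for g, and adds exactly deg p when p does not divide g, as is always the case for
  squarefree f.\<close>

lemma sum_degree_irred_divisors:
  assumes "f \<in> monics n"
  shows "(\<Sum>p\<in>irred_divisors f. degree p) \<le> n"
    and "squarefree_poly f \<Longrightarrow> (\<Sum>p\<in>irred_divisors f. degree p) = n"
proof -
  have "(\<Sum>p\<in>irred_divisors f. degree p) \<le> n \<and>
    (squarefree_poly f \<longrightarrow> (\<Sum>p\<in>irred_divisors f. degree p) = n)"
    using assms
  proof (induction n arbitrary: f rule: less_induct)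
    case (less n)
    show ?case
    proof (cases "n = 0")
      case True
      thus ?thesis using less.prems by (simp add: monics_0 irred_divisors_one)
    next
      case False
      then obtain p g where p: "irred p" "degree p \<le> n" "g \<in> monics (n - degree p)"
        "f = p \<otimes>\<^bsub>poly_ring R\<^esub> g"
        using exists_irred_divisor[OF less.prems] by blast
      have fin: "finite (irred_divisors g)" using finite_irred_divisors p by blast
      have gc: "g \<in> carrier (poly_ring R)" and pc: "p \<in> carrier (poly_ring R)"
        using p monics_carrier irred_carrier by auto
      have eq: "irred_divisors f = insert p (irred_divisors g)"
        using irred_divisors_mult[OF p(1) gc] p by simp
      have IH: "(\<Sum>p\<in>irred_divisors g. degree p) \<le> n - degree p"
        "squarefree_poly g \<Longrightarrow> (\<Sum>p\<in>irred_divisors g. degree p) = n - degree p"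
        using less.IH[OF _ p(3)] irred_degree_pos[OF p(1)] False by auto
      have "(\<Sum>p\<in>irred_divisors f. degree p) \<le> degree p + (\<Sum>p\<in>irred_divisors g. degree p)"
        unfolding eq using fin by (simp add: sum.insert_if)
      moreover have "(\<Sum>p\<in>irred_divisors f. degree p) = n" if sf: "squarefree_poly f"
      proof -
        have "p \<notin> irred_divisors g" "squarefree_poly g"
          using squarefree_poly_mult[OF p(1) gc] sf p(4) by (auto simp: irred_divisors_def)
        thus ?thesis using IH(2) p(2) fin unfolding eq by simp
      qed
      ultimately show ?thesis using IH(1) p(2) by auto
    qed
  qed
  thus "(\<Sum>p\<in>irred_divisors f. degree p) \<le> n"
    and "squarefree_poly f \<Longrightarrow> (\<Sum>p\<in>irred_divisors f. degree p) = n" by auto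
qed

section \<open>Counting polynomials built from a given set of irreducibles\<close>

text \<open>The analogue of smooth integers, with an arbitrary set A in place of a size bound; A
  will be the set of good irreducibles.\<close>

definition smooth :: "'a list set \<Rightarrow> nat \<Rightarrow> 'a list set" where
  "smooth A n = {f \<in> monics n. irred_divisors f \<subseteq> A}"

definition smooth_sf :: "'a list set \<Rightarrow> nat \<Rightarrow> 'a list set" where
  "smooth_sf A n = {f \<in> smooth A n. squarefree_poly f}"

lemma finite_smooth: "finite (smooth A n)"
  using finite_monics by (simp add: smooth_def)

text \<open>For p in A, neither multiplication nor division by p leads out of the smooth
  polynomials, and the two operations are inverse to each other.\<close>

lemma bij_betw_smooth_multiples:
  assumes p: "p \<in> A" "irred p" "degree p \<le> n"
  shows "bij_betw (\<lambda>g. p \<otimes>\<^bsub>poly_ring R\<^esub> g) (smooth A (n - degree p)) {f \<in> smooth A n. p pdivides f}"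
proof -
  have pc: "p \<in> carrier (poly_ring R)" "p \<noteq> \<zero>\<^bsub>poly_ring R\<^esub>"
    using irred_monics[OF p(2)] by (auto simp: monics_iff univ_poly_zero)
  have "inj_on (\<lambda>g. p \<otimes>\<^bsub>poly_ring R\<^esub> g) (smooth A (n - degree p))"
    by (rule inj_onI) (use pc UP.m_lcancel monics_carrier in \<open>auto simp: smooth_def\<close>)
  moreover have "p \<otimes>\<^bsub>poly_ring R\<^esub> g \<in> {f \<in> smooth A n. p pdivides f}"
    if "g \<in> smooth A (n - degree p)" for g
    using that monics_mult[OF irred_monics[OF p(2)], of g "n - degree p"] p pc
      irred_divisors_mult[OF p(2)] pdivides_mult[of p g] monics_carrier[of g]
    by (auto simp: smooth_def)
  moreover have "f \<in> (\<lambda>g. p \<otimes>\<^bsub>poly_ring R\<^esub> g) ` smooth A (n - degree p)"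
    if f: "f \<in> smooth A n" "p pdivides f" for f
  proof -
    obtain g where "g \<in> monics (n - degree p)" "f = p \<otimes>\<^bsub>poly_ring R\<^esub> g"
      using pdivides_monics[OF irred_monics[OF p(2)], of f n] f by (auto simp: smooth_def)
    thus ?thesis using f irred_divisors_mult[OF p(2), of g] monics_carrier[of g] by (auto simp: smooth_def)
  qed
  ultimately show ?thesis by (auto simp: bij_betw_def)
qed

lemma card_smooth_multiples:
  assumes "p \<in> A" "irred p" "degree p \<le> n"
  shows "card {f \<in> smooth A n. p pdivides f} = card (smooth A (n - degree p))"
  using bij_betw_same_card[OF bij_betw_smooth_multiples[OF assms]] by simp

text \<open>Double counting of pairs of a smooth f and an irreducible divisor p of f, weighted by
  deg p. For fixed p the polynomials f are the smooth multiples of p.\<close>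

lemma smooth_degree_sum:
  "(\<Sum>f\<in>smooth A n. \<Sum>p\<in>irred_divisors f. degree p)
    = (\<Sum>k=1..n. k * card (A \<inter> irreds k) * card (smooth A (n - k)))"
proof -
  \<comment> \<open>An index set that is finite and independent of f, so that the two summations can
    be interchanged.\<close>
  let ?I = "Sigma {1..n} (\<lambda>k. A \<inter> irreds k)"
  have "(\<Sum>f\<in>smooth A n. \<Sum>p\<in>irred_divisors f. degree p)
      = (\<Sum>f\<in>smooth A n. \<Sum>(k,p)\<in>{kp\<in>?I. snd kp pdivides f}. k)"
  proof (rule sum.cong[OF refl])
    fix f assume f: "f \<in> smooth A n"
    show "(\<Sum>p\<in>irred_divisors f. degree p) = (\<Sum>(k,p)\<in>{kp\<in>?I. snd kp pdivides f}. k)"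
    proof (rule sum.reindex_bij_witness[of _ snd "\<lambda>p. (degree p, p)"])
      fix p assume p: "p \<in> irred_divisors f"
      hence "p \<in> (\<Union>d\<le>n. irreds d)" using f irred_divisors_subset[of f n] by (auto simp: smooth_def)
      thus "(degree p, p) \<in> {kp\<in>?I. snd kp pdivides f}"
        using p f irred_degree_pos[of p] by (auto simp: smooth_def irred_divisors_def irred_def dest: irredsD)
    qed (auto simp: irred_divisors_def dest: irredsD)
  qed
  also have "\<dots> = (\<Sum>f\<in>smooth A n. \<Sum>kp\<in>?I. if snd kp pdivides f then fst kp else 0)"
    by (simp add: sum.inter_filter finite_irreds split_beta)
  also have "\<dots> = (\<Sum>kp\<in>?I. \<Sum>f\<in>smooth A n. if snd kp pdivides f then fst kp else 0)"
    by (rule sum.swap)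
  also have "\<dots> = (\<Sum>kp\<in>?I. fst kp * card (smooth A (n - fst kp)))"
  proof (rule sum.cong[OF refl])
    fix kp assume kp: "kp \<in> ?I"
    have "(\<Sum>f\<in>smooth A n. if snd kp pdivides f then fst kp else 0)
        = fst kp * card {f \<in> smooth A n. snd kp pdivides f}"
      by (subst sum.If_cases) (auto simp: finite_smooth Int_def)
    also have "card {f \<in> smooth A n. snd kp pdivides f} = card (smooth A (n - fst kp))"
      using kp card_smooth_multiples[of "snd kp" A n] by (auto dest!: irredsD)
    finally show "(\<Sum>f\<in>smooth A n. if snd kp pdivides f then fst kp else 0)
        = fst kp * card (smooth A (n - fst kp))" .
  qed
  also have "\<dots> = (\<Sum>k=1..n. \<Sum>p\<in>A \<inter> irreds k. k * card (smooth A (n - k)))"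
    by (subst sum.Sigma) (auto simp: finite_irreds split_beta)
  also have "\<dots> = (\<Sum>k=1..n. k * card (A \<inter> irreds k) * card (smooth A (n - k)))"
    by (simp add: mult_ac)
  finally show ?thesis .
qed

lemma card_smooth_lower:
  "(\<Sum>k=1..n. k * card (A \<inter> irreds k) * card (smooth A (n - k))) \<le> n * card (smooth A n)"
proof -
  have "(\<Sum>f\<in>smooth A n. \<Sum>p\<in>irred_divisors f. degree p) \<le> (\<Sum>f\<in>smooth A n. n)"
    by (intro sum_mono sum_degree_irred_divisors) (auto simp: smooth_def)
  thus ?thesis unfolding smooth_degree_sum by (simp add: mult.commute)
qed

text \<open>Squarefree f attain the weight n exactly; the other smooth polynomials only enlarge the
  weighted sum.\<close>

lemma card_smooth_sf_upper:
  "n * card (smooth_sf A n) \<le> (\<Sum>k=1..n. k * card (A \<inter> irreds k) * card (smooth A (n - k)))"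
proof -
  have "n * card (smooth_sf A n) = (\<Sum>f\<in>smooth_sf A n. \<Sum>p\<in>irred_divisors f. degree p)"
    using sum_degree_irred_divisors(2)[of _ n] by (simp add: smooth_sf_def smooth_def)
  also have "\<dots> \<le> (\<Sum>f\<in>smooth A n. \<Sum>p\<in>irred_divisors f. degree p)"
    by (rule sum_mono2) (auto simp: finite_smooth smooth_sf_def)
  finally show ?thesis unfolding smooth_degree_sum .
qed

lemma card_smooth_sf_le: "card (smooth_sf A n) \<le> card (smooth A n)"
  by (rule card_mono) (auto simp: finite_smooth smooth_sf_def)

text \<open>A smooth f that is not squarefree equals p^2 g with p in A and g smooth. A union bound
  over p and g suffices, however many such factorisations f has.\<close>

lemma card_smooth_diff:
  "card (smooth A n) \<le> card (smooth_sf A n)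
     + (\<Sum>k=1..n div 2. card (A \<inter> irreds k) * card (smooth A (n - 2 * k)))"
proof -
  let ?B = "\<Union>k\<in>{1..n div 2}. \<Union>p\<in>A \<inter> irreds k.
    (\<lambda>g. (p \<otimes>\<^bsub>poly_ring R\<^esub> p) \<otimes>\<^bsub>poly_ring R\<^esub> g) ` smooth A (n - 2 * k)"
  have "smooth A n \<subseteq> smooth_sf A n \<union> ?B"
  proof
    fix f assume f: "f \<in> smooth A n"
    show "f \<in> smooth_sf A n \<union> ?B"
    proof (cases "squarefree_poly f")
      case True
      thus ?thesis using f by (simp add: smooth_sf_def)
    next
      case False
      then obtain p where p: "irred p" "(p \<otimes>\<^bsub>poly_ring R\<^esub> p) pdivides f"
        by (auto simp: squarefree_poly_def)
      note pc = irred_carrier[OF p(1)] and pm = irred_monics[OF p(1)]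
      have fm: "f \<in> monics n" using f by (simp add: smooth_def)
      obtain g where g: "degree p + degree p \<le> n" "g \<in> monics (n - (degree p + degree p))"
        "f = (p \<otimes>\<^bsub>poly_ring R\<^esub> p) \<otimes>\<^bsub>poly_ring R\<^esub> g"
        using pdivides_monics[OF monics_mult[OF pm pm] fm p(2)] by blast
      have gc: "g \<in> carrier (poly_ring R)" using g(2) monics_carrier by blast
      have "f = p \<otimes>\<^bsub>poly_ring R\<^esub> (p \<otimes>\<^bsub>poly_ring R\<^esub> g)" using g(3) pc gc by (simp add: UP.m_assoc)
      hence "irred_divisors f = insert p (irred_divisors g)"
        using irred_divisors_mult[OF p(1)] pc gc by simp
      hence "p \<in> A" "g \<in> smooth A (n - 2 * degree p)"
        using f g(2) by (auto simp: smooth_def mult_2)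
      moreover have "degree p \<in> {1..n div 2}" using g(1) irred_degree_pos[OF p(1)] by auto
      moreover have "p \<in> irreds (degree p)" using p(1) by (simp add: irred_def)
      ultimately show ?thesis using g(3) by blast
    qed
  qed
  hence "card (smooth A n) \<le> card (smooth_sf A n \<union> ?B)"
    by (rule card_mono[rotated]) (auto simp: finite_smooth finite_irreds smooth_sf_def)
  also have "\<dots> \<le> card (smooth_sf A n) + card ?B" by (rule card_Un_le)
  also have "card ?B \<le> (\<Sum>k=1..n div 2. \<Sum>p\<in>A \<inter> irreds k. card (smooth A (n - 2 * k)))"
    by (intro order.trans[OF card_UN_le] sum_mono card_image_le)
       (auto simp: finite_smooth finite_irreds)
  finally show ?thesis by simp
qed

lemma smooth_0: "smooth A 0 = {\<one>\<^bsub>poly_ring R\<^esub>}" "smooth_sf A 0 = {\<one>\<^bsub>poly_ring R\<^esub>}"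
proof -
  show 1: "smooth A 0 = {\<one>\<^bsub>poly_ring R\<^esub>}"
    by (auto simp: smooth_def monics_0 irred_divisors_one)
  have "\<one>\<^bsub>poly_ring R\<^esub> \<in> monics 0" by (simp add: monics_0)
  hence "squarefree_poly \<one>\<^bsub>poly_ring R\<^esub>"
    unfolding squarefree_poly_def using pdivides_monics[of "_ \<otimes>\<^bsub>poly_ring R\<^esub> _" _ "\<one>\<^bsub>poly_ring R\<^esub>" 0]
      monics_mult irred_monics irred_degree_pos by (metis add_is_0 le_zero_eq less_irrefl)
  thus "smooth_sf A 0 = {\<one>\<^bsub>poly_ring R\<^esub>}" using 1 by (auto simp: smooth_sf_def)
qed

end

section \<open>Residue rings of polynomials\<close>

context finite_field
begin

lemma X_closed: "X \<in> carrier (poly_ring R)"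
  by (rule var_closed(1)[OF carrier_is_subring])

lemma X_monic: "X \<in> monics 1"
  by (simp add: monics_def var_def)

lemma X_irred: "irred X"
  using X_monic degree_one_imp_pirreducible[OF carrier_is_subfield X_closed]
  by (simp add: irred_def irreds_def var_def)

abbreviation rmap :: "'a list \<Rightarrow> 'a list \<Rightarrow> 'a list set" where
  "rmap \<equiv> rupture_surj (carrier R)"

abbreviation rupt :: "'a list \<Rightarrow> 'a list set ring" where
  "rupt \<equiv> Rupt (carrier R)"

lemma rupt_cring:
  assumes "f \<in> carrier (poly_ring R)"
  shows "cring (rupt f)"
  unfolding rupture_def
  by (intro ideal.quotient_is_cring UP.cgenideal_ideal assms UP.is_cring)

lemma rmap_hom: "f \<in> carrier (poly_ring R) \<Longrightarrow> ring_hom_ring (poly_ring R) (rupt f) (rmap f)"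
  by (rule rupture_surj_hom(2)[OF carrier_is_subring])

text \<open>\<open>rmap\<close> is injective on remainders, so equality of classes reduces to
  equality of remainders modulo f.\<close>

lemma rmap_eq_iff:
  assumes "f \<in> carrier (poly_ring R)" "a \<in> carrier (poly_ring R)" "b \<in> carrier (poly_ring R)"
  shows "rmap f a = rmap f b \<longleftrightarrow> f pdivides (a \<ominus>\<^bsub>poly_ring R\<^esub> b)"
proof -
  have "rmap f a = rmap f b \<longleftrightarrow> rmap f (a pmod f) = rmap f (b pmod f)"
    using rupture_surj_composed_with_pmod[OF carrier_is_subfield assms(1)] assms by simp
  also have "\<dots> \<longleftrightarrow> a pmod f = b pmod f"
    using inj_on_eq_iff[OF rupture_surj_inj_on[OF carrier_is_subfield assms(1)]] assms by blast
  also have "\<dots> \<longleftrightarrow> f pdivides (a \<ominus>\<^bsub>poly_ring R\<^esub> b)"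
    by (rule same_pmod_iff_pdivides[OF carrier_is_subfield assms(2,3,1)])
  finally show ?thesis .
qed

text \<open>\<open>normalize\<close> strips leading zeros from lists of length n and padding
  restores them; the zero polynomial [] is included.\<close>

lemma card_polys_length_le:
  "card {r \<in> carrier (poly_ring R). length r \<le> n} = card (carrier R) ^ n"
proof -
  let ?L = "{xs. set xs \<subseteq> carrier R \<and> length xs = n}"
  have "bij_betw normalize ?L {r \<in> carrier (poly_ring R). length r \<le> n}"
    unfolding bij_betw_def
  proof
    show "inj_on normalize ?L"
    proof (rule inj_onI)
      fix xs ys assume "xs \<in> ?L" "ys \<in> ?L" "normalize xs = normalize ys"
      thus "xs = ys" using normalize_trick[of xs] normalize_trick[of ys] by simp
    qed
    show "normalize ` ?L = {r \<in> carrier (poly_ring R). length r \<le> n}"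
    proof (intro equalityI subsetI)
      fix r assume "r \<in> normalize ` ?L"
      then obtain xs where xs: "xs \<in> ?L" "r = normalize xs" by blast
      thus "r \<in> {r \<in> carrier (poly_ring R). length r \<le> n}"
        using normalize_gives_polynomial[of xs "carrier R"] normalize_length_le[of xs]
        by (simp flip: univ_poly_carrier)
    next
      fix r assume r: "r \<in> {r \<in> carrier (poly_ring R). length r \<le> n}"
      hence p: "polynomial (carrier R) r" by (simp add: univ_poly_carrier)
      let ?xs = "replicate (n - length r) \<zero> @ r"
      have n1: "normalize ?xs = r" using normalize_replicate_zero normalize_polynomial[OF p] by simp
      have n2: "?xs \<in> ?L" using r polynomial_incl[OF p] by auto
      show "r \<in> normalize ` ?L" by (rule image_eqI[of _ _ ?xs]) (use n1 n2 in auto)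
    qed
  qed
  hence "card {r \<in> carrier (poly_ring R). length r \<le> n} = card ?L" by (rule bij_betw_same_card[symmetric])
  thus ?thesis by (simp add: card_lists_length_eq finite_carrier)
qed

lemma card_rupt:
  assumes "f \<in> monics n" "n > 0"
  shows "card (carrier (rupt f)) = card (carrier R) ^ n"
proof -
  have fc: "f \<in> carrier (poly_ring R)" "f \<noteq> []" "degree f = n" using assms(1) by (auto simp: monics_iff)
  let ?I = "(\<lambda>q. q pmod f) ` carrier (poly_ring R)"
  have "?I = {r \<in> carrier (poly_ring R). length r \<le> n}"
  proof (intro equalityI subsetI)
    fix r assume "r \<in> ?I"
    then obtain a where a: "a \<in> carrier (poly_ring R)" "r = a pmod f" by blast
    have "length r \<le> n"
      using pmod_degree[OF carrier_is_subfield a(1) fc(1,2)] fc(3) a(2) by auto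
    thus "r \<in> {r \<in> carrier (poly_ring R). length r \<le> n}"
      using long_division_closed(2)[OF carrier_is_subfield a(1) fc(1)] a by simp
  next
    fix r assume r: "r \<in> {r \<in> carrier (poly_ring R). length r \<le> n}"
    hence "degree r < degree f" using fc assms(2) by auto
    hence "r pmod f = r" using pmod_const(2)[OF carrier_is_subfield _ fc(1)] r by simp
    thus "r \<in> ?I" using r by (intro rev_image_eqI[of r]) auto
  qed
  moreover have "carrier (rupt f) = rmap f ` ?I"
    using rupture_carrier_as_pmod_image[OF carrier_is_subfield fc(1)] by simp
  ultimately show ?thesis
    using card_image[OF rupture_surj_inj_on[OF carrier_is_subfield fc(1)]] card_polys_length_le by simp
qed

lemma rupt_field: "irred p \<Longrightarrow> field (rupt p)"
  using rupture_is_field_iff_pirreducible[OF carrier_is_subfield irred_carrier[of p]]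
  by (simp add: irred_def irreds_def)

lemma rmap_image:
  assumes "f \<in> carrier (poly_ring R)"
  shows "rmap f ` carrier (poly_ring R) = carrier (rupt f)"
proof -
  have "rmap f ` carrier (poly_ring R) = rmap f ` (\<lambda>q. q pmod f) ` carrier (poly_ring R)"
    unfolding image_image
    by (intro image_cong refl rupture_surj_composed_with_pmod[OF carrier_is_subfield assms])
  thus ?thesis using rupture_carrier_as_pmod_image[OF carrier_is_subfield assms] by simp
qed

section \<open>The characteristic, and the Frobenius map on residue rings\<close>

lemma poly_char:
  assumes "card (carrier R) = p ^ d"
  shows "[p] \<cdot>\<^bsub>poly_ring R\<^esub> \<one>\<^bsub>poly_ring R\<^esub> = \<zero>\<^bsub>poly_ring R\<^esub>"
proof -
  have "[(card (carrier R))] \<cdot> \<one> = \<zero>"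
    using add.pow_order_eq_1[of \<one>] by (simp add: Coset.order_def)
  hence char: "[p] \<cdot> \<one> = \<zero>" using assms char_prime_of_prime_power by metis
  interpret C: ring_hom_ring R "poly_ring R" poly_of_const
    using canonical_embedding_ring_hom[OF carrier_is_subring] by simp
  have "poly_of_const ([k] \<cdot> \<one>) = [k] \<cdot>\<^bsub>poly_ring R\<^esub> \<one>\<^bsub>poly_ring R\<^esub>" for k :: nat
    by (induction k) (simp_all add: add.nat_pow_Suc)
  thus ?thesis using char C.hom_zero by metis
qed

lemma carrier_power: "a \<in> carrier R \<Longrightarrow> a [^] (card (carrier R) ^ k) = a"
proof (induction k)
  case (Suc k)
  have "a [^] card (carrier R) = a"
  proof (cases "a = \<zero>")
    case True
    moreover have "card (carrier R) \<noteq> 0" using finite_carrier zero_closed by (metis card_eq_0_iff empty_iff)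
    ultimately show ?thesis using nat_pow_zero by simp
  next
    case False
    interpret M: group "mult_of R" by (rule field_mult_group)
    have "a [^] (card (carrier R) - 1) = \<one>"
      using M.pow_order_eq_1[of a] Suc False order_mult_of[OF finite_carrier]
      by (simp add: nat_pow_mult_of Coset.order_def)
    moreover have "card (carrier R) = Suc (card (carrier R) - 1)"
      using finite_carrier Suc.prems by (metis Suc_pred' card_gt_0_iff empty_iff)
    ultimately show ?thesis using Suc by (metis l_one nat_pow_Suc)
  qed
  thus ?case using Suc by (simp add: nat_pow_pow[symmetric])
qed simp

text \<open>Horner's step. It turns list induction from the right into induction on
  polynomials.\<close>

lemma append_const_eq:
  assumes "h @ [c] \<in> carrier (poly_ring R)"
  shows "h @ [c] = h \<otimes>\<^bsub>poly_ring R\<^esub> X \<oplus>\<^bsub>poly_ring R\<^esub> poly_of_const c"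
proof -
  interpret C: ring_hom_ring R "poly_ring R" poly_of_const
    using canonical_embedding_ring_hom[OF carrier_is_subring] by simp
  have hc: "h \<in> carrier (poly_ring R)" and c: "c \<in> carrier R"
    using assms by (cases h; auto simp: polynomial_def simp flip: univ_poly_carrier)+
  have cc: "poly_of_const c \<in> carrier (poly_ring R)" using c by simp
  show "h @ [c] = h \<otimes>\<^bsub>poly_ring R\<^esub> X \<oplus>\<^bsub>poly_ring R\<^esub> poly_of_const c"
  \<comment> \<open>The empty list is the zero polynomial, for which \<open>h @ [\<zero>]\<close> is
    not the normal form of h X.\<close>
  proof (cases "h = []")
    case True
    hence "c \<noteq> \<zero>" using assms by (auto simp: polynomial_def simp flip: univ_poly_carrier)
    thus ?thesis using True c X_closed UP.l_null[OF X_closed] UP.l_zero[OF cc]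
      by (simp add: univ_poly_zero poly_of_const_def)
  next
    case False
    have "poly_add (h @ [\<zero>]) [c] = h @ [c]"
      using poly_add_append_replicate[of h "[c]"] assms False
      by (simp add: univ_poly_carrier[symmetric] polynomial_in_carrier[OF carrier_is_subring] normalize_polynomial)
         (use c hc in \<open>auto simp: polynomial_def simp flip: univ_poly_carrier\<close>)
    moreover have "poly_add (h @ [\<zero>]) [c] = poly_add (h @ [\<zero>]) (poly_of_const c)"
      using poly_add_normalize(2)[of "h @ [\<zero>]" "[c]"] c hc
      by (auto simp: poly_of_const_def polynomial_def simp flip: univ_poly_carrier)
    ultimately show ?thesis
      using False poly_mult_var[OF carrier_is_subring hc] by (simp add: univ_poly_add)
  qed
qed

text \<open>For Q = |F|^k the Q-th power map is additive and multiplicative, fixes the constants,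
  and fixes the class of X by assumption; constants and X generate all classes.\<close>

lemma rmap_frobenius_id:
  assumes q: "card (carrier R) = p ^ d" "prime (p :: nat)"
    and f: "f \<in> carrier (poly_ring R)"
    and X: "rmap f X [^]\<^bsub>rupt f\<^esub> (card (carrier R) ^ k) = rmap f X"
    and h: "h \<in> carrier (poly_ring R)"
  shows "rmap f h [^]\<^bsub>rupt f\<^esub> (card (carrier R) ^ k) = rmap f h"
proof -
  define Q where "Q = card (carrier R) ^ k"
  have Qp: "Q = p ^ (d * k)" by (simp add: Q_def q(1) power_mult)
  interpret S: cring "rupt f" by (rule rupt_cring[OF f])
  interpret H: ring_hom_ring "poly_ring R" "rupt f" "rmap f" by (rule rmap_hom[OF f])
  interpret C: ring_hom_ring R "poly_ring R" poly_of_const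
    using canonical_embedding_ring_hom[OF carrier_is_subring] by simp
  have const: "rmap f (poly_of_const c) [^]\<^bsub>rupt f\<^esub> Q = rmap f (poly_of_const c)" if "c \<in> carrier R" for c
    using carrier_power[OF that, of k] that
    by (simp add: Q_def flip: H.hom_nat_pow C.hom_nat_pow)
  show ?thesis unfolding Q_def[symmetric] using h
  proof (induction h rule: rev_induct)
    case Nil
    show ?case using const[of \<zero>] by (simp add: poly_of_const_def)
  next
    case (snoc c h)
    have hc: "h \<in> carrier (poly_ring R)" and c: "c \<in> carrier R"
      using snoc.prems by (cases h; auto simp: polynomial_def simp flip: univ_poly_carrier)+
    have cc: "poly_of_const c \<in> carrier (poly_ring R)" using c by simp
    note eq = append_const_eq[OF snoc.prems]
    \<comment> \<open>Additivity is applied in the polynomial ring, whose characteristic is known,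
      and carried to the quotient afterwards.\<close>
    have "(h @ [c]) [^]\<^bsub>poly_ring R\<^esub> Q = (h \<otimes>\<^bsub>poly_ring R\<^esub> X) [^]\<^bsub>poly_ring R\<^esub> Q
        \<oplus>\<^bsub>poly_ring R\<^esub> poly_of_const c [^]\<^bsub>poly_ring R\<^esub> Q"
      unfolding eq Qp
      by (rule UP.frobenius_power_add[OF q(2) poly_char[OF q(1)]]) (use hc cc X_closed in auto)
    also have "\<dots> = h [^]\<^bsub>poly_ring R\<^esub> Q \<otimes>\<^bsub>poly_ring R\<^esub> X [^]\<^bsub>poly_ring R\<^esub> Q
        \<oplus>\<^bsub>poly_ring R\<^esub> poly_of_const c [^]\<^bsub>poly_ring R\<^esub> Q"
      using UP.nat_pow_distrib[OF hc X_closed] by simp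
    finally have "rmap f (h @ [c]) [^]\<^bsub>rupt f\<^esub> Q = rmap f \<dots>"
      using snoc.prems by (simp flip: H.hom_nat_pow)
    also have "\<dots> = rmap f h [^]\<^bsub>rupt f\<^esub> Q \<otimes>\<^bsub>rupt f\<^esub> rmap f X [^]\<^bsub>rupt f\<^esub> Q
        \<oplus>\<^bsub>rupt f\<^esub> rmap f (poly_of_const c) [^]\<^bsub>rupt f\<^esub> Q"
      using hc cc X_closed by (simp add: H.hom_nat_pow)
    also have "\<dots> = rmap f h \<otimes>\<^bsub>rupt f\<^esub> rmap f X \<oplus>\<^bsub>rupt f\<^esub> rmap f (poly_of_const c)"
      using snoc.IH[OF hc] const[OF c] X by (simp add: Q_def)
    also have "\<dots> = rmap f (h @ [c])" unfolding eq using hc cc X_closed by simp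
    finally show ?case .
  qed
qed

end

section \<open>Periodic polynomials\<close>

lemma (in monoid) nat_pow_fixed_iterate:
  assumes "x \<in> carrier G" "x [^] (a :: nat) = x"
  shows "x [^] (a ^ b :: nat) = x"
  using assms by (induction b) (simp_all add: nat_pow_pow[symmetric])

context finite_field
begin

lemma pdivides_X_power_iff:
  assumes "f \<in> carrier (poly_ring R)"
  shows "f pdivides (X [^]\<^bsub>poly_ring R\<^esub> (m :: nat) \<ominus>\<^bsub>poly_ring R\<^esub> X)
      \<longleftrightarrow> rmap f X [^]\<^bsub>rupt f\<^esub> m = rmap f X"
    and "f pdivides (X [^]\<^bsub>poly_ring R\<^esub> (m :: nat) \<ominus>\<^bsub>poly_ring R\<^esub> \<one>\<^bsub>poly_ring R\<^esub>)
      \<longleftrightarrow> rmap f X [^]\<^bsub>rupt f\<^esub> m = \<one>\<^bsub>rupt f\<^esub>"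
proof -
  interpret H: ring_hom_ring "poly_ring R" "rupt f" "rmap f" by (rule rmap_hom[OF assms])
  show "f pdivides (X [^]\<^bsub>poly_ring R\<^esub> (m :: nat) \<ominus>\<^bsub>poly_ring R\<^esub> X)
      \<longleftrightarrow> rmap f X [^]\<^bsub>rupt f\<^esub> m = rmap f X"
    using rmap_eq_iff[OF assms, of "X [^]\<^bsub>poly_ring R\<^esub> m" X] X_closed by (simp add: H.hom_nat_pow)
  show "f pdivides (X [^]\<^bsub>poly_ring R\<^esub> (m :: nat) \<ominus>\<^bsub>poly_ring R\<^esub> \<one>\<^bsub>poly_ring R\<^esub>)
      \<longleftrightarrow> rmap f X [^]\<^bsub>rupt f\<^esub> m = \<one>\<^bsub>rupt f\<^esub>"
    using rmap_eq_iff[OF assms, of "X [^]\<^bsub>poly_ring R\<^esub> m" "\<one>\<^bsub>poly_ring R\<^esub>"] X_closed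
    by (simp add: H.hom_nat_pow)
qed

lemma rmap_X_closed: "f \<in> carrier (poly_ring R) \<Longrightarrow> rmap f X \<in> carrier (rupt f)"
  using rmap_image[of f] X_closed by blast

definition periodic_poly :: "nat \<Rightarrow> 'a list \<Rightarrow> bool" where
  "periodic_poly L f \<longleftrightarrow> (\<exists>n>1. f pdivides (X [^]\<^bsub>poly_ring R\<^esub> (L ^ n) \<ominus>\<^bsub>poly_ring R\<^esub> X))"

definition periodic_irreds :: "nat \<Rightarrow> 'a list set" where
  "periodic_irreds L = {p. irred p \<and> periodic_poly L p}"

text \<open>Iterating the L^n-th power map: an exponent n may be replaced by any multiple, so that
  different factors can be given a common one.\<close>

lemma pdivides_X_power_mult:
  fixes L n k :: nat
  assumes f: "f \<in> carrier (poly_ring R)"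
    and "f pdivides (X [^]\<^bsub>poly_ring R\<^esub> (L ^ n) \<ominus>\<^bsub>poly_ring R\<^esub> X)"
  shows "f pdivides (X [^]\<^bsub>poly_ring R\<^esub> (L ^ (n * k)) \<ominus>\<^bsub>poly_ring R\<^esub> X)"
proof -
  interpret S: cring "rupt f" by (rule rupt_cring[OF f])
  show ?thesis
    using assms S.nat_pow_fixed_iterate[OF rmap_X_closed[OF f], of "L ^ n" k]
    by (simp add: pdivides_X_power_iff power_mult)
qed

text \<open>Splitting off an irreducible p leaves a cofactor g prime to p, so f = p g divides
  whatever both p and g divide. Exponents a for p and b for g are replaced by the common exponent a
  * b.\<close>

lemma smooth_sf_periodic:
  assumes "f \<in> smooth_sf (periodic_irreds L) n"
  shows "periodic_poly L f"
  using assms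
proof (induction n arbitrary: f rule: less_induct)
  case (less n)
  have f: "f \<in> monics n" "irred_divisors f \<subseteq> periodic_irreds L" "squarefree_poly f"
    using less.prems by (auto simp: smooth_sf_def smooth_def)
  show ?case
  proof (cases "n = 0")
    case True
    hence "f = \<one>\<^bsub>poly_ring R\<^esub>" using f by (simp add: monics_0)
    hence "f pdivides (X [^]\<^bsub>poly_ring R\<^esub> (L ^ 2) \<ominus>\<^bsub>poly_ring R\<^esub> X)"
      using pdivides_mult[of f "X [^]\<^bsub>poly_ring R\<^esub> (L ^ 2) \<ominus>\<^bsub>poly_ring R\<^esub> X"] X_closed by simp
    thus ?thesis unfolding periodic_poly_def by (metis one_less_numeral_iff semiring_norm(76))
  next
    case False
    then obtain p g where p: "irred p" "degree p \<le> n" "g \<in> monics (n - degree p)"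
      "f = p \<otimes>\<^bsub>poly_ring R\<^esub> g"
      using exists_irred_divisor[OF f(1)] by blast
    have gc: "g \<in> carrier (poly_ring R)" and pc: "p \<in> carrier (poly_ring R)"
      using p monics_carrier irred_carrier by auto
    have div: "irred_divisors f = insert p (irred_divisors g)"
      using irred_divisors_mult[OF p(1) gc] p by simp
    have sf: "\<not> p pdivides g" "squarefree_poly g"
      using squarefree_poly_mult[OF p(1) gc] f(3) p(4) by auto
    have "g \<in> smooth_sf (periodic_irreds L) (n - degree p)"
      using p f div sf by (auto simp: smooth_sf_def smooth_def)
    moreover have "n - degree p < n" using irred_degree_pos[OF p(1)] False by linarith
    ultimately have "periodic_poly L g" using less.IH by blast
    then obtain b where b: "b > 1" "g pdivides (X [^]\<^bsub>poly_ring R\<^esub> (L ^ b) \<ominus>\<^bsub>poly_ring R\<^esub> X)"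
      by (auto simp: periodic_poly_def)
    have "periodic_poly L p" using f(2) div by (auto simp: periodic_irreds_def)
    then obtain a where a: "a > 1" "p pdivides (X [^]\<^bsub>poly_ring R\<^esub> (L ^ a) \<ominus>\<^bsub>poly_ring R\<^esub> X)"
      by (auto simp: periodic_poly_def)
    define Y where "Y = X [^]\<^bsub>poly_ring R\<^esub> (L ^ (a * b)) \<ominus>\<^bsub>poly_ring R\<^esub> X"
    have pY: "p pdivides Y" and gY: "g pdivides Y"
      using pdivides_X_power_mult[OF pc a(2), of b] pdivides_X_power_mult[OF gc b(2), of a]
      by (simp_all add: Y_def mult.commute)
    obtain h where h: "h \<in> carrier (poly_ring R)" "Y = g \<otimes>\<^bsub>poly_ring R\<^esub> h"
      using gY unfolding pdivides_def factor_def by blast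
    have "p pdivides h" using irred_prime[OF p(1) gc h(1)] pY h(2) sf(1) by simp
    then obtain k where k: "k \<in> carrier (poly_ring R)" "h = p \<otimes>\<^bsub>poly_ring R\<^esub> k"
      unfolding pdivides_def factor_def by blast
    have "Y = f \<otimes>\<^bsub>poly_ring R\<^esub> k" using h(2) k p(4) pc gc by (simp add: UP.m_ac)
    hence "f pdivides Y" using pdivides_mult[of f k] pc gc k p(4) by simp
    moreover have "1 < a * b" using a(1) b(1) by (metis less_1_mult)
    ultimately show ?thesis unfolding periodic_poly_def Y_def by blast
  qed
qed

text \<open>Goodness passes to divisors, whence the upper bound. A repeated factor may or may not
  destroy goodness, so the lower bound keeps to squarefree polynomials.\<close>

lemma card_periodic_bounds:
  fixes L n :: nat
  defines "C \<equiv> card {f \<in> monics n. periodic_poly L f}"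
  shows "card (smooth_sf (periodic_irreds L) n) \<le> C" "C \<le> card (smooth (periodic_irreds L) n)"
proof -
  show "card (smooth_sf (periodic_irreds L) n) \<le> C"
    unfolding C_def using smooth_sf_periodic[of _ L n]
    by (intro card_mono) (auto simp: finite_monics smooth_sf_def smooth_def)
  have "periodic_poly L p" if "irred p" "p pdivides f" "periodic_poly L f" for p f
    using that pdivides_trans[OF irred_carrier[OF that(1)]] by (auto simp: periodic_poly_def)
  hence "{f \<in> monics n. periodic_poly L f} \<subseteq> smooth (periodic_irreds L) n"
    by (auto simp: smooth_def periodic_irreds_def irred_divisors_def)
  thus "C \<le> card (smooth (periodic_irreds L) n)"
    unfolding C_def by (intro card_mono finite_smooth)
qed

section \<open>Irreducible factors of X^N - 1 and the number of periodic irreducibles\<close>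

lemma binomial_monic:
  assumes "N > 0"
  shows "X [^]\<^bsub>poly_ring R\<^esub> N \<ominus>\<^bsub>poly_ring R\<^esub> \<one>\<^bsub>poly_ring R\<^esub> \<in> monics N"
proof -
  interpret C: ring_hom_ring R "poly_ring R" poly_of_const
    using canonical_embedding_ring_hom[OF carrier_is_subring] by simp
  obtain n where n: "N = Suc n" using assms by (cases N) auto
  \<comment> \<open>With N = n + 1, appending -1 to the list of X^n produces X^N - 1 in a form where
    length and leading coefficient can be read off.\<close>
  let ?f = "X [^]\<^bsub>poly_ring R\<^esub> n @ [\<ominus> \<one>]"
  have "monom \<one> n @ [\<ominus> \<one>] \<in> monics N" by (auto simp: monics_def monom_def n)
  hence f: "?f \<in> monics N" unfolding unitary_monom_eq_var_pow[OF carrier_is_subring] .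
  have "?f = X [^]\<^bsub>poly_ring R\<^esub> n \<otimes>\<^bsub>poly_ring R\<^esub> X \<oplus>\<^bsub>poly_ring R\<^esub> poly_of_const (\<ominus> \<one>)"
    by (rule append_const_eq[OF monics_carrier[OF f]])
  also have "poly_of_const (\<ominus> \<one>) = \<ominus>\<^bsub>poly_ring R\<^esub> \<one>\<^bsub>poly_ring R\<^esub>" by simp
  also have "X [^]\<^bsub>poly_ring R\<^esub> n \<otimes>\<^bsub>poly_ring R\<^esub> X \<oplus>\<^bsub>poly_ring R\<^esub> \<ominus>\<^bsub>poly_ring R\<^esub> \<one>\<^bsub>poly_ring R\<^esub>
      = X [^]\<^bsub>poly_ring R\<^esub> N \<ominus>\<^bsub>poly_ring R\<^esub> \<one>\<^bsub>poly_ring R\<^esub>"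
    by (simp add: n a_minus_def)
  finally have eq: "?f = X [^]\<^bsub>poly_ring R\<^esub> N \<ominus>\<^bsub>poly_ring R\<^esub> \<one>\<^bsub>poly_ring R\<^esub>" .
  show ?thesis using f unfolding eq .
qed

lemma rmap_X_power_fixed:
  fixes Q N :: nat
  assumes f: "f \<in> carrier (poly_ring R)" and N: "N dvd Q - 1" and Q: "Q > 1"
    and div: "f pdivides (X [^]\<^bsub>poly_ring R\<^esub> N \<ominus>\<^bsub>poly_ring R\<^esub> \<one>\<^bsub>poly_ring R\<^esub>)"
  shows "rmap f X [^]\<^bsub>rupt f\<^esub> Q = rmap f X"
proof -
  interpret S: cring "rupt f" by (rule rupt_cring[OF f])
  obtain t where t: "Q - 1 = N * t" using N by blast
  have "rmap f X [^]\<^bsub>rupt f\<^esub> N = \<one>\<^bsub>rupt f\<^esub>"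
    using div pdivides_X_power_iff(2)[OF f] by simp
  hence "rmap f X [^]\<^bsub>rupt f\<^esub> (Q - 1) = \<one>\<^bsub>rupt f\<^esub>"
    unfolding t using rmap_X_closed[OF f] by (simp flip: S.nat_pow_pow)
  hence "rmap f X [^]\<^bsub>rupt f\<^esub> Suc (Q - 1) = rmap f X"
    using rmap_X_closed[OF f] by simp
  moreover have "Suc (Q - 1) = Q" using Q by simp
  ultimately show ?thesis by simp
qed

text \<open>
  A substitute for the derivative: if \<open>r^2\<close> divides \<open>X^N - 1\<close>, then \<open>X^Q = X\<close> modulo \<open>r^2\<close>, and since
  the \<open>Q\<close>-th power map is additive, \<open>h^Q = h\<close> modulo \<open>r^2\<close> for every \<open>h\<close>. For \<open>h = r\<close> the left-hand side
  vanishes, so \<open>r^2\<close> divides \<open>r\<close>.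
\<close>

lemma squarefree_binomial:
  assumes q: "card (carrier R) = p ^ d" "prime (p :: nat)"
    and N: "N dvd card (carrier R) ^ k - 1" and Q: "card (carrier R) ^ k > 1"
  shows "squarefree_poly (X [^]\<^bsub>poly_ring R\<^esub> N \<ominus>\<^bsub>poly_ring R\<^esub> \<one>\<^bsub>poly_ring R\<^esub>)"
  unfolding squarefree_poly_def
proof (intro allI impI notI)
  fix r assume r: "irred r"
    "(r \<otimes>\<^bsub>poly_ring R\<^esub> r) pdivides (X [^]\<^bsub>poly_ring R\<^esub> N \<ominus>\<^bsub>poly_ring R\<^esub> \<one>\<^bsub>poly_ring R\<^esub>)"
  define f where "f = r \<otimes>\<^bsub>poly_ring R\<^esub> r"
  define Q' where "Q' = card (carrier R) ^ k"
  note rm = irred_monics[OF r(1)] and rc = irred_carrier[OF r(1)]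
  have fm: "f \<in> monics (degree r + degree r)" unfolding f_def by (rule monics_mult[OF rm rm])
  note fc = monics_carrier[OF fm]
  interpret S: cring "rupt f" by (rule rupt_cring[OF fc])
  interpret H: ring_hom_ring "poly_ring R" "rupt f" "rmap f" by (rule rmap_hom[OF fc])
  have Q': "Q' > 1" using Q by (simp add: Q'_def)
  have "rmap f X [^]\<^bsub>rupt f\<^esub> (card (carrier R) ^ k) = rmap f X"
    by (rule rmap_X_power_fixed[OF fc N Q]) (use r(2) in \<open>simp add: f_def\<close>)
  hence "rmap f r [^]\<^bsub>rupt f\<^esub> Q' = rmap f r"
    using rmap_frobenius_id[OF q fc _ rc, of k] by (simp add: Q'_def)
  moreover have "rmap f r [^]\<^bsub>rupt f\<^esub> Q' = \<zero>\<^bsub>rupt f\<^esub>"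
  proof -
    have "rmap f r \<otimes>\<^bsub>rupt f\<^esub> rmap f r = rmap f (r \<otimes>\<^bsub>poly_ring R\<^esub> r)"
      using H.hom_mult[OF rc rc] by simp
    also have "\<dots> = rmap f f" by (simp only: f_def)
    also have "\<dots> = rmap f \<zero>\<^bsub>poly_ring R\<^esub>"
      using rmap_eq_iff[OF fc fc, of "\<zero>\<^bsub>poly_ring R\<^esub>"] UP.divides_refl[OF fc]
      by (simp add: pdivides_def fc UP.minus_eq)
    finally have sq: "rmap f r \<otimes>\<^bsub>rupt f\<^esub> rmap f r = \<zero>\<^bsub>rupt f\<^esub>" by simp
    have "Q' = Suc (Suc (Q' - 2))" using Q' by simp
    then obtain j where "Q' = Suc (Suc j)" by blast
    thus ?thesis using sq rc by (simp add: S.m_assoc)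
  qed
  ultimately have "rmap f r = rmap f \<zero>\<^bsub>poly_ring R\<^esub>" by simp
  hence "f pdivides r" using rmap_eq_iff[OF fc rc, of "\<zero>\<^bsub>poly_ring R\<^esub>"] rc by (simp add: UP.minus_eq)
  hence "degree r + degree r \<le> degree r" using pdivides_monics[OF fm rm] by blast
  thus False using irred_degree_pos[OF r(1)] by simp
qed

text \<open>Put Q = |F|^k. From X^Q = X modulo r, every nonzero element of the field F[X]/(r) is a
  root of Y^(Q-1) = 1, which has at most Q - 1 roots; hence |F|^(deg r) is at most Q.\<close>

lemma degree_irred_binomial_divisor:
  assumes q: "card (carrier R) = p ^ d" "prime (p :: nat)"
    and N: "N dvd card (carrier R) ^ k - 1" and Q: "card (carrier R) ^ k > 1"
    and r: "irred r" "r pdivides (X [^]\<^bsub>poly_ring R\<^esub> N \<ominus>\<^bsub>poly_ring R\<^esub> \<one>\<^bsub>poly_ring R\<^esub>)"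
  shows "degree r \<le> k"
proof -
  define Q' where "Q' = card (carrier R) ^ k"
  note rm = irred_monics[OF r(1)] and rc = irred_carrier[OF r(1)]
  interpret K: field "rupt r" by (rule rupt_field[OF r(1)])
  have cardK: "card (carrier (rupt r)) = card (carrier R) ^ degree r"
    by (rule card_rupt[OF rm irred_degree_pos[OF r(1)]])
  have q1: "card (carrier R) > 1"
  proof (rule ccontr)
    assume "\<not> card (carrier R) > 1"
    hence "card (carrier R) ^ k \<le> 1 ^ k" by (intro power_mono) simp_all
    thus False using Q by simp
  qed
  have fin: "finite (carrier (rupt r))" using cardK q1 by (metis card_eq_0_iff less_nat_zero_code power_eq_0_iff)
  have Q': "Suc (Q' - 1) = Q'" "Q' > 1" using Q by (auto simp: Q'_def)
  have X: "rmap r X [^]\<^bsub>rupt r\<^esub> (card (carrier R) ^ k) = rmap r X"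
    by (rule rmap_X_power_fixed[OF rc N Q r(2)])
  have "carrier (rupt r) - {\<zero>\<^bsub>rupt r\<^esub>} \<subseteq> {x \<in> carrier (rupt r). x [^]\<^bsub>rupt r\<^esub> (Q' - 1) = \<one>\<^bsub>rupt r\<^esub>}"
  proof
    fix x assume x: "x \<in> carrier (rupt r) - {\<zero>\<^bsub>rupt r\<^esub>}"
    then obtain h where "h \<in> carrier (poly_ring R)" "x = rmap r h" using rmap_image[OF rc] by blast
    hence "x [^]\<^bsub>rupt r\<^esub> Q' = x" using rmap_frobenius_id[OF q rc X] by (simp add: Q'_def)
    hence "x [^]\<^bsub>rupt r\<^esub> (Q' - 1) \<otimes>\<^bsub>rupt r\<^esub> x = \<one>\<^bsub>rupt r\<^esub> \<otimes>\<^bsub>rupt r\<^esub> x"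
      using x Q'(1) by (metis K.l_one K.nat_pow_Suc Diff_iff)
    hence "x [^]\<^bsub>rupt r\<^esub> (Q' - 1) = \<one>\<^bsub>rupt r\<^esub>"
      using x K.m_rcancel[of x "x [^]\<^bsub>rupt r\<^esub> (Q' - 1)" "\<one>\<^bsub>rupt r\<^esub>"] by simp
    thus "x \<in> {x \<in> carrier (rupt r). x [^]\<^bsub>rupt r\<^esub> (Q' - 1) = \<one>\<^bsub>rupt r\<^esub>}" using x by simp
  qed
  hence "card (carrier (rupt r) - {\<zero>\<^bsub>rupt r\<^esub>})
      \<le> card {x \<in> carrier (rupt r). x [^]\<^bsub>rupt r\<^esub> (Q' - 1) = \<one>\<^bsub>rupt r\<^esub>}"
    using fin by (intro card_mono) simp_all
  also have "\<dots> \<le> Q' - 1" using Q'(2) by (intro K.num_roots_le_deg[OF fin]) simp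
  finally have "card (carrier (rupt r) - {\<zero>\<^bsub>rupt r\<^esub>}) \<le> Q' - 1" .
  hence "card (carrier R) ^ degree r \<le> card (carrier R) ^ k"
    using Q' fin by (simp add: cardK Q'_def)
  thus ?thesis using q1 power_le_imp_le_exp by blast
qed


text \<open>Let e be the order of X in the multiplicative group of F[X]/(r), where X is nonzero
  because r differs from X. Goodness means that e divides L^n - 1 for some n > 1, that is, that e is
  prime to L. As e divides |F|^k - 1 = L^v N, this says that e divides N.\<close>

lemma periodic_irreds_iff:
  assumes "prime (L :: nat)" and r: "irred r" "degree r = k" "r \<noteq> X"
    and q1: "card (carrier R) > 1" and N: "card (carrier R) ^ k - 1 = L ^ v * N" "\<not> L dvd N"
  shows "r \<in> periodic_irreds L \<longleftrightarrow>
    r pdivides (X [^]\<^bsub>poly_ring R\<^esub> N \<ominus>\<^bsub>poly_ring R\<^esub> \<one>\<^bsub>poly_ring R\<^esub>)"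
proof -
  note rm = irred_monics[OF r(1)] and rc = irred_carrier[OF r(1)]
  interpret K: field "rupt r" by (rule rupt_field[OF r(1)])
  have cardK: "card (carrier (rupt r)) = card (carrier R) ^ k"
    using card_rupt[OF rm irred_degree_pos[OF r(1)]] r(2) by simp
  have fin: "finite (carrier (rupt r))" using cardK q1 by (metis card_eq_0_iff less_nat_zero_code power_eq_0_iff)
  interpret M: group "Multiplicative_Group.mult_of (rupt r)" by (rule K.field_mult_group)
  define x where "x = rmap r X"
  have x: "x \<in> carrier (rupt r)" using rmap_X_closed[OF rc] by (simp add: x_def)
  have "x \<noteq> \<zero>\<^bsub>rupt r\<^esub>"
  proof
    interpret H: ring_hom_ring "poly_ring R" "rupt r" "rmap r" by (rule rmap_hom[OF rc])
    assume "x = \<zero>\<^bsub>rupt r\<^esub>"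
    hence "rmap r X = rmap r \<zero>\<^bsub>poly_ring R\<^esub>" by (simp add: x_def)
    hence "r pdivides X"
      using rmap_eq_iff[OF rc X_closed, of "\<zero>\<^bsub>poly_ring R\<^esub>"] X_closed by (simp add: UP.minus_eq)
    thus False using irred_pdivides_irred[OF r(1) X_irred] r(3) by simp
  qed
  hence xM: "x \<in> carrier (Multiplicative_Group.mult_of (rupt r))" using x by simp
  define e where "e = M.ord x"
  have pow: "x [^]\<^bsub>rupt r\<^esub> m = \<one>\<^bsub>rupt r\<^esub> \<longleftrightarrow> e dvd m" for m :: nat
    using M.pow_eq_id[OF xM] by (simp add: e_def nat_pow_mult_of)
  have order: "Coset.order (Multiplicative_Group.mult_of (rupt r)) = card (carrier R) ^ k - 1"
    using K.order_mult_of[OF fin] by (simp add: Coset.order_def cardK)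
  have e: "e dvd card (carrier R) ^ k - 1"
    using M.pow_order_eq_1[OF xM] pow[of "card (carrier R) ^ k - 1"] order by (simp add: nat_pow_mult_of)
  have "card (carrier R) ^ k > 1"
    using q1 r(2) irred_degree_pos[OF r(1)] by (intro one_less_power) auto
  hence "card (carrier R) ^ k - 1 > 0" by simp
  hence epos: "e > 0" using e by (metis dvd_0_left_iff not_gr_zero)
  have fixed: "x [^]\<^bsub>rupt r\<^esub> m = x \<longleftrightarrow> e dvd m - 1" if "m > 0" for m
  proof -
    have "x [^]\<^bsub>rupt r\<^esub> m = x [^]\<^bsub>rupt r\<^esub> (m - 1) \<otimes>\<^bsub>rupt r\<^esub> x"
      using that by (metis K.nat_pow_Suc Suc_pred')
    hence "x [^]\<^bsub>rupt r\<^esub> m = x \<longleftrightarrow> x [^]\<^bsub>rupt r\<^esub> (m - 1) = \<one>\<^bsub>rupt r\<^esub>"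
      using x \<open>x \<noteq> \<zero>\<^bsub>rupt r\<^esub>\<close> K.m_rcancel[of x "x [^]\<^bsub>rupt r\<^esub> (m - 1)" "\<one>\<^bsub>rupt r\<^esub>"] by simp
    thus ?thesis by (simp add: pow)
  qed
  have Lpos: "L > 0" using assms(1) prime_gt_0_nat by blast
  have "r \<in> periodic_irreds L \<longleftrightarrow> (\<exists>n>1. e dvd L ^ n - 1)"
    using r(1) fixed Lpos by (simp add: periodic_irreds_def periodic_poly_def pdivides_X_power_iff[OF rc] flip: x_def)
  also have "\<dots> \<longleftrightarrow> coprime e L"
  proof
    assume "\<exists>n>1. e dvd L ^ n - 1"
    then obtain n where n: "n > 1" "e dvd L ^ n - 1" by blast
    have "\<not> L dvd e"
    proof
      assume "L dvd e"
      hence 1: "L dvd L ^ n - 1" using n(2) by (rule dvd_trans)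
      have 2: "L dvd L ^ n" using n(1) by (cases n) auto
      have "L dvd L ^ n - (L ^ n - 1)" by (rule dvd_diff_nat[OF 2 1])
      moreover have "L ^ n - (L ^ n - 1) = 1" using Lpos by (simp add: Suc_leI)
      ultimately show False using prime_gt_1_nat[OF assms(1)] by simp
    qed
    thus "coprime e L" using prime_imp_coprime[OF assms(1)] coprime_commute by blast
  next
    assume "coprime e L"
    \<comment> \<open>Euler's exponent is doubled below because \<open>totient e\<close> may be 1,
      while the exponent of a period has to exceed 1.\<close>
    hence "[L ^ totient e = 1] (mod e)" by (intro euler_theorem) (simp add: coprime_commute)
    hence "[(L ^ totient e) ^ 2 = 1 ^ 2] (mod e)" by (rule cong_pow)
    hence "[L ^ (totient e * 2) = 1] (mod e)" by (simp add: power_mult)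
    moreover have "L ^ (totient e * 2) \<ge> 1" using Lpos by simp
    ultimately have "e dvd L ^ (totient e * 2) - 1" by (simp add: cong_altdef_nat)
    moreover have "totient e * 2 > 1" using epos by (simp add: Suc_lessI totient_gt_0_iff)
    ultimately show "\<exists>n>1. e dvd L ^ n - 1" by blast
  qed
  also have "\<dots> \<longleftrightarrow> e dvd N"
  proof
    assume "coprime e L"
    hence "coprime e (L ^ v)" by simp
    thus "e dvd N" using e N(1) coprime_dvd_mult_right_iff by metis
  next
    assume "e dvd N"
    moreover have "coprime N L" using prime_imp_coprime[OF assms(1) N(2)] coprime_commute by blast
    ultimately show "coprime e L" using coprime_divisors dvd_refl by blast
  qed
  also have "\<dots> \<longleftrightarrow> r pdivides (X [^]\<^bsub>poly_ring R\<^esub> N \<ominus>\<^bsub>poly_ring R\<^esub> \<one>\<^bsub>poly_ring R\<^esub>)"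
    by (simp add: pdivides_X_power_iff[OF rc] pow flip: x_def)
  finally show ?thesis .
qed

text \<open>The irreducible factors of the squarefree polynomial X^N - 1 have degrees at most k that
  add up to N, and those of degree k are the good irreducibles other than X. The summand k pays for
  X, the sum over j < k for the factors of lower degree.\<close>

lemma card_periodic_irreds_bounds:
  assumes q: "card (carrier R) = p ^ d" "prime (p :: nat)"
    and q1: "card (carrier R) > 1" and L: "prime (L :: nat)" and k: "k > 0"
    and N: "card (carrier R) ^ k - 1 = L ^ v * N" "\<not> L dvd N"
  shows "k * card (periodic_irreds L \<inter> irreds k) \<le> N + k"
    and "N \<le> k * card (periodic_irreds L \<inter> irreds k) + (\<Sum>j<k. j * card (carrier R) ^ j)"
proof -
  define f where "f = X [^]\<^bsub>poly_ring R\<^esub> N \<ominus>\<^bsub>poly_ring R\<^esub> \<one>\<^bsub>poly_ring R\<^esub>"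
  define D where "D = irred_divisors f"
  have Q: "card (carrier R) ^ k > 1" using q1 k by (intro one_less_power) auto
  have Npos: "N > 0" using N(2) by (metis dvd_0_right not_gr_zero)
  have Ndvd: "N dvd card (carrier R) ^ k - 1" using N(1) by simp
  have fm: "f \<in> monics N" unfolding f_def by (rule binomial_monic[OF Npos])
  have finD: "finite D" unfolding D_def by (rule finite_irred_divisors[OF fm])
  have sumD: "(\<Sum>r\<in>D. degree r) = N"
    unfolding D_def by (rule sum_degree_irred_divisors(2)[OF fm])
      (unfold f_def, rule squarefree_binomial[OF q Ndvd Q])
  have degD: "degree r \<le> k" if "r \<in> D" for r
    using that degree_irred_binomial_divisor[OF q Ndvd Q, of r] by (simp add: D_def irred_divisors_def f_def)
  have iff: "r \<in> periodic_irreds L \<longleftrightarrow> r \<in> D" if "r \<in> irreds k" "r \<noteq> X" for r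
    using periodic_irreds_iff[OF L _ _ that(2) q1 N] irredsD[OF that(1)]
    by (simp add: D_def irred_divisors_def f_def)
  have sum_irreds: "(\<Sum>r\<in>E. degree r) = j * card E" if "E \<subseteq> irreds j" for j E
  proof -
    have "(\<Sum>r\<in>E. degree r) = (\<Sum>r\<in>E. j)" by (rule sum.cong[OF refl]) (use that irredsD in blast)
    thus ?thesis by simp
  qed
  have finP: "finite (periodic_irreds L \<inter> irreds k)" by (simp add: finite_irreds)
  \<comment> \<open>X is good but does not divide X^N - 1; it can occur only for k = 1.\<close>
  have "card (periodic_irreds L \<inter> irreds k) \<le> card (insert X (D \<inter> irreds k))"
    using iff finD by (intro card_mono) auto
  also have "\<dots> \<le> card (D \<inter> irreds k) + 1" using finD by (simp add: card_insert_if)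
  finally have "k * card (periodic_irreds L \<inter> irreds k) \<le> k * card (D \<inter> irreds k) + k"
    by (metis add_mult_distrib2 mult.right_neutral mult_le_mono2)
  also have "k * card (D \<inter> irreds k) = (\<Sum>r\<in>D \<inter> irreds k. degree r)"
    by (rule sum_irreds[symmetric]) blast
  also have "\<dots> \<le> (\<Sum>r\<in>D. degree r)" by (rule sum_mono2[OF finD]) auto
  finally have "k * card (periodic_irreds L \<inter> irreds k) \<le> (\<Sum>r\<in>D. degree r) + k" by simp
  thus "k * card (periodic_irreds L \<inter> irreds k) \<le> N + k" unfolding sumD .
  have X: "X \<in> periodic_irreds L"
  proof -
    have "X pdivides (X [^]\<^bsub>poly_ring R\<^esub> Suc m \<ominus>\<^bsub>poly_ring R\<^esub> X)" for m
    proof -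
      have "X \<otimes>\<^bsub>poly_ring R\<^esub> (X [^]\<^bsub>poly_ring R\<^esub> m \<ominus>\<^bsub>poly_ring R\<^esub> \<one>\<^bsub>poly_ring R\<^esub>)
          = X \<otimes>\<^bsub>poly_ring R\<^esub> X [^]\<^bsub>poly_ring R\<^esub> m \<ominus>\<^bsub>poly_ring R\<^esub> X"
        using X_closed by (simp add: UP.r_distr UP.minus_eq UP.r_minus)
      also have "X \<otimes>\<^bsub>poly_ring R\<^esub> X [^]\<^bsub>poly_ring R\<^esub> m = X [^]\<^bsub>poly_ring R\<^esub> Suc m"
        using UP.m_comm[OF X_closed, of "X [^]\<^bsub>poly_ring R\<^esub> m"] X_closed by simp
      finally have "X [^]\<^bsub>poly_ring R\<^esub> Suc m \<ominus>\<^bsub>poly_ring R\<^esub> X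
          = X \<otimes>\<^bsub>poly_ring R\<^esub> (X [^]\<^bsub>poly_ring R\<^esub> m \<ominus>\<^bsub>poly_ring R\<^esub> \<one>\<^bsub>poly_ring R\<^esub>)" ..
      thus ?thesis using pdivides_mult[OF X_closed] X_closed by simp
    qed
    moreover have "L ^ 2 = Suc (L ^ 2 - 1)" using L prime_gt_0_nat[of L] by simp
    ultimately have "X pdivides (X [^]\<^bsub>poly_ring R\<^esub> (L ^ 2) \<ominus>\<^bsub>poly_ring R\<^esub> X)" by metis
    thus ?thesis using X_irred by (auto simp: periodic_irreds_def periodic_poly_def intro!: exI[of _ 2])
  qed
  have "D \<inter> irreds k \<subseteq> periodic_irreds L \<inter> irreds k" using iff X by blast
  hence le: "card (D \<inter> irreds k) \<le> card (periodic_irreds L \<inter> irreds k)" by (rule card_mono[OF finP])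
  have "D \<subseteq> (D \<inter> irreds k) \<union> (\<Union>j<k. irreds j)"
  proof
    fix r assume r: "r \<in> D"
    hence "r \<in> irreds (degree r)" by (simp add: D_def irred_divisors_def irred_def)
    thus "r \<in> (D \<inter> irreds k) \<union> (\<Union>j<k. irreds j)"
      using degD[OF r] r by (cases "degree r = k") auto
  qed
  hence "N \<le> (\<Sum>r\<in>(D \<inter> irreds k) \<union> (\<Union>j<k. irreds j). degree r)"
    unfolding sumD[symmetric] using finD finite_irreds by (intro sum_mono2) auto
  also have "\<dots> \<le> (\<Sum>r\<in>D \<inter> irreds k. degree r) + (\<Sum>r\<in>(\<Union>j<k. irreds j). degree r)"
    using finD finite_irreds by (simp add: sum_Un_nat)
  also have "(\<Sum>r\<in>(\<Union>j<k. irreds j). degree r) = (\<Sum>j<k. \<Sum>r\<in>irreds j. degree r)"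
  proof (rule sum.UNION_disjoint)
    show "\<forall>i\<in>{..<k}. \<forall>j\<in>{..<k}. i \<noteq> j \<longrightarrow> irreds i \<inter> irreds j = {}"
      using irredsD by (metis disjoint_iff)
  qed (simp_all add: finite_irreds)
  also have "\<dots> = (\<Sum>j<k. j * card (irreds j))" by (intro sum.cong refl sum_irreds) simp
  \<comment> \<open>Counting all monic polynomials of degree j is crude, yet the total remains of
    lower order than |F|^k.\<close>
  also have "\<dots> \<le> (\<Sum>j<k. j * card (carrier R) ^ j)"
    unfolding card_monics[symmetric] using finite_monics
    by (intro sum_mono mult_le_mono2 card_mono) (auto simp: irreds_def)
  also have "(\<Sum>r\<in>D \<inter> irreds k. degree r) = k * card (D \<inter> irreds k)"
    by (rule sum_irreds) blast
  finally show "N \<le> k * card (periodic_irreds L \<inter> irreds k) + (\<Sum>j<k. j * card (carrier R) ^ j)"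
    using le mult_le_mono2[OF le, of k] by linarith
qed

end

section \<open>Matrices over a finite field\<close>

lemma (in abelian_monoid) finsum_swap:
  assumes "finite A" "finite B" "\<And>i j. i \<in> A \<Longrightarrow> j \<in> B \<Longrightarrow> f i j \<in> carrier G"
  shows "(\<Oplus>i\<in>A. \<Oplus>j\<in>B. f i j) = (\<Oplus>j\<in>B. \<Oplus>i\<in>A. f i j)"
  using assms(1,3)
proof (induction A rule: finite_induct)
  case (insert a A)
  have 1: "(\<lambda>i. \<Oplus>j\<in>B. f i j) \<in> A \<rightarrow> carrier G" "(\<Oplus>j\<in>B. f a j) \<in> carrier G"
    "(\<lambda>j. \<Oplus>i\<in>A. f i j) \<in> B \<rightarrow> carrier G" "f a \<in> B \<rightarrow> carrier G"
    using insert.prems by (auto intro!: finsum_closed)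
  have "(\<Oplus>i\<in>insert a A. \<Oplus>j\<in>B. f i j) = (\<Oplus>j\<in>B. f a j) \<oplus> (\<Oplus>i\<in>A. \<Oplus>j\<in>B. f i j)"
    using insert.hyps 1 by (intro finsum_insert) auto
  also have "\<dots> = (\<Oplus>j\<in>B. f a j) \<oplus> (\<Oplus>j\<in>B. \<Oplus>i\<in>A. f i j)" using insert by simp
  also have "\<dots> = (\<Oplus>j\<in>B. f a j \<oplus> (\<Oplus>i\<in>A. f i j))" using 1 by (simp add: finsum_addf)
  also have "\<dots> = (\<Oplus>j\<in>B. \<Oplus>i\<in>insert a A. f i j)"
    using insert.hyps insert.prems 1 by (intro finsum_cong') (auto simp: finsum_insert Pi_def)
  finally show ?case .
qed simp

context finite_field
begin

abbreviation "MR \<equiv> mat_ring R"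

text \<open>Extensional functions: two vectors are equal as soon as their n entries agree, and the
  vectors form a finite set.\<close>

definition vecs :: "nat \<Rightarrow> (nat \<Rightarrow> 'a) set" where
  "vecs n = ({..<n} \<rightarrow>\<^sub>E carrier R)"

definition act :: "nat \<Rightarrow> 'a mat \<Rightarrow> (nat \<Rightarrow> 'a) \<Rightarrow> nat \<Rightarrow> 'a" where
  "act n A v = (\<lambda>i\<in>{..<n}. \<Oplus>k\<in>{..<n}. A $$ (i, k) \<otimes> v k)"

definition mat_col :: "nat \<Rightarrow> 'a mat \<Rightarrow> nat \<Rightarrow> nat \<Rightarrow> 'a" where
  "mat_col n A j = (\<lambda>i\<in>{..<n}. A $$ (i, j))"

definition unitv :: "nat \<Rightarrow> nat \<Rightarrow> nat \<Rightarrow> 'a" where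
  "unitv n j = (\<lambda>i\<in>{..<n}. if i = j then \<one> else \<zero>)"

definition zerov :: "nat \<Rightarrow> nat \<Rightarrow> 'a" where
  "zerov n = (\<lambda>i\<in>{..<n}. \<zero>)"

lemma finite_vecs: "finite (vecs n)"
  unfolding vecs_def by (intro finite_PiE finite_carrier) simp

lemma card_vecs: "card (vecs n) = card (carrier R) ^ n"
  by (simp add: vecs_def card_PiE)

lemma vecsD: "v \<in> vecs n \<Longrightarrow> i < n \<Longrightarrow> v i \<in> carrier R"
  by (auto simp: vecs_def)

lemma vecs_eqI: "v \<in> vecs n \<Longrightarrow> w \<in> vecs n \<Longrightarrow> (\<And>i. i < n \<Longrightarrow> v i = w i) \<Longrightarrow> v = w"
  unfolding vecs_def by (erule (1) PiE_ext) simp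

lemma unitv_closed [simp]: "unitv n j \<in> vecs n"
  by (simp add: unitv_def vecs_def restrict_PiE_iff)

lemma zerov_closed [simp]: "zerov n \<in> vecs n"
  by (simp add: zerov_def vecs_def restrict_PiE_iff)

lemma mat_carrier_iff:
  "A \<in> carrier (MR n) \<longleftrightarrow> A \<in> carrier_mat n n \<and> (\<forall>i<n. \<forall>j<n. A $$ (i, j) \<in> carrier R)"
  by (auto simp: mat_ring_def dest!: elements_matD)

lemma mat_entry: "A \<in> carrier (MR n) \<Longrightarrow> i < n \<Longrightarrow> j < n \<Longrightarrow> A $$ (i, j) \<in> carrier R"
  by (simp add: mat_carrier_iff)

lemma mat_carrierI:
  "(\<And>i j. i < n \<Longrightarrow> j < n \<Longrightarrow> f i j \<in> carrier R) \<Longrightarrow> mat n n (\<lambda>(i, j). f i j) \<in> carrier (MR n)"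
  by (auto simp: mat_carrier_iff)

lemma mat_mult_def: "A \<otimes>\<^bsub>MR n\<^esub> B = mat n n (\<lambda>(i, j). \<Oplus>k\<in>{..<n}. A $$ (i, k) \<otimes> B $$ (k, j))"
  by (simp add: mat_ring_def)

lemma mat_one_def: "\<one>\<^bsub>MR n\<^esub> = mat n n (\<lambda>(i, j). if i = j then \<one> else \<zero>)"
  by (simp add: mat_ring_def)

lemma mat_mult_closed:
  "A \<in> carrier (MR n) \<Longrightarrow> B \<in> carrier (MR n) \<Longrightarrow> A \<otimes>\<^bsub>MR n\<^esub> B \<in> carrier (MR n)"
  unfolding mat_mult_def by (intro mat_carrierI finsum_closed) (simp add: mat_entry)

lemma mat_one_closed: "\<one>\<^bsub>MR n\<^esub> \<in> carrier (MR n)"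
  unfolding mat_one_def by (intro mat_carrierI) auto

lemma act_closed:
  assumes "A \<in> carrier (MR n)" "v \<in> vecs n"
  shows "act n A v \<in> vecs n"
  unfolding act_def vecs_def restrict_PiE_iff
  by (intro ballI finsum_closed) (use vecsD[OF assms(2)] mat_entry[OF assms(1)] in auto)

lemma mat_col_closed: "A \<in> carrier (MR n) \<Longrightarrow> j < n \<Longrightarrow> mat_col n A j \<in> vecs n"
  by (simp add: mat_col_def vecs_def restrict_PiE_iff mat_entry)

lemma mat_eqI:
  assumes "A \<in> carrier (MR n)" "B \<in> carrier (MR n)" "\<And>j. j < n \<Longrightarrow> mat_col n A j = mat_col n B j"
  shows "A = B"
proof (rule eq_matI)
  fix i j assume "i < dim_row B" "j < dim_col B"
  hence "i < n" "j < n" using assms(2) by (auto simp: mat_carrier_iff)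
  thus "A $$ (i, j) = B $$ (i, j)"
    using fun_cong[OF assms(3), of j i] by (simp add: mat_col_def)
qed (use assms in \<open>auto simp: mat_carrier_iff\<close>)

lemma mat_col_mult:
  assumes "A \<in> carrier (MR n)" "B \<in> carrier (MR n)" "j < n"
  shows "mat_col n (A \<otimes>\<^bsub>MR n\<^esub> B) j = act n A (mat_col n B j)"
  unfolding act_def mat_col_def[of n "A \<otimes>\<^bsub>MR n\<^esub> B"]
proof (rule restrict_ext)
  fix i assume i: "i \<in> {..<n}"
  have "(A \<otimes>\<^bsub>MR n\<^esub> B) $$ (i, j) = (\<Oplus>k\<in>{..<n}. A $$ (i, k) \<otimes> B $$ (k, j))"
    using i assms by (simp add: mat_mult_def)
  also have "\<dots> = (\<Oplus>k\<in>{..<n}. A $$ (i, k) \<otimes> mat_col n B j k)"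
    using i assms by (intro finsum_cong') (auto simp: mat_col_def mat_entry)
  finally show "(A \<otimes>\<^bsub>MR n\<^esub> B) $$ (i, j) = (\<Oplus>k\<in>{..<n}. A $$ (i, k) \<otimes> mat_col n B j k)" .
qed

lemma mat_col_one: "j < n \<Longrightarrow> mat_col n \<one>\<^bsub>MR n\<^esub> j = unitv n j"
  unfolding mat_col_def unitv_def by (rule restrict_ext) (simp add: mat_one_def)

lemma act_unitv:
  assumes "A \<in> carrier (MR n)" "j < n"
  shows "act n A (unitv n j) = mat_col n A j"
  unfolding act_def mat_col_def
proof (rule restrict_ext)
  fix i assume i: "i \<in> {..<n}"
  have "(\<Oplus>k\<in>{..<n}. A $$ (i, k) \<otimes> unitv n j k) = (\<Oplus>k\<in>{..<n}. if j = k then A $$ (i, k) else \<zero>)"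
    using assms i by (intro finsum_cong') (auto simp: unitv_def mat_entry)
  also have "\<dots> = A $$ (i, j)"
    using assms i by (intro finsum_singleton) (auto simp: mat_entry)
  finally show "(\<Oplus>k\<in>{..<n}. A $$ (i, k) \<otimes> unitv n j k) = A $$ (i, j)" .
qed

text \<open>Interchange of two finite sums. Read column by column, this is the associativity of the
  matrix product.\<close>

lemma act_mult:
  assumes "A \<in> carrier (MR n)" "B \<in> carrier (MR n)" "v \<in> vecs n"
  shows "act n (A \<otimes>\<^bsub>MR n\<^esub> B) v = act n A (act n B v)"
  unfolding act_def
proof (rule restrict_ext)
  fix i assume i: "i \<in> {..<n}"
  note cl = vecsD[OF assms(3)] mat_entry[OF assms(1)] mat_entry[OF assms(2)]
  have "(\<Oplus>k\<in>{..<n}. (A \<otimes>\<^bsub>MR n\<^esub> B) $$ (i, k) \<otimes> v k)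
      = (\<Oplus>k\<in>{..<n}. \<Oplus>m\<in>{..<n}. A $$ (i, m) \<otimes> B $$ (m, k) \<otimes> v k)"
  proof (rule finsum_cong')
    fix k assume k: "k \<in> {..<n}"
    have "(A \<otimes>\<^bsub>MR n\<^esub> B) $$ (i, k) = (\<Oplus>m\<in>{..<n}. A $$ (i, m) \<otimes> B $$ (m, k))"
      using i k by (simp add: mat_mult_def)
    thus "(A \<otimes>\<^bsub>MR n\<^esub> B) $$ (i, k) \<otimes> v k = (\<Oplus>m\<in>{..<n}. A $$ (i, m) \<otimes> B $$ (m, k) \<otimes> v k)"
      using i k cl by (simp add: finsum_ldistr Pi_def)
  qed (use i cl in \<open>auto intro!: finsum_closed\<close>)
  also have "\<dots> = (\<Oplus>m\<in>{..<n}. \<Oplus>k\<in>{..<n}. A $$ (i, m) \<otimes> B $$ (m, k) \<otimes> v k)"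
    by (rule finsum_swap) (use i cl in auto)
  also have "\<dots> = (\<Oplus>m\<in>{..<n}. A $$ (i, m) \<otimes> (\<Oplus>k\<in>{..<n}. B $$ (m, k) \<otimes> v k))"
  proof (rule finsum_cong')
    fix m assume m: "m \<in> {..<n}"
    have "A $$ (i, m) \<otimes> (\<Oplus>k\<in>{..<n}. B $$ (m, k) \<otimes> v k) = (\<Oplus>k\<in>{..<n}. A $$ (i, m) \<otimes> (B $$ (m, k) \<otimes> v k))"
      by (rule finsum_rdistr) (use i m cl in auto)
    also have "\<dots> = (\<Oplus>k\<in>{..<n}. A $$ (i, m) \<otimes> B $$ (m, k) \<otimes> v k)"
      by (rule finsum_cong') (use i m cl in \<open>auto simp: m_assoc\<close>)
    finally show "(\<Oplus>k\<in>{..<n}. A $$ (i, m) \<otimes> B $$ (m, k) \<otimes> v k)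
        = A $$ (i, m) \<otimes> (\<Oplus>k\<in>{..<n}. B $$ (m, k) \<otimes> v k)" ..
  qed (use i cl in \<open>auto intro!: finsum_closed\<close>)
  also have "\<dots> = (\<Oplus>m\<in>{..<n}. A $$ (i, m) \<otimes> (\<lambda>i\<in>{..<n}. \<Oplus>k\<in>{..<n}. B $$ (i, k) \<otimes> v k) m)"
    by (rule finsum_cong') (use i cl in \<open>auto intro!: finsum_closed\<close>)
  finally show "(\<Oplus>k\<in>{..<n}. (A \<otimes>\<^bsub>MR n\<^esub> B) $$ (i, k) \<otimes> v k)
      = (\<Oplus>m\<in>{..<n}. A $$ (i, m) \<otimes> (\<lambda>i\<in>{..<n}. \<Oplus>k\<in>{..<n}. B $$ (i, k) \<otimes> v k) m)" .
qed

lemma act_one: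
  assumes "v \<in> vecs n"
  shows "act n \<one>\<^bsub>MR n\<^esub> v = v"
proof (rule vecs_eqI[OF act_closed[OF mat_one_closed assms] assms])
  fix i assume i: "i < n"
  have "act n \<one>\<^bsub>MR n\<^esub> v i = (\<Oplus>k\<in>{..<n}. \<one>\<^bsub>MR n\<^esub> $$ (i, k) \<otimes> v k)" using i by (simp add: act_def)
  also have "\<dots> = (\<Oplus>k\<in>{..<n}. if i = k then v k else \<zero>)"
    using i vecsD[OF assms] by (intro finsum_cong') (auto simp: mat_one_def)
  also have "\<dots> = v i" using i vecsD[OF assms] by (intro finsum_singleton) auto
  finally show "act n \<one>\<^bsub>MR n\<^esub> v i = v i" .
qed

lemma mat_ring_monoid: "monoid (MR n)"
proof (rule monoidI)
  fix A B C assume c: "A \<in> carrier (MR n)" "B \<in> carrier (MR n)" "C \<in> carrier (MR n)"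
  show "A \<otimes>\<^bsub>MR n\<^esub> B \<otimes>\<^bsub>MR n\<^esub> C = A \<otimes>\<^bsub>MR n\<^esub> (B \<otimes>\<^bsub>MR n\<^esub> C)"
    by (rule mat_eqI[of _ n]) (use c in \<open>simp_all add: mat_mult_closed mat_col_mult act_mult mat_col_closed\<close>)
next
  fix A assume c: "A \<in> carrier (MR n)"
  show "\<one>\<^bsub>MR n\<^esub> \<otimes>\<^bsub>MR n\<^esub> A = A"
    by (rule mat_eqI[of _ n]) (use c in \<open>simp_all add: mat_mult_closed mat_one_closed mat_col_mult act_one mat_col_closed\<close>)
  show "A \<otimes>\<^bsub>MR n\<^esub> \<one>\<^bsub>MR n\<^esub> = A"
    by (rule mat_eqI[of _ n]) (use c in \<open>simp_all add: mat_mult_closed mat_one_closed mat_col_mult mat_col_one act_unitv\<close>)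
qed (simp_all add: mat_mult_closed mat_one_closed)

text \<open>One law for both later uses: differences are the case c = -1, scalar multiples the case
  of a zero vector v.\<close>

lemma act_linear:
  assumes "A \<in> carrier (MR n)" "v \<in> vecs n" "w \<in> vecs n" "c \<in> carrier R"
  shows "act n A (\<lambda>i\<in>{..<n}. v i \<oplus> c \<otimes> w i) = (\<lambda>i\<in>{..<n}. act n A v i \<oplus> c \<otimes> act n A w i)"
proof (rule ext)
  fix i
  note cl = mat_entry[OF assms(1)] vecsD[OF assms(2)] vecsD[OF assms(3)] assms(4)
  show "act n A (\<lambda>i\<in>{..<n}. v i \<oplus> c \<otimes> w i) i = (\<lambda>i\<in>{..<n}. act n A v i \<oplus> c \<otimes> act n A w i) i"
  proof (cases "i < n")
    case True
    have "(\<Oplus>k\<in>{..<n}. A $$ (i, k) \<otimes> (\<lambda>i\<in>{..<n}. v i \<oplus> c \<otimes> w i) k)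
        = (\<Oplus>k\<in>{..<n}. A $$ (i, k) \<otimes> v k \<oplus> c \<otimes> (A $$ (i, k) \<otimes> w k))"
      by (rule finsum_cong') (use True cl in \<open>auto simp: r_distr m_lcomm\<close>)
    also have "\<dots> = (\<Oplus>k\<in>{..<n}. A $$ (i, k) \<otimes> v k) \<oplus> (\<Oplus>k\<in>{..<n}. c \<otimes> (A $$ (i, k) \<otimes> w k))"
      by (rule finsum_addf) (use True cl in auto)
    also have "(\<Oplus>k\<in>{..<n}. c \<otimes> (A $$ (i, k) \<otimes> w k)) = c \<otimes> (\<Oplus>k\<in>{..<n}. A $$ (i, k) \<otimes> w k)"
      by (rule finsum_rdistr[symmetric]) (use True cl in auto)
    finally show ?thesis using True by (simp add: act_def)
  qed (simp add: act_def)
qed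

lemma act_zerov:
  assumes "A \<in> carrier (MR n)"
  shows "act n A (zerov n) = zerov n"
  unfolding act_def zerov_def
proof (rule restrict_ext)
  fix i assume i: "i \<in> {..<n}"
  have "(\<Oplus>k\<in>{..<n}. A $$ (i, k) \<otimes> (\<lambda>i\<in>{..<n}. \<zero>) k) = (\<Oplus>k\<in>{..<n}. \<zero>)"
    by (rule finsum_cong') (use i mat_entry[OF assms] in auto)
  thus "(\<Oplus>k\<in>{..<n}. A $$ (i, k) \<otimes> (\<lambda>i\<in>{..<n}. \<zero>) k) = \<zero>" by simp
qed

lemma act_scale:
  assumes "A \<in> carrier (MR n)" "v \<in> vecs n" "act n A v = zerov n" "c \<in> carrier R"
  shows "act n A (\<lambda>i\<in>{..<n}. c \<otimes> v i) = zerov n"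
proof -
  have "(\<lambda>i\<in>{..<n}. c \<otimes> v i) = (\<lambda>i\<in>{..<n}. zerov n i \<oplus> c \<otimes> v i)"
    using vecsD[OF assms(2)] assms(4) by (intro restrict_ext) (simp add: zerov_def)
  moreover have "act n A (\<lambda>i\<in>{..<n}. zerov n i \<oplus> c \<otimes> v i) = zerov n"
    unfolding act_linear[OF assms(1) zerov_closed assms(2,4)] act_zerov[OF assms(1)] assms(3)
    using assms(4) by (auto simp: zerov_def intro!: restrict_ext)
  ultimately show ?thesis by simp
qed

section \<open>Counting matrices and bounding the number of singular ones\<close>

lemma card_mat_carrier: "card (carrier (MR n)) = card (carrier R) ^ (n * n)"
  and finite_mat_carrier: "finite (carrier (MR n))"
proof -
  let ?P = "({..<n} \<times> {..<n}) \<rightarrow>\<^sub>E carrier R"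
  have "bij_betw (\<lambda>A. restrict (\<lambda>ij. A $$ ij) ({..<n} \<times> {..<n})) (carrier (MR n)) ?P"
  proof (rule bij_betw_byWitness[where f' = "\<lambda>g. mat n n g"])
    show "\<forall>A\<in>carrier (MR n). mat n n (restrict (\<lambda>ij. A $$ ij) ({..<n} \<times> {..<n})) = A"
      by (auto simp: mat_carrier_iff intro!: eq_matI)
    show "\<forall>g\<in>?P. restrict (\<lambda>ij. mat n n g $$ ij) ({..<n} \<times> {..<n}) = g"
    proof
      fix g assume g: "g \<in> ?P"
      show "restrict (\<lambda>ij. mat n n g $$ ij) ({..<n} \<times> {..<n}) = g"
      proof
        fix x show "restrict (\<lambda>ij. mat n n g $$ ij) ({..<n} \<times> {..<n}) x = g x"
          using PiE_arb[OF g, of x] by (cases x) auto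
      qed
    qed
    show "(\<lambda>A. restrict (\<lambda>ij. A $$ ij) ({..<n} \<times> {..<n})) ` carrier (MR n) \<subseteq> ?P"
      by (rule image_subsetI, subst restrict_PiE_iff) (auto simp: mat_carrier_iff)
    show "mat n n ` ?P \<subseteq> carrier (MR n)"
    proof (rule image_subsetI)
      fix g assume "g \<in> ?P"
      hence "g (i, j) \<in> carrier R" if "i < n" "j < n" for i j using that by (intro PiE_mem[of g]) auto
      thus "mat n n g \<in> carrier (MR n)" by (simp add: mat_carrier_iff)
    qed
  qed
  moreover have "finite ?P" by (intro finite_PiE finite_carrier) simp
  moreover have "card ?P = card (carrier R) ^ (n * n)" by (simp add: card_PiE)
  ultimately show "card (carrier (MR n)) = card (carrier R) ^ (n * n)" "finite (carrier (MR n))"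
    using bij_betw_same_card bij_betw_finite by metis+
qed

text \<open>Linear algebra by pigeonhole. On the finite set of vectors an injective action is
  surjective, and preimages of the unit vectors are the columns of a right inverse B. From A (B A) =
  A and injectivity also B A = 1. Hence a non-unit identifies two vectors, whose difference lies in
  the kernel.\<close>

lemma non_unit_kernel:
  assumes A: "A \<in> carrier (MR n)" "A \<notin> Units (MR n)"
  obtains v where "v \<in> vecs n" "v \<noteq> zerov n" "act n A v = zerov n"
proof -
  have "\<not> inj_on (act n A) (vecs n)"
  proof
    assume inj: "inj_on (act n A) (vecs n)"
    have "act n A ` vecs n \<subseteq> vecs n" using act_closed[OF A(1)] by blast
    hence surj: "act n A ` vecs n = vecs n" using endo_inj_surj[OF finite_vecs _ inj] by simp
    hence "\<exists>w. w \<in> vecs n \<and> act n A w = unitv n j" for j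
      by (metis imageE unitv_closed)
    then obtain w where w: "\<And>j. w j \<in> vecs n" "\<And>j. act n A (w j) = unitv n j" by metis
    define B where "B = mat n n (\<lambda>(i, j). w j i)"
    have B: "B \<in> carrier (MR n)" unfolding B_def by (intro mat_carrierI vecsD[OF w(1)])
    have colB: "mat_col n B j = w j" if "j < n" for j
      by (rule vecs_eqI[OF mat_col_closed[OF B that] w(1)]) (use that in \<open>simp add: mat_col_def B_def\<close>)
    interpret M: monoid "MR n" by (rule mat_ring_monoid)
    have AB: "A \<otimes>\<^bsub>MR n\<^esub> B = \<one>\<^bsub>MR n\<^esub>"
      by (rule mat_eqI[of _ n]) (use A B w in \<open>simp_all add: mat_col_mult mat_col_one colB\<close>)
    have "B \<otimes>\<^bsub>MR n\<^esub> A = \<one>\<^bsub>MR n\<^esub>"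
    proof (rule mat_eqI[of _ n])
      fix j assume j: "j < n"
      have "act n A (mat_col n (B \<otimes>\<^bsub>MR n\<^esub> A) j) = mat_col n (A \<otimes>\<^bsub>MR n\<^esub> (B \<otimes>\<^bsub>MR n\<^esub> A)) j"
        using A B j by (simp add: mat_col_mult mat_mult_closed)
      also have "A \<otimes>\<^bsub>MR n\<^esub> (B \<otimes>\<^bsub>MR n\<^esub> A) = A" using AB A B by (simp flip: M.m_assoc)
      also have "mat_col n A j = act n A (mat_col n \<one>\<^bsub>MR n\<^esub> j)"
        using A j by (simp add: mat_col_one act_unitv)
      finally show "mat_col n (B \<otimes>\<^bsub>MR n\<^esub> A) j = mat_col n \<one>\<^bsub>MR n\<^esub> j"
        using inj A B j by (auto dest!: inj_onD simp: mat_col_closed)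
    qed (use A B in simp_all)
    thus False using A AB B by (auto simp: Units_def)
  qed
  then obtain v w where vw: "v \<in> vecs n" "w \<in> vecs n" "v \<noteq> w" "act n A v = act n A w"
    by (auto simp: inj_on_def)
  define u where "u = (\<lambda>i\<in>{..<n}. v i \<oplus> (\<ominus> \<one>) \<otimes> w i)"
  note cl = vecsD[OF vw(1)] vecsD[OF vw(2)] vecsD[OF act_closed[OF A(1) vw(2)]]
  have "u \<in> vecs n" using cl by (auto simp: u_def vecs_def)
  moreover have "u \<noteq> zerov n"
  proof
    assume "u = zerov n"
    have "v i = w i" if "i < n" for i
    proof -
      have "v i \<ominus> w i = \<zero>" using fun_cong[OF \<open>u = zerov n\<close>, of i] that cl
        by (simp add: u_def zerov_def l_minus minus_eq)
      thus ?thesis using cl that by simp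
    qed
    thus False using vecs_eqI[OF vw(1,2)] vw(3) by blast
  qed
  moreover have "act n A u = zerov n"
    unfolding u_def using cl
    by (subst act_linear[OF A(1) vw(1,2)]) (auto simp: vw(4) zerov_def l_minus r_neg intro!: restrict_ext)
  ultimately show ?thesis using that by blast
qed

text \<open>At an index j with v j nonzero, each row equation determines the entry in column j from
  the others, so n (n - 1) entries determine the matrix.\<close>

lemma card_annihilating_matrices:
  assumes v: "v \<in> vecs n" "v \<noteq> zerov n"
  shows "card {A \<in> carrier (MR n). act n A v = zerov n} \<le> card (carrier R) ^ (n * (n - 1))"
proof -
  obtain j where j: "j < n" "v j \<noteq> \<zero>"
    using vecs_eqI[OF v(1) zerov_closed] v(2) by (auto simp: zerov_def)
  let ?I = "{..<n} \<times> ({..<n} - {j})"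
  let ?g = "\<lambda>A. restrict (\<lambda>ij. A $$ ij) ?I"
  let ?K = "{A \<in> carrier (MR n). act n A v = zerov n}"
  have "inj_on ?g ?K"
  proof (rule inj_onI)
    fix A B assume A: "A \<in> ?K" and B: "B \<in> ?K" and eq: "?g A = ?g B"
    have entries: "A $$ (i, k) = B $$ (i, k)" if "i < n" "k < n" "k \<noteq> j" for i k
      using fun_cong[OF eq, of "(i, k)"] that by simp
    have split: "C $$ (i, j) \<otimes> v j \<oplus> (\<Oplus>k\<in>{..<n} - {j}. C $$ (i, k) \<otimes> v k) = \<zero>"
      if "C \<in> ?K" "i < n" for C i
    proof -
      have "\<zero> = (\<Oplus>k\<in>insert j ({..<n} - {j}). C $$ (i, k) \<otimes> v k)"
      proof -
        have "act n C v i = zerov n i" using that(1) by simp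
        hence "(\<Oplus>k\<in>{..<n}. C $$ (i, k) \<otimes> v k) = \<zero>" using that(2) by (simp add: act_def zerov_def)
        moreover have "insert j ({..<n} - {j}) = {..<n}" using j by auto
        ultimately show ?thesis by simp
      qed
      also have "\<dots> = C $$ (i, j) \<otimes> v j \<oplus> (\<Oplus>k\<in>{..<n} - {j}. C $$ (i, k) \<otimes> v k)"
        by (rule finsum_insert) (use that j vecsD[OF v(1)] in \<open>auto simp: mat_entry\<close>)
      finally show ?thesis ..
    qed
    have col: "A $$ (i, j) = B $$ (i, j)" if i: "i < n" for i
    proof -
      let ?s = "\<Oplus>k\<in>{..<n} - {j}. A $$ (i, k) \<otimes> v k"
      have s: "?s \<in> carrier R" using A i vecsD[OF v(1)] by (intro finsum_closed) (auto simp: mat_entry)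
      have "?s = (\<Oplus>k\<in>{..<n} - {j}. B $$ (i, k) \<otimes> v k)"
        using entries i B vecsD[OF v(1)] by (intro finsum_cong') (auto simp: mat_entry)
      hence "A $$ (i, j) \<otimes> v j \<oplus> ?s = B $$ (i, j) \<otimes> v j \<oplus> ?s"
        using split[OF A i] split[OF B i] by simp
      hence "A $$ (i, j) \<otimes> v j = B $$ (i, j) \<otimes> v j"
        by (rule add.right_cancel[OF s, THEN iffD1, rotated -1])
           (use A B i j vecsD[OF v(1)] in \<open>auto simp: mat_entry\<close>)
      moreover have "A $$ (i, j) \<in> carrier R" "B $$ (i, j) \<in> carrier R"
        using A B i j mat_entry by blast+
      ultimately show ?thesis using m_rcancel[of "v j"] j vecsD[OF v(1)] by simp
    qed
    show "A = B"
    proof (rule eq_matI)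
      fix i k assume "i < dim_row B" "k < dim_col B"
      hence "i < n" "k < n" using B by (auto simp: mat_carrier_iff)
      thus "A $$ (i, k) = B $$ (i, k)" using entries col by (cases "k = j") auto
    qed (use A B in \<open>auto simp: mat_carrier_iff\<close>)
  qed
  moreover have "?g ` ?K \<subseteq> ?I \<rightarrow>\<^sub>E carrier R"
    by (rule image_subsetI, subst restrict_PiE_iff) (auto simp: mat_entry)
  moreover have "finite (?I \<rightarrow>\<^sub>E carrier R)" by (intro finite_PiE finite_carrier) simp
  ultimately have "card ?K \<le> card (?I \<rightarrow>\<^sub>E carrier R)" by (rule card_inj_on_le)
  also have "\<dots> = card (carrier R) ^ (n * (n - 1))" using j by (simp add: card_PiE card_cartesian_product)
  finally show ?thesis .
qed

text \<open>Double counting of pairs of a non-unit A and a nonzero v with A v = 0. Each A occurs at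
  least |F| - 1 times, with the nonzero multiples of one kernel vector, and each v occurs with at
  most |F|^(n(n-1)) matrices. The proportion of non-units is thus at most 1/(|F| - 1), and the exact
  order of GL_n is avoided.\<close>

lemma card_non_units:
  assumes "n > 0"
  shows "(card (carrier R) - 1) * card (carrier (MR n) - Units (MR n)) \<le> card (carrier R) ^ (n * n)"
proof -
  let ?S = "carrier (MR n) - Units (MR n)" and ?V = "vecs n - {zerov n}"
  have fin: "finite ?S" "finite ?V" using finite_mat_carrier finite_vecs by auto
  have kernel: "card (carrier R) - 1 \<le> card {v \<in> ?V. act n A v = zerov n}" if A: "A \<in> ?S" for A
  proof -
    obtain v where v: "v \<in> vecs n" "v \<noteq> zerov n" "act n A v = zerov n"
      using non_unit_kernel A by blast
    obtain j where j: "j < n" "v j \<noteq> \<zero>"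
      using vecs_eqI[OF v(1) zerov_closed] v(2) by (auto simp: zerov_def)
    let ?h = "\<lambda>c. \<lambda>i\<in>{..<n}. c \<otimes> v i"
    have at_j: "?h c j = c \<otimes> v j" for c using j by simp
    have "inj_on ?h (carrier R - {\<zero>})"
    proof (rule inj_onI)
      fix c d assume cd: "c \<in> carrier R - {\<zero>}" "d \<in> carrier R - {\<zero>}" "?h c = ?h d"
      have "c \<otimes> v j = d \<otimes> v j" using fun_cong[OF cd(3), of j] unfolding at_j .
      thus "c = d" using cd j vecsD[OF v(1)] m_rcancel[of "v j" c d] by simp
    qed
    moreover have "?h c \<in> {v \<in> ?V. act n A v = zerov n}" if c: "c \<in> carrier R - {\<zero>}" for c
    proof -
      have "?h c j \<noteq> zerov n j"
        unfolding at_j using c j vecsD[OF v(1)] by (simp add: zerov_def integral_iff)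
      hence "?h c \<noteq> zerov n" using fun_cong[of "?h c" "zerov n" j] by blast
      moreover have "?h c \<in> vecs n" using c vecsD[OF v(1)] by (auto simp: vecs_def)
      moreover have "act n A (?h c) = zerov n" using act_scale[OF _ v(1,3)] A c by blast
      ultimately show ?thesis by blast
    qed
    ultimately have "card (carrier R - {\<zero>}) \<le> card {v \<in> ?V. act n A v = zerov n}"
      using fin(2) by (intro card_inj_on_le[of ?h]) auto
    thus ?thesis using finite_carrier by simp
  qed
  have "(card (carrier R) - 1) * card ?S = (\<Sum>A\<in>?S. card (carrier R) - 1)" by simp
  also have "\<dots> \<le> (\<Sum>A\<in>?S. card {v \<in> ?V. act n A v = zerov n})" by (rule sum_mono[OF kernel])
  also have "\<dots> = (\<Sum>A\<in>?S. \<Sum>v\<in>?V. if act n A v = zerov n then 1 else 0)"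
    using fin(2) by (simp add: sum.If_cases Int_def)
  also have "\<dots> = (\<Sum>v\<in>?V. \<Sum>A\<in>?S. if act n A v = zerov n then 1 else 0)" by (rule sum.swap)
  also have "\<dots> = (\<Sum>v\<in>?V. card {A \<in> ?S. act n A v = zerov n})"
    using fin(1) by (simp add: sum.If_cases Int_def)
  also have "\<dots> \<le> (\<Sum>v\<in>?V. card (carrier R) ^ (n * (n - 1)))"
  proof (rule sum_mono)
    fix v assume v: "v \<in> ?V"
    have "card {A \<in> ?S. act n A v = zerov n} \<le> card {A \<in> carrier (MR n). act n A v = zerov n}"
      using finite_mat_carrier by (intro card_mono) auto
    also have "\<dots> \<le> card (carrier R) ^ (n * (n - 1))" using v by (intro card_annihilating_matrices) auto
    finally show "card {A \<in> ?S. act n A v = zerov n} \<le> card (carrier R) ^ (n * (n - 1))" .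
  qed
  also have "\<dots> = card ?V * card (carrier R) ^ (n * (n - 1))" by simp
  also have "\<dots> \<le> card (carrier R) ^ n * card (carrier R) ^ (n * (n - 1))"
    unfolding card_vecs[symmetric] using finite_vecs by (intro mult_le_mono1 card_mono) auto
  also have "\<dots> = card (carrier R) ^ (n * n)"
    using assms by (cases n) (auto simp flip: power_add)
  finally show ?thesis .
qed

end

section \<open>Companion matrices\<close>

context finite_field
begin

text \<open>Multiplication by X on F[X]/(f) in the basis 1, X, ..., X^(n-1).
  \<open>coeff f i\<close> is the coefficient of X^i, although lists start with the leading one; the
  last column is X^n reduced modulo f.\<close>

definition companion :: "nat \<Rightarrow> 'a list \<Rightarrow> 'a mat" where
  "companion n f = mat n n (\<lambda>(i, j).
     if j = n - 1 then \<ominus> (coeff f i) else if i = Suc j then \<one> else \<zero>)"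

text \<open>Coordinates of the class of r in the basis 1, X, ..., X^(n-1), meant for
  \<open>length r \<le> n\<close>.\<close>

definition coeff_vec :: "nat \<Rightarrow> 'a list \<Rightarrow> nat \<Rightarrow> 'a" where
  "coeff_vec n r = (\<lambda>i\<in>{..<n}. coeff r i)"

lemma poly_coeff_closed: "r \<in> carrier (poly_ring R) \<Longrightarrow> coeff r i \<in> carrier R"
  by (rule coeff_in_carrier, rule polynomial_in_carrier[OF carrier_is_subring]) (simp add: univ_poly_carrier)

lemma poly_eqI:
  assumes "r \<in> carrier (poly_ring R)" "s \<in> carrier (poly_ring R)" "\<And>i. coeff r i = coeff s i"
  shows "r = s"
  using coeff_iff_polynomial_cond[of "carrier R" r s] assms by (auto simp: univ_poly_carrier)

lemma coeff_vec_closed: "r \<in> carrier (poly_ring R) \<Longrightarrow> coeff_vec n r \<in> vecs n"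
  by (simp add: coeff_vec_def vecs_def restrict_PiE_iff poly_coeff_closed)

lemma coeff_vec_inj:
  assumes "r \<in> carrier (poly_ring R)" "s \<in> carrier (poly_ring R)" "length r \<le> n" "length s \<le> n"
    "coeff_vec n r = coeff_vec n s"
  shows "r = s"
proof (rule poly_eqI[OF assms(1,2)])
  fix i show "coeff r i = coeff s i"
    using fun_cong[OF assms(5), of i] assms(3,4) coeff_length[of r i] coeff_length[of s i]
    by (cases "i < n") (auto simp: coeff_vec_def)
qed

lemma companion_closed: "f \<in> monics n \<Longrightarrow> companion n f \<in> carrier (MR n)"
  unfolding companion_def by (intro mat_carrierI) (auto simp: poly_coeff_closed monics_carrier)

lemma monics_coeff:
  assumes "f \<in> monics n"
  shows "coeff f n = \<one>" "i > n \<Longrightarrow> coeff f i = \<zero>"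
proof -
  have "f \<noteq> []" using assms by (auto simp: monics_def)
  thus "coeff f n = \<one>" "i > n \<Longrightarrow> coeff f i = \<zero>"
  using assms lead_coeff_simp[of f] coeff_length[of f i] by (auto simp: monics_def)
qed

lemma companion_inj:
  assumes "f \<in> monics n" "g \<in> monics n" "n > 0" "companion n f = companion n g"
  shows "f = g"
proof (rule poly_eqI)
  fix i
  show "coeff f i = coeff g i"
  proof (cases "i < n")
    case True
    hence "companion n f $$ (i, n - 1) = \<ominus> (coeff f i)" "companion n g $$ (i, n - 1) = \<ominus> (coeff g i)"
      using assms(3) by (simp_all add: companion_def)
    hence "\<ominus> (coeff f i) = \<ominus> (coeff g i)" using assms(4) by simp
    thus ?thesis using poly_coeff_closed monics_carrier assms(1,2) by (metis minus_minus)
  next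
    case False
    thus ?thesis using monics_coeff[OF assms(1)] monics_coeff[OF assms(2)] by (cases "i = n") auto
  qed
qed (use assms monics_carrier in auto)

lemma coeff_const_mult:
  assumes "c \<in> carrier R" "f \<in> carrier (poly_ring R)"
  shows "coeff (poly_of_const c \<otimes>\<^bsub>poly_ring R\<^esub> f) i = c \<otimes> coeff f i"
proof (cases "c = \<zero>")
  case True
  thus ?thesis using assms poly_coeff_closed[OF assms(2)]
    by (simp add: poly_of_const_def univ_poly_mult)
next
  case False
  have "set f \<subseteq> carrier R" using assms(2) polynomial_in_carrier[OF carrier_is_subring] by (simp add: univ_poly_carrier)
  thus ?thesis using False assms(1) poly_mult_const'(1)[of f c] scalar_coeff[OF assms(1), of f]
    by (simp add: poly_of_const_def univ_poly_mult flip: normalize_coeff)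
qed

lemma coeff_X_mult:
  assumes "r \<in> carrier (poly_ring R)"
  shows "coeff (r \<otimes>\<^bsub>poly_ring R\<^esub> X) i = (if i = 0 then \<zero> else coeff r (i - 1))"
  using poly_mult_var[OF carrier_is_subring assms] append_coeff[of r "[\<zero>]"] by auto

lemma coeff_add:
  assumes "r \<in> carrier (poly_ring R)" "s \<in> carrier (poly_ring R)"
  shows "coeff (r \<oplus>\<^bsub>poly_ring R\<^esub> s) i = coeff r i \<oplus> coeff s i"
  using poly_add_coeff[of r s] assms polynomial_in_carrier[OF carrier_is_subring]
  by (simp add: univ_poly_carrier univ_poly_add)

lemma length_le_if_coeff:
  assumes "r \<in> carrier (poly_ring R)" "\<And>i. i \<ge> n \<Longrightarrow> coeff r i = \<zero>"
  shows "length r \<le> n"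
proof (rule ccontr)
  assume "\<not> length r \<le> n"
  hence r: "r \<noteq> []" "degree r \<ge> n" by auto
  hence "lead_coeff r = \<zero>" using assms(2)[of "degree r"] lead_coeff_simp[of r] by simp
  thus False using lead_coeff_closed[OF assms(1) r(1)] by simp
qed

lemma poly_of_const_closed: "c \<in> carrier R \<Longrightarrow> poly_of_const c \<in> carrier (poly_ring R)"
  by (auto simp: poly_of_const_def polynomial_def simp flip: univ_poly_carrier)

lemma companion_act:
  assumes f: "f \<in> monics n" "n > 0" and r: "r \<in> carrier (poly_ring R)" "length r \<le> n"
  obtains s where "s \<in> carrier (poly_ring R)" "length s \<le> n"
    "act n (companion n f) (coeff_vec n r) = coeff_vec n s"
    "rmap f s = rmap f (r \<otimes>\<^bsub>poly_ring R\<^esub> X)"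
proof -
  define c where "c = coeff r (n - 1)"
  have c: "c \<in> carrier R" using poly_coeff_closed r(1) by (simp add: c_def)
  note fc = monics_carrier[OF f(1)]
  interpret S: cring "rupt f" by (rule rupt_cring[OF fc])
  interpret H: ring_hom_ring "poly_ring R" "rupt f" "rmap f" by (rule rmap_hom[OF fc])
  \<comment> \<open>The remainder of r X: this product may reach degree n with coefficient c there,
    and subtracting c f cancels that coefficient without changing the class.\<close>
  define s where "s = r \<otimes>\<^bsub>poly_ring R\<^esub> X \<oplus>\<^bsub>poly_ring R\<^esub> poly_of_const (\<ominus> c) \<otimes>\<^bsub>poly_ring R\<^esub> f"
  have cc: "poly_of_const (\<ominus> c) \<in> carrier (poly_ring R)" using c poly_of_const_closed by simp
  have s: "s \<in> carrier (poly_ring R)" unfolding s_def using cc r fc X_closed by simp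
  have coeff_s: "coeff s i = (if i = 0 then \<zero> else coeff r (i - 1)) \<oplus> \<ominus> c \<otimes> coeff f i" for i
    unfolding s_def using cc r fc X_closed c
    by (simp add: coeff_add coeff_X_mult coeff_const_mult)
  have len: "length s \<le> n"
  proof (rule length_le_if_coeff[OF s])
    fix i assume i: "i \<ge> n"
    show "coeff s i = \<zero>"
    proof (cases "i = n")
      case True
      thus ?thesis unfolding coeff_s using f c monics_coeff[OF f(1)] by (simp add: c_def r_neg)
    next
      case False
      hence "coeff r (i - 1) = \<zero>" "coeff f i = \<zero>"
        using i r(2) coeff_length[of r "i - 1"] monics_coeff(2)[OF f(1), of i] by auto
      thus ?thesis unfolding coeff_s using c by simp
    qed
  qed
  have "rmap f f = rmap f \<zero>\<^bsub>poly_ring R\<^esub>"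
    using rmap_eq_iff[OF fc fc, of "\<zero>\<^bsub>poly_ring R\<^esub>"] UP.divides_refl[OF fc]
    by (simp add: pdivides_def fc UP.minus_eq)
  hence "rmap f f = \<zero>\<^bsub>rupt f\<^esub>" by simp
  hence "rmap f s = rmap f (r \<otimes>\<^bsub>poly_ring R\<^esub> X)"
    unfolding s_def using cc r fc X_closed by simp
  moreover have "act n (companion n f) (coeff_vec n r) = coeff_vec n s"
  proof (rule vecs_eqI[OF act_closed[OF companion_closed[OF f(1)] coeff_vec_closed[OF r(1)]] coeff_vec_closed[OF s]])
    fix i assume i: "i < n"
    let ?t = "\<lambda>k. companion n f $$ (i, k) \<otimes> coeff_vec n r k"
    have t: "?t k \<in> carrier R" if "k < n" for k
      using that i mat_entry[OF companion_closed[OF f(1)]] poly_coeff_closed[OF r(1)] by (simp add: coeff_vec_def)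
    have ins: "{..<n} = insert (n - 1) {..<n - 1}" using f(2) by auto
    have "(\<Oplus>k\<in>{..<n - 1}. ?t k) = (if i = 0 then \<zero> else coeff r (i - 1))"
    proof (cases "i = 0")
      case True
      have "(\<Oplus>k\<in>{..<n - 1}. ?t k) = (\<Oplus>k\<in>{..<n - 1}. \<zero>)"
        using True f(2) poly_coeff_closed[OF r(1)]
        by (intro finsum_cong') (auto simp: companion_def coeff_vec_def)
      thus ?thesis using True by simp
    next
      case False
      have "(\<Oplus>k\<in>{..<n - 1}. ?t k) = (\<Oplus>k\<in>{..<n - 1}. if i - 1 = k then coeff r k else \<zero>)"
        using False i poly_coeff_closed[OF r(1)]
        by (intro finsum_cong') (auto simp: companion_def coeff_vec_def)
      also have "\<dots> = coeff r (i - 1)"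
        using False i poly_coeff_closed[OF r(1)] by (intro finsum_singleton) auto
      finally show ?thesis using False by simp
    qed
    moreover have "(\<Oplus>k\<in>{..<n}. ?t k) = ?t (n - 1) \<oplus> (\<Oplus>k\<in>{..<n - 1}. ?t k)"
      unfolding ins by (rule finsum_insert) (use t f(2) in auto)
    moreover have "?t (n - 1) = \<ominus> c \<otimes> coeff f i"
    proof -
      have "companion n f $$ (i, n - 1) = \<ominus> coeff f i" "coeff_vec n r (n - 1) = c"
        using i f(2) by (simp_all add: companion_def coeff_vec_def c_def)
      thus ?thesis using c poly_coeff_closed[OF fc] m_comm[of c "coeff f i"] by (simp add: l_minus)
    qed
    ultimately have "(\<Oplus>k\<in>{..<n}. ?t k) = coeff s i"
      unfolding coeff_s using poly_coeff_closed[OF r(1)] poly_coeff_closed[OF fc] c by (simp add: a_comm)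
    thus "act n (companion n f) (coeff_vec n r) i = coeff_vec n s i"
      using i by (simp add: act_def coeff_vec_def)
  qed
  ultimately show ?thesis using that s len by blast
qed

lemma rmap_inj_short:
  assumes f: "f \<in> monics n" and r: "r \<in> carrier (poly_ring R)" "length r \<le> n"
    and s: "s \<in> carrier (poly_ring R)" "length s \<le> n" and eq: "rmap f r = rmap f s" and n: "n > 0"
  shows "r = s"
proof -
  note fc = monics_carrier[OF f]
  have "degree f = n" using f by (simp add: monics_iff)
  hence "r pmod f = r" "s pmod f = s"
    using pmod_const(2)[OF carrier_is_subfield _ fc] r s n by auto
  moreover have "r pmod f = s pmod f"
    using same_pmod_iff_pdivides[OF carrier_is_subfield r(1) s(1) fc] rmap_eq_iff[OF fc r(1) s(1)] eq by simp
  ultimately show ?thesis by metis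
qed

text \<open>The unit vector e_0 holds the coordinates of 1, and each application of the companion
  matrix multiplies by X; r is the remainder of X^m.\<close>

lemma companion_pow_act:
  assumes f: "f \<in> monics n" "n > 0"
  obtains r where "r \<in> carrier (poly_ring R)" "length r \<le> n"
    "act n (companion n f [^]\<^bsub>MR n\<^esub> (m :: nat)) (unitv n 0) = coeff_vec n r"
    "rmap f r = rmap f (X [^]\<^bsub>poly_ring R\<^esub> m)"
proof -
  interpret M: monoid "MR n" by (rule mat_ring_monoid)
  note fc = monics_carrier[OF f(1)] and Cc = companion_closed[OF f(1)]
  interpret H: ring_hom_ring "poly_ring R" "rupt f" "rmap f" by (rule rmap_hom[OF fc])
  have "\<exists>r. r \<in> carrier (poly_ring R) \<and> length r \<le> n \<and>
    act n (companion n f [^]\<^bsub>MR n\<^esub> m) (unitv n 0) = coeff_vec n r \<and>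
    rmap f r = rmap f (X [^]\<^bsub>poly_ring R\<^esub> m)"
  proof (induction m)
    case 0
    have "coeff_vec n \<one>\<^bsub>poly_ring R\<^esub> = unitv n 0"
      by (auto simp: coeff_vec_def unitv_def univ_poly_one intro!: restrict_ext)
    moreover have "length \<one>\<^bsub>poly_ring R\<^esub> \<le> n" using f(2) by (simp add: univ_poly_one)
    ultimately show ?case
      by (intro exI[of _ "\<one>\<^bsub>poly_ring R\<^esub>"]) (simp add: act_one)
  next
    case (Suc m)
    then obtain r where r: "r \<in> carrier (poly_ring R)" "length r \<le> n"
      "act n (companion n f [^]\<^bsub>MR n\<^esub> m) (unitv n 0) = coeff_vec n r"
      "rmap f r = rmap f (X [^]\<^bsub>poly_ring R\<^esub> m)" by blast
    obtain s where s: "s \<in> carrier (poly_ring R)" "length s \<le> n"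
      "act n (companion n f) (coeff_vec n r) = coeff_vec n s"
      "rmap f s = rmap f (r \<otimes>\<^bsub>poly_ring R\<^esub> X)"
      using companion_act[OF f r(1,2)] by blast
    have "act n (companion n f [^]\<^bsub>MR n\<^esub> Suc m) (unitv n 0) = coeff_vec n s"
      
      by (simp only: M.nat_pow_Suc2[OF Cc] act_mult[OF Cc M.nat_pow_closed[OF Cc] unitv_closed] r(3) s(3))
    moreover have "rmap f s = rmap f (X [^]\<^bsub>poly_ring R\<^esub> Suc m)"
      using s(4) r(1,4) X_closed by simp
    ultimately show ?case using s(1,2) by blast
  qed
  thus ?thesis using that by blast
qed

text \<open>For j < n the power X^j is already reduced. Thus e_0 is a cyclic vector, and its orbit
  begins with all the unit vectors.\<close>

lemma companion_pow_basis:
  assumes f: "f \<in> monics n" and j: "j < n"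
  shows "act n (companion n f [^]\<^bsub>MR n\<^esub> j) (unitv n 0) = unitv n j"
proof -
  have n: "n > 0" using j by simp
  obtain r where r: "r \<in> carrier (poly_ring R)" "length r \<le> n"
    "act n (companion n f [^]\<^bsub>MR n\<^esub> j) (unitv n 0) = coeff_vec n r"
    "rmap f r = rmap f (X [^]\<^bsub>poly_ring R\<^esub> j)"
    using companion_pow_act[OF f n] by blast
  have X: "monom \<one> j = X [^]\<^bsub>poly_ring R\<^esub> j" by (rule unitary_monom_eq_var_pow[OF carrier_is_subring])
  have "length (X [^]\<^bsub>poly_ring R\<^esub> j) \<le> n" unfolding X[symmetric] using j by (simp add: monom_def)
  hence "r = X [^]\<^bsub>poly_ring R\<^esub> j"
    using rmap_inj_short[OF f r(1,2) _ _ r(4) n] X_closed by simp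
  moreover have "coeff_vec n (monom \<one> j) = unitv n j"
    by (auto simp: coeff_vec_def unitv_def monom_coeff intro!: restrict_ext)
  ultimately show ?thesis using r(3) X by simp
qed

text \<open>Evaluation at e_0 translates C^m = C into X^m = X modulo f. Agreement at e_0 is enough,
  because every e_j is C^j e_0 and powers of C commute.\<close>

lemma companion_pow_eq_iff:
  assumes f: "f \<in> monics n" "n > 0"
  shows "companion n f [^]\<^bsub>MR n\<^esub> (m :: nat) = companion n f \<longleftrightarrow>
    f pdivides (X [^]\<^bsub>poly_ring R\<^esub> m \<ominus>\<^bsub>poly_ring R\<^esub> X)"
proof -
  interpret M: monoid "MR n" by (rule mat_ring_monoid)
  define C where "C = companion n f"
  note fc = monics_carrier[OF f(1)]
  have C: "C \<in> carrier (MR n)" using companion_closed[OF f(1)] by (simp add: C_def)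
  have Cp: "C [^]\<^bsub>MR n\<^esub> (k :: nat) \<in> carrier (MR n)" for k using C by simp
  obtain r where r: "r \<in> carrier (poly_ring R)" "length r \<le> n"
    "act n (C [^]\<^bsub>MR n\<^esub> m) (unitv n 0) = coeff_vec n r" "rmap f r = rmap f (X [^]\<^bsub>poly_ring R\<^esub> m)"
    using companion_pow_act[OF f] unfolding C_def by blast
  obtain s where s: "s \<in> carrier (poly_ring R)" "length s \<le> n"
    "act n (C [^]\<^bsub>MR n\<^esub> (1 :: nat)) (unitv n 0) = coeff_vec n s"
    "rmap f s = rmap f (X [^]\<^bsub>poly_ring R\<^esub> (1 :: nat))"
    using companion_pow_act[OF f] unfolding C_def by blast
  have one: "C [^]\<^bsub>MR n\<^esub> (1 :: nat) = C" "X [^]\<^bsub>poly_ring R\<^esub> (1 :: nat) = X"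
    using C X_closed by simp_all
  have "f pdivides (X [^]\<^bsub>poly_ring R\<^esub> m \<ominus>\<^bsub>poly_ring R\<^esub> X) \<longleftrightarrow> rmap f r = rmap f s"
    using rmap_eq_iff[OF fc, of "X [^]\<^bsub>poly_ring R\<^esub> m" X] X_closed r(4) s(4) one by simp
  also have "\<dots> \<longleftrightarrow> r = s" using rmap_inj_short[OF f(1) r(1,2) s(1,2) _ f(2)] by blast
  also have "\<dots> \<longleftrightarrow> coeff_vec n r = coeff_vec n s" using coeff_vec_inj[OF r(1) s(1) r(2) s(2)] by blast
  also have "\<dots> \<longleftrightarrow> act n (C [^]\<^bsub>MR n\<^esub> m) (unitv n 0) = act n C (unitv n 0)"
    using r(3) s(3) one by simp
  also have "\<dots> \<longleftrightarrow> C [^]\<^bsub>MR n\<^esub> m = C"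
  proof
    assume e0: "act n (C [^]\<^bsub>MR n\<^esub> m) (unitv n 0) = act n C (unitv n 0)"
    show "C [^]\<^bsub>MR n\<^esub> m = C"
    proof (rule mat_eqI[OF Cp C])
      fix j assume j: "j < n"
      have basis: "unitv n j = act n (C [^]\<^bsub>MR n\<^esub> j) (unitv n 0)"
        using companion_pow_basis[OF f(1) j] by (simp add: C_def)
      have "act n (C [^]\<^bsub>MR n\<^esub> m) (unitv n j) = act n (C [^]\<^bsub>MR n\<^esub> m \<otimes>\<^bsub>MR n\<^esub> C [^]\<^bsub>MR n\<^esub> j) (unitv n 0)"
        unfolding basis by (rule act_mult[OF Cp Cp unitv_closed, symmetric])
      also have "C [^]\<^bsub>MR n\<^esub> m \<otimes>\<^bsub>MR n\<^esub> C [^]\<^bsub>MR n\<^esub> j = C [^]\<^bsub>MR n\<^esub> j \<otimes>\<^bsub>MR n\<^esub> C [^]\<^bsub>MR n\<^esub> m"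
        using C by (simp add: M.nat_pow_mult add.commute)
      also have "act n \<dots> (unitv n 0) = act n (C [^]\<^bsub>MR n\<^esub> j) (act n C (unitv n 0))"
        unfolding e0[symmetric] by (rule act_mult[OF Cp Cp unitv_closed])
      also have "\<dots> = act n (C [^]\<^bsub>MR n\<^esub> j \<otimes>\<^bsub>MR n\<^esub> C) (unitv n 0)"
        by (rule act_mult[OF Cp C unitv_closed, symmetric])
      also have "C [^]\<^bsub>MR n\<^esub> j \<otimes>\<^bsub>MR n\<^esub> C = C \<otimes>\<^bsub>MR n\<^esub> C [^]\<^bsub>MR n\<^esub> j"
        using M.nat_pow_Suc2[OF C, of j] by simp
      also have "act n \<dots> (unitv n 0) = act n C (unitv n j)"
        unfolding basis by (rule act_mult[OF C Cp unitv_closed])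
      finally show "mat_col n (C [^]\<^bsub>MR n\<^esub> m) j = mat_col n C j"
        using C j by (simp add: act_unitv)
    qed
  qed simp
  finally show ?thesis by (simp add: C_def)
qed

section \<open>Conjugates of companion matrices\<close>

lemma intertwine_pow:
  assumes "A \<in> carrier (MR n)" "B \<in> carrier (MR n)" "C \<in> carrier (MR n)"
    "A \<otimes>\<^bsub>MR n\<^esub> B = B \<otimes>\<^bsub>MR n\<^esub> C"
  shows "A [^]\<^bsub>MR n\<^esub> (m :: nat) \<otimes>\<^bsub>MR n\<^esub> B = B \<otimes>\<^bsub>MR n\<^esub> C [^]\<^bsub>MR n\<^esub> m"
proof -
  interpret M: monoid "MR n" by (rule mat_ring_monoid)
  show ?thesis
  proof (induction m)
    case (Suc m)
    have "A [^]\<^bsub>MR n\<^esub> Suc m \<otimes>\<^bsub>MR n\<^esub> B = A [^]\<^bsub>MR n\<^esub> m \<otimes>\<^bsub>MR n\<^esub> (B \<otimes>\<^bsub>MR n\<^esub> C)"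
      using assms by (simp add: M.m_assoc)
    also have "\<dots> = (B \<otimes>\<^bsub>MR n\<^esub> C [^]\<^bsub>MR n\<^esub> m) \<otimes>\<^bsub>MR n\<^esub> C"
      using assms Suc by (simp flip: M.m_assoc)
    also have "\<dots> = B \<otimes>\<^bsub>MR n\<^esub> C [^]\<^bsub>MR n\<^esub> Suc m" using assms by (simp add: M.m_assoc)
    finally show ?case .
  qed (use assms in simp)
qed

text \<open>The conjugate alone does not determine B, which may be multiplied on the right by any
  unit commuting with the companion matrix. The image of the cyclic vector e_0 removes this
  freedom.\<close>

definition pair_of :: "nat \<Rightarrow> 'a mat \<times> 'a list \<Rightarrow> 'a mat \<times> (nat \<Rightarrow> 'a)" where
  "pair_of n = (\<lambda>(B, f). (B \<otimes>\<^bsub>MR n\<^esub> companion n f \<otimes>\<^bsub>MR n\<^esub> inv\<^bsub>MR n\<^esub> B, act n B (unitv n 0)))"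

text \<open>The inverse-free relation A B = B C is the form of conjugation that passes to powers and
  to columns.\<close>

lemma pair_of_intertwines:
  assumes "B \<in> Units (MR n)" "f \<in> monics n" "pair_of n (B, f) = (A, v)"
  shows "A \<in> carrier (MR n)" "v \<in> vecs n" "A \<otimes>\<^bsub>MR n\<^esub> B = B \<otimes>\<^bsub>MR n\<^esub> companion n f"
    "v = act n B (unitv n 0)"
proof -
  interpret M: monoid "MR n" by (rule mat_ring_monoid)
  have c: "B \<in> carrier (MR n)" "inv\<^bsub>MR n\<^esub> B \<in> carrier (MR n)" "companion n f \<in> carrier (MR n)"
    using assms companion_closed by auto
  have A: "A = B \<otimes>\<^bsub>MR n\<^esub> companion n f \<otimes>\<^bsub>MR n\<^esub> inv\<^bsub>MR n\<^esub> B" "v = act n B (unitv n 0)"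
    using assms(3) by (auto simp: pair_of_def)
  show "A \<in> carrier (MR n)" "v \<in> vecs n" "v = act n B (unitv n 0)"
    using A c act_closed by auto
  show "A \<otimes>\<^bsub>MR n\<^esub> B = B \<otimes>\<^bsub>MR n\<^esub> companion n f"
    unfolding A using assms(1) c by (simp add: M.m_assoc)
qed

text \<open>
  A pair \<open>(A, v)\<close> determines the columns \<open>A^j v\<close> of \<open>B\<close> and then the companion matrix \<open>B^(-1) A B\<close>.
\<close>

lemma inj_on_pair_of:
  assumes n: "n > 0"
  shows "inj_on (pair_of n) (Units (MR n) \<times> monics n)"
proof (rule inj_onI, clarify)
  interpret M: monoid "MR n" by (rule mat_ring_monoid)
  fix B f B' f'
  assume B: "B \<in> Units (MR n)" "f \<in> monics n" and B': "B' \<in> Units (MR n)" "f' \<in> monics n"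
    and eq: "pair_of n (B, f) = pair_of n (B', f')"
  obtain A v where Av: "pair_of n (B, f) = (A, v)" by fastforce
  note p = pair_of_intertwines[OF B Av]
  note p' = pair_of_intertwines[OF B' Av[unfolded eq]]
  have col: "mat_col n D j = act n (A [^]\<^bsub>MR n\<^esub> j) v"
    if D: "D \<in> carrier (MR n)" "g \<in> monics n" "A \<otimes>\<^bsub>MR n\<^esub> D = D \<otimes>\<^bsub>MR n\<^esub> companion n g"
      "v = act n D (unitv n 0)" "j < n" for D g j
  proof -
    note Cc = companion_closed[OF D(2)]
    have "mat_col n D j = act n D (act n (companion n g [^]\<^bsub>MR n\<^esub> j) (unitv n 0))"
      using companion_pow_basis[OF D(2,5)] act_unitv[OF D(1,5)] by simp
    also have "\<dots> = act n (D \<otimes>\<^bsub>MR n\<^esub> companion n g [^]\<^bsub>MR n\<^esub> j) (unitv n 0)"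
      using D(1) Cc by (simp add: act_mult)
    also have "D \<otimes>\<^bsub>MR n\<^esub> companion n g [^]\<^bsub>MR n\<^esub> j = A [^]\<^bsub>MR n\<^esub> j \<otimes>\<^bsub>MR n\<^esub> D"
      using intertwine_pow[OF p(1) D(1) Cc D(3)] by simp
    also have "act n \<dots> (unitv n 0) = act n (A [^]\<^bsub>MR n\<^esub> j) v"
      using D(1,4) p(1) by (simp add: act_mult)
    finally show ?thesis .
  qed
  have c: "B \<in> carrier (MR n)" "B' \<in> carrier (MR n)" using B B' by auto
  have BB: "B = B'"
    by (rule mat_eqI[OF c]) (use col[OF c(1) B(2) p(3,4)] col[OF c(2) B'(2) p'(3,4)] in simp)
  have "B \<otimes>\<^bsub>MR n\<^esub> companion n f = B \<otimes>\<^bsub>MR n\<^esub> companion n f'"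
    using p(3) p'(3) BB by simp
  hence "companion n f = companion n f'"
    using M.Units_l_cancel[OF B(1)] companion_closed B(2) B'(2) by blast
  thus "B = B' \<and> f = f'" using BB companion_inj[OF B(2) B'(2) n] by simp
qed

definition periodic_mats :: "nat \<Rightarrow> nat \<Rightarrow> 'a mat set" where
  "periodic_mats L n = {A \<in> carrier (MR n). \<exists>m>1. A [^]\<^bsub>MR n\<^esub> (L ^ m) = A}"

lemma pair_of_periodic:
  assumes "B \<in> Units (MR n)" "f \<in> monics n" "pair_of n (B, f) = (A, v)" "n > 0"
  shows "A \<in> periodic_mats L n \<longleftrightarrow> periodic_poly L f"
proof -
  interpret M: monoid "MR n" by (rule mat_ring_monoid)
  note p = pair_of_intertwines[OF assms(1-3)]
  note Cc = companion_closed[OF assms(2)]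
  have B: "B \<in> carrier (MR n)" using assms(1) by auto
  have "A [^]\<^bsub>MR n\<^esub> m = A \<longleftrightarrow> companion n f [^]\<^bsub>MR n\<^esub> m = companion n f" for m :: nat
  proof -
    have "A [^]\<^bsub>MR n\<^esub> m = A \<longleftrightarrow> A [^]\<^bsub>MR n\<^esub> m \<otimes>\<^bsub>MR n\<^esub> B = A \<otimes>\<^bsub>MR n\<^esub> B"
    proof
      assume "A [^]\<^bsub>MR n\<^esub> m \<otimes>\<^bsub>MR n\<^esub> B = A \<otimes>\<^bsub>MR n\<^esub> B"
      hence "A [^]\<^bsub>MR n\<^esub> m \<otimes>\<^bsub>MR n\<^esub> B \<otimes>\<^bsub>MR n\<^esub> inv\<^bsub>MR n\<^esub> B = A \<otimes>\<^bsub>MR n\<^esub> B \<otimes>\<^bsub>MR n\<^esub> inv\<^bsub>MR n\<^esub> B"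
        by simp
      thus "A [^]\<^bsub>MR n\<^esub> m = A" using assms(1) p(1) B by (simp add: M.m_assoc)
    qed simp
    also have "\<dots> \<longleftrightarrow> B \<otimes>\<^bsub>MR n\<^esub> companion n f [^]\<^bsub>MR n\<^esub> m = B \<otimes>\<^bsub>MR n\<^esub> companion n f"
      using intertwine_pow[OF p(1) B Cc p(3)] p(3) by simp
    also have "\<dots> \<longleftrightarrow> companion n f [^]\<^bsub>MR n\<^esub> m = companion n f"
      using assms(1) Cc by simp
    finally show ?thesis .
  qed
  thus ?thesis
    using p(1) companion_pow_eq_iff[OF assms(2,4)] by (simp add: periodic_mats_def periodic_poly_def)
qed

text \<open>The injection sends good polynomials to good matrices and bad ones to bad ones. The
  second inequality is u (q^n - c) <= (q^(n n) - P) q^n, rearranged so that no natural numbers are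
  subtracted.\<close>

lemma card_periodic_mats_bounds:
  fixes L n :: nat
  assumes n: "n > 0"
  defines "c \<equiv> card {f \<in> monics n. periodic_poly L f}"
    and "u \<equiv> card (Units (MR n))" and "q \<equiv> card (carrier R)" and "P \<equiv> card (periodic_mats L n)"
  shows "u * c \<le> P * q ^ n" "P * q ^ n + u * q ^ n \<le> q ^ (n * n) * q ^ n + u * c"
proof -
  let ?F = "{f \<in> monics n. periodic_poly L f}"
  have sub: "Units (MR n) \<subseteq> carrier (MR n)" by (auto simp: Units_def)
  have fin: "finite (Units (MR n))" "finite (periodic_mats L n)"
    using finite_subset[OF sub finite_mat_carrier] finite_mat_carrier by (auto simp: periodic_mats_def)
  have inj: "inj_on (pair_of n) (Units (MR n) \<times> S)" if "S \<subseteq> monics n" for S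
    by (rule inj_on_subset[OF inj_on_pair_of[OF n]]) (use that in auto)
  have "pair_of n ` (Units (MR n) \<times> ?F) \<subseteq> periodic_mats L n \<times> vecs n"
  proof (rule image_subsetI)
    fix x assume "x \<in> Units (MR n) \<times> ?F"
    then obtain B f where x: "x = (B, f)" "B \<in> Units (MR n)" "f \<in> monics n" "periodic_poly L f" by auto
    obtain A v where Av: "pair_of n (B, f) = (A, v)" by fastforce
    show "pair_of n x \<in> periodic_mats L n \<times> vecs n"
      using pair_of_periodic[OF x(2,3) Av n] pair_of_intertwines(2)[OF x(2,3) Av] Av x by simp
  qed
  hence "card (Units (MR n) \<times> ?F) \<le> card (periodic_mats L n \<times> vecs n)"
    using fin finite_vecs by (intro card_inj_on_le[OF inj]) auto
  thus "u * c \<le> P * q ^ n" by (simp add: u_def c_def P_def q_def card_cartesian_product card_vecs)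
  have "pair_of n ` (Units (MR n) \<times> (monics n - ?F)) \<subseteq> (carrier (MR n) - periodic_mats L n) \<times> vecs n"
  proof (rule image_subsetI)
    fix x assume "x \<in> Units (MR n) \<times> (monics n - ?F)"
    then obtain B f where x: "x = (B, f)" "B \<in> Units (MR n)" "f \<in> monics n" "\<not> periodic_poly L f" by auto
    obtain A v where Av: "pair_of n (B, f) = (A, v)" by fastforce
    show "pair_of n x \<in> (carrier (MR n) - periodic_mats L n) \<times> vecs n"
      using pair_of_periodic[OF x(2,3) Av n] pair_of_intertwines(1,2)[OF x(2,3) Av] Av x by simp
  qed
  hence "card (Units (MR n) \<times> (monics n - ?F)) \<le> card ((carrier (MR n) - periodic_mats L n) \<times> vecs n)"
    using finite_mat_carrier finite_vecs by (intro card_inj_on_le[OF inj]) auto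
  moreover have "card (monics n - ?F) = q ^ n - c"
    using finite_monics[of n] by (subst card_Diff_subset) (auto simp: card_monics c_def q_def)
  moreover have "card (carrier (MR n) - periodic_mats L n) = q ^ (n * n) - P"
    using fin(2) by (subst card_Diff_subset) (auto simp: card_mat_carrier P_def q_def periodic_mats_def)
  ultimately have le: "u * (q ^ n - c) \<le> (q ^ (n * n) - P) * q ^ n"
    by (simp add: u_def q_def card_cartesian_product card_vecs)
  have "c \<le> q ^ n" unfolding c_def q_def card_monics[symmetric] by (intro card_mono finite_monics) auto
  moreover have "P \<le> q ^ (n * n)"
    unfolding P_def q_def card_mat_carrier[symmetric] by (intro card_mono finite_mat_carrier) (auto simp: periodic_mats_def)
  ultimately obtain a b where "q ^ n = c + a" "q ^ (n * n) = P + b" by (metis le_Suc_ex)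
  thus "P * q ^ n + u * q ^ n \<le> q ^ (n * n) * q ^ n + u * c" using le by (simp add: algebra_simps)
qed

end

section \<open>The limit\<close>

lemma eventually_admissible:
  "(\<And>q. admissible L c q \<Longrightarrow> Q q) \<Longrightarrow> \<forall>\<^sub>F q in admissible_at_top L c. Q q"
  by (simp add: admissible_at_top_def eventually_inf_principal)

lemma filterlim_admissible: "filterlim real at_top (admissible_at_top L c)"
  unfolding admissible_at_top_def
  by (rule filterlim_mono[OF filterlim_real_sequentially order_refl inf_le1])

lemma admissibleD:
  assumes "admissible L c q" "c \<ge> 1"
  shows "q > 1" "primepow q" "L dvd q - 1" "multiplicity L (q - 1) = c"
    and "\<exists>p d. q = p ^ d \<and> prime (p :: nat)"
proof -
  obtain p d where pd: "prime p" "d > 0" "q = p ^ d"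
    using assms(1) unfolding admissible_def by blast
  show "q > 1" unfolding pd(3) by (rule one_less_power[OF prime_gt_1_nat[OF pd(1)] pd(2)])
  show "primepow q" unfolding primepow_def using pd by auto
  show m: "multiplicity L (q - 1) = c" using assms(1) by (simp add: admissible_def)
  thus "L dvd q - 1" using assms(2) not_dvd_imp_multiplicity_0 by fastforce
  show "\<exists>p d. q = p ^ d \<and> prime (p :: nat)" using pd by blast
qed

lemma tendsto_const_over_power:
  fixes x :: "'b \<Rightarrow> real"
  assumes "filterlim x at_top F" "m > 0"
  shows "((\<lambda>q. C / x q ^ m) \<longlongrightarrow> 0) F"
  by (rule real_tendsto_divide_at_top[OF tendsto_const filterlim_pow_at_top[OF assms(2,1)]])

lemma tendsto_power_ratio:
  fixes x :: "'b \<Rightarrow> real"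
  assumes x: "filterlim x at_top F" and "j < k"
  shows "((\<lambda>q. x q ^ j / x q ^ k) \<longlongrightarrow> 0) F"
proof (rule Lim_transform_eventually)
  show "((\<lambda>q. 1 / x q ^ (k - j)) \<longlongrightarrow> 0) F"
    using assms by (intro tendsto_const_over_power) auto
  have "\<forall>\<^sub>F q in F. x q > 0" using x by (auto simp: filterlim_at_top_dense)
  thus "\<forall>\<^sub>F q in F. 1 / x q ^ (k - j) = x q ^ j / x q ^ k"
  proof eventually_elim
    case (elim q)
    have "x q ^ k = x q ^ j * x q ^ (k - j)" using assms(2) by (simp flip: power_add)
    thus ?case using elim by simp
  qed
qed

text \<open>In the application x q = q and b = L^v, so (x^k - 1)/b is the degree N of the polynomial
  X^N - 1 whose factors are counted. All corrections have degree below k in x.\<close>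

lemma tendsto_density:
  fixes x :: "'b \<Rightarrow> real" and N :: "'b \<Rightarrow> real" and k :: nat and b :: real
  assumes x: "filterlim x at_top F" and k: "k \<ge> 1" and b: "b > 0"
    and upper: "\<forall>\<^sub>F q in F. real k * N q \<le> (x q ^ k - 1) / b + real k"
    and lower: "\<forall>\<^sub>F q in F. (x q ^ k - 1) / b \<le> real k * N q + (\<Sum>j<k. real j * x q ^ j)"
  shows "((\<lambda>q. N q / x q ^ k) \<longlongrightarrow> 1 / (real k * b)) F"
proof -
  have xpos: "\<forall>\<^sub>F q in F. x q > 0" using x by (auto simp: filterlim_at_top_dense)
  have "((\<lambda>q. real k * N q / x q ^ k) \<longlongrightarrow> 1 / b) F"
  proof (rule tendsto_sandwich)
    show "\<forall>\<^sub>F q in F. 1 / b - (1 / b) / x q ^ k - (\<Sum>j<k. real j * (x q ^ j / x q ^ k)) \<le> real k * N q / x q ^ k"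
      using lower xpos
    proof eventually_elim
      case (elim q)
      have "((x q ^ k - 1) / b - (\<Sum>j<k. real j * x q ^ j)) / x q ^ k \<le> real k * N q / x q ^ k"
        using elim by (intro divide_right_mono) auto
      moreover have "((x q ^ k - 1) / b - (\<Sum>j<k. real j * x q ^ j)) / x q ^ k
          = 1 / b - (1 / b) / x q ^ k - (\<Sum>j<k. real j * (x q ^ j / x q ^ k))"
        using elim by (simp add: diff_divide_distrib sum_divide_distrib)
      ultimately show ?case by simp
    qed
    show "\<forall>\<^sub>F q in F. real k * N q / x q ^ k \<le> 1 / b - (1 / b) / x q ^ k + real k / x q ^ k"
      using upper xpos
    proof eventually_elim
      case (elim q)
      have "real k * N q / x q ^ k \<le> ((x q ^ k - 1) / b + real k) / x q ^ k"
        using elim by (intro divide_right_mono) auto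
      also have "\<dots> = 1 / b - (1 / b) / x q ^ k + real k / x q ^ k"
        using elim by (simp add: diff_divide_distrib add_divide_distrib)
      finally show ?case .
    qed
    have s: "((\<lambda>q. \<Sum>j<k. real j * (x q ^ j / x q ^ k)) \<longlongrightarrow> (\<Sum>j<k. real j * 0)) F"
      by (intro tendsto_sum tendsto_mult tendsto_const tendsto_power_ratio[OF x]) auto
    have z: "((\<lambda>q. C / x q ^ k) \<longlongrightarrow> 0) F" for C
      using k by (intro tendsto_const_over_power[OF x]) auto
    show "((\<lambda>q. 1 / b - (1 / b) / x q ^ k - (\<Sum>j<k. real j * (x q ^ j / x q ^ k))) \<longlongrightarrow> 1 / b) F"
      using tendsto_diff[OF tendsto_diff[OF tendsto_const[of "1 / b"] z[of "1 / b"]] s] by simp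
    show "((\<lambda>q. 1 / b - (1 / b) / x q ^ k + real k / x q ^ k) \<longlongrightarrow> 1 / b) F"
      using tendsto_add[OF tendsto_diff[OF tendsto_const[of "1 / b"] z[of "1 / b"]] z[of "real k"]] by simp
  qed
  hence "((\<lambda>q. real k * N q / x q ^ k / real k) \<longlongrightarrow> 1 / b / real k) F"
    by (rule tendsto_divide[OF _ tendsto_const]) (use k in simp)
  thus ?thesis using k by (simp add: mult.commute)
qed

section \<open>Bounds over one fixed field\<close>

text \<open>The part of |F|^k - 1 prime to L is written as (|F|^k - 1)/L^v, an explicit function of
  |F| once v is known.\<close>

lemma (in finite_field) periodic_irreds_real_bounds:
  assumes q: "card (carrier R) = p ^ d" "prime (p :: nat)"
    and q1: "card (carrier R) > 1" and L: "prime (L :: nat)" and k: "k \<ge> 1"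
    and v: "multiplicity L (card (carrier R) ^ k - 1) = v"
  defines "N \<equiv> real (card (periodic_irreds L \<inter> irreds k))" and "x \<equiv> real (card (carrier R))"
  shows "real k * N \<le> (x ^ k - 1) / real L ^ v + real k"
    and "(x ^ k - 1) / real L ^ v \<le> real k * N + (\<Sum>j<k. real j * x ^ j)"
proof -
  have Q: "card (carrier R) ^ k > 1" using q1 k by (intro one_less_power) auto
  hence "card (carrier R) ^ k - 1 \<noteq> 0" by simp
  then obtain M where M: "card (carrier R) ^ k - 1 = L ^ v * M" "\<not> L dvd M"
    using multiplicity_decompose'[of "card (carrier R) ^ k - 1" L] L v by (metis not_prime_unit)
  have "L > 0" using L prime_gt_0_nat by blast
  have "real (card (carrier R) ^ k - 1) = x ^ k - 1" using Q by (simp add: x_def of_nat_diff)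
  hence "(x ^ k - 1) / real L ^ v = real M" using M(1) \<open>L > 0\<close> by (simp add: field_simps)
  moreover have "real (k * card (periodic_irreds L \<inter> irreds k)) \<le> real (M + k)"
    using card_periodic_irreds_bounds(1)[OF q q1 L _ M] k by (intro of_nat_mono) simp
  moreover have "real M \<le> real (k * card (periodic_irreds L \<inter> irreds k) + (\<Sum>j<k. j * card (carrier R) ^ j))"
    using card_periodic_irreds_bounds(2)[OF q q1 L _ M] k by (intro of_nat_mono) simp
  ultimately show "real k * N \<le> (x ^ k - 1) / real L ^ v + real k"
    and "(x ^ k - 1) / real L ^ v \<le> real k * N + (\<Sum>j<k. real j * x ^ j)"
    by (simp_all add: N_def x_def)
qed

lemma (in monoid) funpow_nat_pow:
  "x \<in> carrier G \<Longrightarrow> ((\<lambda>y. y [^] (L :: nat)) ^^ m) x = x [^] (L ^ m)"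
  by (induction m) (simp_all add: nat_pow_pow mult.commute)

lemma (in finite_field) Per_mat_ring:
  "Per (\<lambda>A. A [^]\<^bsub>MR n\<^esub> L) (carrier (MR n)) = periodic_mats L n"
  "Per (\<lambda>A. A [^]\<^bsub>MR n\<^esub> L) (Units (MR n)) = periodic_mats L n \<inter> Units (MR n)"
proof -
  interpret M: monoid "MR n" by (rule mat_ring_monoid)
  show "Per (\<lambda>A. A [^]\<^bsub>MR n\<^esub> L) (carrier (MR n)) = periodic_mats L n"
    by (auto simp: Per_def periodic_mats_def M.funpow_nat_pow)
  show "Per (\<lambda>A. A [^]\<^bsub>MR n\<^esub> L) (Units (MR n)) = periodic_mats L n \<inter> Units (MR n)"
    using M.Units_closed by (auto simp: Per_def periodic_mats_def M.funpow_nat_pow)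
qed

text \<open>Here u is the proportion of invertible matrices and c that of good polynomials. The
  bounds on P are the two counts from the injection after division; P and U u differ by at most the
  proportion 1 - u of singular matrices.\<close>

lemma (in finite_field) Per_ratio_bounds:
  fixes L n :: nat
  assumes n: "n > 0" and q1: "card (carrier R) > 1"
  defines "x \<equiv> real (card (carrier R))"
  defines "u \<equiv> real (card (Units (MR n))) / x ^ (n * n)"
    and "c \<equiv> real (card {f \<in> monics n. periodic_poly L f}) / x ^ n"
    and "P \<equiv> Per_ratio (\<lambda>A. A [^]\<^bsub>MR n\<^esub> L) (carrier (MR n))"
    and "U \<equiv> Per_ratio (\<lambda>A. A [^]\<^bsub>MR n\<^esub> L) (Units (MR n))"
  shows "1 - 1 / (x - 1) \<le> u" "u \<le> 1" "u * c \<le> P" "P \<le> 1 - u + u * c"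
    and "P - (1 - u) \<le> U * u" "U * u \<le> P"
proof -
  have x: "x > 1" using q1 by (simp add: x_def)
  have sub: "Units (MR n) \<subseteq> carrier (MR n)" by (auto simp: Units_def)
  have finU: "finite (Units (MR n))" by (rule finite_subset[OF sub finite_mat_carrier])
  have finP: "finite (periodic_mats L n)" using finite_mat_carrier by (simp add: periodic_mats_def)
  have le: "card (Units (MR n)) \<le> card (carrier (MR n))" by (rule card_mono[OF finite_mat_carrier sub])
  have cardM: "real (card (carrier (MR n))) = x ^ (n * n)" by (simp add: card_mat_carrier x_def)
  have nu: "real (card (carrier (MR n) - Units (MR n))) = x ^ (n * n) - real (card (Units (MR n)))"
    using card_Diff_subset[OF finU sub] le cardM by (simp add: of_nat_diff)
  have xx: "x ^ (n * n) > 0" "x ^ n > 0" using x by simp_all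
  have "real ((card (carrier R) - 1) * card (carrier (MR n) - Units (MR n))) \<le> real (card (carrier R) ^ (n * n))"
    by (rule of_nat_mono[OF card_non_units[OF n]])
  hence "(x - 1) * real (card (carrier (MR n) - Units (MR n))) \<le> x ^ (n * n)"
    using q1 by (simp add: x_def of_nat_diff)
  hence "(x - 1) * (x ^ (n * n) - real (card (Units (MR n)))) \<le> x ^ (n * n)"
    unfolding nu .
  hence "(x ^ (n * n) - real (card (Units (MR n)))) / x ^ (n * n) \<le> 1 / (x - 1)"
    using x xx by (simp add: field_simps)
  thus "1 - 1 / (x - 1) \<le> u" using x xx by (simp add: u_def diff_divide_distrib)
  show "u \<le> 1" using le xx by (simp add: u_def flip: cardM)
  have P: "P = real (card (periodic_mats L n)) / x ^ (n * n)"
    by (simp add: P_def Per_ratio_def Per_mat_ring cardM)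
  note b = card_periodic_mats_bounds[OF n, of L]
  note b = of_nat_mono[OF b(1), where ?'a = real] of_nat_mono[OF b(2), where ?'a = real]
  show "u * c \<le> P"
    using b(1) xx unfolding P u_def c_def by (simp add: field_simps flip: x_def)
  show "P \<le> 1 - u + u * c"
  proof -
    \<comment> \<open>Stated for arbitrary reals, so that the cardinalities stay opaque while both
      sides are divided by m a.\<close>
    have gen: "p / m \<le> 1 - w / m + w / m * (k / a)"
      if "p * a + w * a \<le> m * a + w * k" "m > 0" "a > 0" for p a w m k :: real
    proof -
      have "(p * a + w * a) / (m * a) \<le> (m * a + w * k) / (m * a)"
        using that by (intro divide_right_mono) auto
      moreover have "(p * a + w * a) / (m * a) = p / m + w / m"
        using that by (simp add: add_divide_distrib)
      moreover have "(m * a + w * k) / (m * a) = 1 + w / m * (k / a)"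
        using that by (simp add: add_divide_distrib)
      ultimately show ?thesis by linarith
    qed
    show ?thesis
      unfolding P u_def c_def by (rule gen[OF _ xx]) (use b(2) in \<open>simp flip: x_def\<close>)
  qed
  \<comment> \<open>Needed to cancel |GL_n|, the denominator of U, in the product U u.\<close>
  have "card (Units (MR n)) \<noteq> 0"
  proof -
    interpret M: monoid "MR n" by (rule mat_ring_monoid)
    have "\<one>\<^bsub>MR n\<^esub> \<in> Units (MR n)" by simp
    thus ?thesis using finU by auto
  qed
  hence Uu: "U * u = real (card (periodic_mats L n \<inter> Units (MR n))) / x ^ (n * n)"
    using xx by (simp add: U_def u_def Per_ratio_def Per_mat_ring)
  have "card (periodic_mats L n \<inter> Units (MR n)) \<le> card (periodic_mats L n)"
    by (rule card_mono[OF finP]) auto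
  thus "U * u \<le> P" unfolding Uu P using xx by (simp add: divide_right_mono)
  have "periodic_mats L n \<subseteq> (periodic_mats L n \<inter> Units (MR n)) \<union> (carrier (MR n) - Units (MR n))"
    by (auto simp: periodic_mats_def)
  hence "card (periodic_mats L n)
      \<le> card ((periodic_mats L n \<inter> Units (MR n)) \<union> (carrier (MR n) - Units (MR n)))"
    using finP finite_mat_carrier by (intro card_mono) auto
  also have "\<dots> \<le> card (periodic_mats L n \<inter> Units (MR n)) + card (carrier (MR n) - Units (MR n))"
    by (rule card_Un_le)
  finally have "real (card (periodic_mats L n))
      \<le> real (card (periodic_mats L n \<inter> Units (MR n))) + (x ^ (n * n) - real (card (Units (MR n))))"
    unfolding nu[symmetric] by linarith
  hence "real (card (periodic_mats L n)) / x ^ (n * n)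
      \<le> (real (card (periodic_mats L n \<inter> Units (MR n))) + (x ^ (n * n) - real (card (Units (MR n))))) / x ^ (n * n)"
    using xx by (intro divide_right_mono) auto
  thus "P - (1 - u) \<le> U * u"
    using x unfolding P Uu by (simp add: u_def add_divide_distrib diff_divide_distrib)
qed

theorem theorem1:
  fixes l L c q\<^sub>0 :: nat
    and F :: "nat \<Rightarrow> 'a ring"
  assumes "l \<ge> 2"
    and "prime L" and "L \<noteq> 2"
    and "c \<ge> 1"
    and "\<And>q. primepow q \<Longrightarrow> field (F q) \<and> card (carrier (F q)) = q"
    and "admissible L c q\<^sub>0"
  shows "let M = (\<lambda>q. mat_ring (F q) l);
             V = (\<Sum>P\<in>partitions l. \<Prod>k\<in>set_mset P.
                    1 / (real k ^ count P k * fact (count P k))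
                      * (1 / real L ^ (count P k * multiplicity L (q\<^sub>0 ^ k - 1))))
         in ((\<lambda>q. Per_ratio (\<lambda>x. x [^]\<^bsub>M q\<^esub> L) (carrier (M q))) \<longlongrightarrow> V) (admissible_at_top L c)
          \<and> ((\<lambda>q. Per_ratio (\<lambda>x. x [^]\<^bsub>M q\<^esub> L) (Units (M q))) \<longlongrightarrow> V) (admissible_at_top L c)"
proof -
  define FF where "FF = admissible_at_top L c"
  define v where "v k = c + multiplicity L k" for k
  \<comment> \<open>The limiting proportion of good irreducibles among the monic polynomials of
    degree k. It involves L, c and k but not q.\<close>
  define a where "a k = 1 / (real k * real L ^ v k)" for k
  have val: "multiplicity L (q ^ k - 1) = v k" if "admissible L c q" "k \<ge> 1" for q k
    using multiplicity_power_minus_1[OF assms(2,3) admissibleD(3,1)[OF that(1) assms(4)], of k]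
      admissibleD(4)[OF that(1) assms(4)] that(2) by (simp add: v_def)
  \<comment> \<open>The valuations at \<open>q\<^sub>0\<close> are replaced by \<open>v k\<close>,
    so the right-hand side no longer refers to a particular prime power.\<close>
  have V: "(\<Sum>P\<in>partitions l. \<Prod>k\<in>set_mset P. 1 / (real k ^ count P k * fact (count P k))
      * (1 / real L ^ (count P k * multiplicity L (q\<^sub>0 ^ k - 1)))) = partition_sum a l"
    unfolding partition_sum_def partition_weight_def
  proof (intro sum.cong prod.cong refl)
    fix P k assume P: "P \<in> partitions l" "k \<in> set_mset P"
    have "k \<ge> 1" using partition_member_le(1)[OF P] by simp
    thus "1 / (real k ^ count P k * fact (count P k)) * (1 / real L ^ (count P k * multiplicity L (q\<^sub>0 ^ k - 1)))
        = a k ^ count P k / fact (count P k)"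
      using val[OF assms(6)] by (simp add: a_def power_divide power_mult_distrib mult.commute flip: power_mult)
  qed
  \<comment> \<open>The family F is specified at prime powers only; every admissible q is one, so
    the locale is available along the filter.\<close>
  have ff: "finite_field (F q)" "card (carrier (F q)) = q" "q > 1"
    "\<exists>p d. card (carrier (F q)) = p ^ d \<and> prime (p :: nat)" if "admissible L c q" for q
  proof -
    note adm = admissibleD[OF that assms(4)]
    show card: "card (carrier (F q)) = q" and "q > 1" using assms(5) adm by auto
    moreover have "finite (carrier (F q))" using card adm(1) by (intro card_ge_0_finite) simp
    ultimately show "finite_field (F q)"
      using assms(5) adm(2) by (simp add: finite_field_def finite_field_axioms_def)
    show "\<exists>p d. card (carrier (F q)) = p ^ d \<and> prime (p :: nat)" using card adm(5) by simp
  qed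
  define A where "A q = finite_field.periodic_irreds (F q) L" for q
  define N where "N q k = real (card (A q \<inter> finite_field.irreds (F q) k))" for q k
  define G where "G q n = real (card (finite_field.smooth (F q) (A q) n))" for q n
  define H where "H q n = real (card (finite_field.smooth_sf (F q) (A q) n))" for q n
  define C where "C q = real (card {f \<in> finite_field.monics (F q) l. finite_field.periodic_poly (F q) L f})" for q
  define u where "u q = real (card (Units (mat_ring (F q) l))) / real q ^ (l * l)" for q
  define P where "P q = Per_ratio (\<lambda>x. x [^]\<^bsub>mat_ring (F q) l\<^esub> L) (carrier (mat_ring (F q) l))" for q
  define U where "U q = Per_ratio (\<lambda>x. x [^]\<^bsub>mat_ring (F q) l\<^esub> L) (Units (mat_ring (F q) l))" for q
  have x: "filterlim real at_top FF" unfolding FF_def by (rule filterlim_admissible)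
  have ev: "\<forall>\<^sub>F q in FF. Q q" if "\<And>q. admissible L c q \<Longrightarrow> Q q" for Q
    unfolding FF_def using that by (rule eventually_admissible)
  have Npos: "real L ^ v k > 0" for k using prime_gt_0_nat[OF assms(2)] by simp
  have N: "((\<lambda>q. N q k / real q ^ k) \<longlongrightarrow> a k) FF" if k: "k \<ge> 1" for k
    unfolding a_def
  proof (rule tendsto_density[OF x k Npos])
    have *: "real k * N q k \<le> (real q ^ k - 1) / real L ^ v k + real k \<and>
        (real q ^ k - 1) / real L ^ v k \<le> real k * N q k + (\<Sum>j<k. real j * real q ^ j)"
      if q: "admissible L c q" for q
    proof -
      obtain p d where pd: "card (carrier (F q)) = p ^ d" "prime (p :: nat)" using ff(4)[OF q] by blast
      show ?thesis
        using finite_field.periodic_irreds_real_bounds[OF ff(1)[OF q] pd _ assms(2) k, of "v k"] val[OF q k] ff(2,3)[OF q]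
        by (simp add: N_def A_def)
    qed
    show "\<forall>\<^sub>F q in FF. real k * N q k \<le> (real q ^ k - 1) / real L ^ v k + real k"
      using * by (intro ev) blast
    show "\<forall>\<^sub>F q in FF. (real q ^ k - 1) / real L ^ v k \<le> real k * N q k + (\<Sum>j<k. real j * real q ^ j)"
      using * by (intro ev) blast
  qed
  have lim: "((\<lambda>q. G q l / real q ^ l) \<longlongrightarrow> partition_sum a l) FF
      \<and> ((\<lambda>q. H q l / real q ^ l) \<longlongrightarrow> partition_sum a l) FF"
  proof (rule tendsto_partition_sum[OF x N])
    show "\<forall>\<^sub>F q in FF. G q 0 = 1 \<and> H q 0 = 1"
      by (rule ev) (simp add: G_def H_def finite_field.smooth_0[OF ff(1)])
    show "\<forall>\<^sub>F q in FF. H q n \<le> G q n" for n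
      by (rule ev) (simp add: G_def H_def finite_field.card_smooth_sf_le[OF ff(1)])
    show "\<forall>\<^sub>F q in FF. real n * H q n \<le> (\<Sum>k=1..n. real k * N q k * G q (n - k))" for n
    proof (rule ev)
      fix q assume q: "admissible L c q"
      show "real n * H q n \<le> (\<Sum>k=1..n. real k * N q k * G q (n - k))"
        using of_nat_mono[OF finite_field.card_smooth_sf_upper[OF ff(1)[OF q], of n "A q"], where ?'a = real]
        by (simp add: H_def N_def G_def)
    qed
    show "\<forall>\<^sub>F q in FF. (\<Sum>k=1..n. real k * N q k * G q (n - k)) \<le> real n * G q n" for n
    proof (rule ev)
      fix q assume q: "admissible L c q"
      show "(\<Sum>k=1..n. real k * N q k * G q (n - k)) \<le> real n * G q n"
        using of_nat_mono[OF finite_field.card_smooth_lower[OF ff(1)[OF q], of "A q" n], where ?'a = real]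
        by (simp add: N_def G_def)
    qed
    show "\<forall>\<^sub>F q in FF. G q n \<le> H q n + (\<Sum>k=1..n div 2. N q k * G q (n - 2 * k))" for n
    proof (rule ev)
      fix q assume q: "admissible L c q"
      show "G q n \<le> H q n + (\<Sum>k=1..n div 2. N q k * G q (n - 2 * k))"
        using of_nat_mono[OF finite_field.card_smooth_diff[OF ff(1)[OF q], of "A q" n], where ?'a = real]
        by (simp add: H_def N_def G_def)
    qed
  qed
  have C: "((\<lambda>q. C q / real q ^ l) \<longlongrightarrow> partition_sum a l) FF"
  proof (rule tendsto_sandwich)
    show "((\<lambda>q. H q l / real q ^ l) \<longlongrightarrow> partition_sum a l) FF"
      "((\<lambda>q. G q l / real q ^ l) \<longlongrightarrow> partition_sum a l) FF" using lim by auto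
    show "\<forall>\<^sub>F q in FF. H q l / real q ^ l \<le> C q / real q ^ l"
      by (rule ev) (simp add: H_def C_def A_def divide_right_mono finite_field.card_periodic_bounds[OF ff(1)])
    show "\<forall>\<^sub>F q in FF. C q / real q ^ l \<le> G q l / real q ^ l"
      by (rule ev) (simp add: G_def C_def A_def divide_right_mono finite_field.card_periodic_bounds[OF ff(1)])
  qed
  have bounds: "1 - 1 / (real q - 1) \<le> u q \<and> u q \<le> 1 \<and> u q * (C q / real q ^ l) \<le> P q
      \<and> P q \<le> 1 - u q + u q * (C q / real q ^ l) \<and> P q - (1 - u q) \<le> U q * u q \<and> U q * u q \<le> P q"
    if q: "admissible L c q" for q
    using finite_field.Per_ratio_bounds(1-2)[OF ff(1)[OF q], where n = l]
      finite_field.Per_ratio_bounds(3-6)[OF ff(1)[OF q], where n = l and L = L] ff(2,3)[OF q] assms(1)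
    by (simp add: u_def C_def P_def U_def)
  have u: "(u \<longlongrightarrow> 1) FF"
  proof (rule tendsto_sandwich)
    have "filterlim (\<lambda>q. - 1 + real q) at_top FF" by (rule filterlim_tendsto_add_at_top[OF tendsto_const x])
    hence "((\<lambda>q. 1 / (- 1 + real q)) \<longlongrightarrow> 0) FF" by (rule real_tendsto_divide_at_top[OF tendsto_const])
    hence "((\<lambda>q. 1 - 1 / (- 1 + real q)) \<longlongrightarrow> 1 - 0) FF" by (intro tendsto_diff tendsto_const)
    thus "((\<lambda>q. 1 - 1 / (real q - 1)) \<longlongrightarrow> 1) FF" by simp
    show "((\<lambda>_. 1) \<longlongrightarrow> (1 :: real)) FF" by (rule tendsto_const)
  qed (use bounds in \<open>auto intro!: ev\<close>)
  have uC: "((\<lambda>q. u q * (C q / real q ^ l)) \<longlongrightarrow> partition_sum a l) FF"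
    using tendsto_mult[OF u C] by simp
  have P: "(P \<longlongrightarrow> partition_sum a l) FF"
  proof (rule tendsto_sandwich[OF _ _ uC])
    show "((\<lambda>q. 1 - u q + u q * (C q / real q ^ l)) \<longlongrightarrow> partition_sum a l) FF"
      using tendsto_add[OF tendsto_diff[OF tendsto_const[of 1] u] uC] by simp
  qed (use bounds in \<open>auto intro!: ev\<close>)
  \<comment> \<open>The bounds compare U u, not U, with P; the factor u is divided out at the end
    because it tends to 1.\<close>
  have "((\<lambda>q. U q * u q) \<longlongrightarrow> partition_sum a l) FF"
  proof (rule tendsto_sandwich[OF _ _ _ P])
    show "((\<lambda>q. P q - (1 - u q)) \<longlongrightarrow> partition_sum a l) FF"
      using tendsto_diff[OF P tendsto_diff[OF tendsto_const[of 1] u]] by simp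
  qed (use bounds in \<open>auto intro!: ev\<close>)
  hence Uu: "((\<lambda>q. U q * u q / u q) \<longlongrightarrow> partition_sum a l / 1) FF"
    by (rule tendsto_divide[OF _ u]) simp
  have "\<forall>\<^sub>F q in FF. u q > 0" by (rule order_tendstoD(1)[OF u]) simp
  hence "\<forall>\<^sub>F q in FF. U q * u q / u q = U q" by eventually_elim simp
  hence "(U \<longlongrightarrow> partition_sum a l) FF" using Lim_transform_eventually[OF Uu] by simp
  thus ?thesis using P unfolding Let_def V FF_def P_def[abs_def] U_def[abs_def] by simp
qed

end
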